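(* Let $G$ be a linear algebraic group over $\mathbb{R}$ with $G(\mathbb{R})$ compact, let $V$ be an affine $G$-variety over $\mathbb{R}$, and let $\pi\colon V\to W=V/\!/G$ be the quotient morphism. Let $K\subset V(\mathbb{R})$ be basic closed and $G$-invariant, and let $N$ be a quadratic module in $\mathbb{R}[W]=\mathbb{R}[V]^G$. The following are equivalent: (i) $N$ solves the invariant $K$-moment problem; (ii) $\overline N=\mathscr P_W(\pi K)$; (iii) $N$ solves the (usual) $\pi(K)$-moment problem in $W$.
   Context: An affine $\mathbb{R}$-variety is a reduced affine scheme of finite type over $\mathbb{R}$. Standing assumption: $G(\mathbb{R})$ is Zariski dense in $G$; $G$ is reductive since $G(\mathbb{R})$ is compact. An affine $G$-variety is an affine $\mathbb{R}$-variety $V$ with an action $G\times V\to V$ by a morphism; $G(\mathbb{R})$ acts on $\mathbb{R}[V]$ by $f^g(x)=f(gx)$; $V/\!/G$ is the affine variety with coordinate ring $\mathbb{R}[V]^G$ and $\pi$ is induced by $\mathbb{R}[V]^G\subset\mathbb{R}[V]$. $G$-invariant subsets are those stable under $G(\mathbb{R})$. A linear functional $L\colon\mathbb{R}[V]\to\mathbb{R}$ is $G$-invariant if $L(f^g)=L(f)$ for all $f\in\mathbb{R}[V]$, $g\in G(\mathbb{R})$. A set in $V(\mathbb{R})$ is basic closed if it is of the form $\{f_1\ge0,\dots,f_r\ge0\}$ with $f_i\in\mathbb{R}[V]$. A quadratic module in a ring $A$ is a subset $M$ with $1\in M$, $M+M\subset M$, $a^2M\subset M$ for all $a\in A$. $\mathscr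 P_W(\pi K)=\{f\in\mathbb{R}[W]\colon f\ge0\text{ on }\pi(K)\}$. $\overline N$ is the closure of $N$ in $\mathbb{R}[W]$ with respect to the finest locally convex vector space topology. "Measure" means (positive) Borel measure for which all functions in the relevant coordinate ring are integrable. $N$ solves the invariant $K$-moment problem if for every $G$-invariant linear functional $L\colon\mathbb{R}[V]\to\mathbb{R}$: there exists a $G$-invariant measure $\mu$ on $K$ with $L(f)=\int_Kf\,d\mu$ for all $f\in\mathbb{R}[V]$ if and only if $L(f)\ge0$ for every $f\in N$. (For $G$-invariant $L$, the existence of such a $G$-invariant $\mu$ is equivalent to each of: there is a measure $\mu$ on $K$ with $L(f)=\int_K f\,d\mu$ for all $f\in\mathbb{R}[V]^G$; there is a measure $\nu$ on $\pi(K)$ with $L(f)=\int_{\pi(K)}f\,d\nu$ for all $f\in\mathbb{R}[W]$; $L(f)\ge0$ for all $f\in\mathscr P_W(\pi K)$.) $N$ solves the (usual) $\pi(K)$-moment problem in $W$ if the linear functionals $F\colon\mathbb{R}[W]\to\mathbb{R}$ with $F|_N\ge0$ are precisely those of the form $F(f)=\int_{\pi(K)}f\,d\nu$ with $\nu$ a Borel measure on $\pi(K)$. *)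

theory Defs
  imports "HOL-Analysis.Analysis"
begin

section \<open>Affine real varieties\<close>

text \<open>
  Commutative unital \<open>\<real>\<close>-algebras. In contrast to \<^class>\<open>comm_ring_1\<close>, the case \<open>0 = 1\<close> is
  allowed, so that the empty variety is not excluded.
\<close>

class real_comm_algebra = real_algebra + comm_ring + comm_monoid_mult

definition subalgebra :: "'a::real_comm_algebra set \<Rightarrow> bool" where
  "subalgebra B \<longleftrightarrow> subspace B \<and> 1 \<in> B \<and> (\<forall>a\<in>B. \<forall>b\<in>B. a * b \<in> B)"

text \<open>
  A reduced affine scheme of finite type over \<open>\<real>\<close> is given by its coordinate ring, a finitely
  generated reduced \<open>\<real>\<close>-algebra. Its real points need not be Zariski dense, so the elements of
  the coordinate ring are not functions on the real points.
\<close>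

definition affine_coordinate_ring :: "'a::real_comm_algebra set \<Rightarrow> bool" where
  "affine_coordinate_ring B \<longleftrightarrow>
     subalgebra B \<and>
     (\<exists>S. finite S \<and> S \<subseteq> B \<and> subalgebra hull S = B) \<and>
     (\<forall>a\<in>B. \<forall>n::nat. a ^ n = 0 \<longrightarrow> a = 0)"

text \<open>
  Real points of the scheme with coordinate ring \<open>B\<close>, as \<open>\<real>\<close>-algebra homomorphisms \<open>B \<rightarrow> \<real>\<close>.
  The value of \<open>f\<close> at the point \<open>x\<close> is thus \<open>x f\<close>. A homomorphism is extended
  by \<^const>\<open>undefined\<close> outside \<open>B\<close>, which makes its representation as a total function unique.
\<close>

definition real_points :: "'a::real_comm_algebra set \<Rightarrow> ('a \<Rightarrow> real) set" where
  "real_points B = {x \<in> extensional B.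
     x 1 = 1 \<and>
     (\<forall>a\<in>B. \<forall>b\<in>B. x (a + b) = x a + x b) \<and>
     (\<forall>a\<in>B. \<forall>b\<in>B. x (a * b) = x a * x b) \<and>
     (\<forall>c. \<forall>a\<in>B. x (c *\<^sub>R a) = c * x a)}"

text \<open>
  The Euclidean topology on the real points: the coarsest one in which all evaluations
  \<open>x \<mapsto> x f\<close> are continuous.
\<close>

definition points_topology :: "'a::real_comm_algebra set \<Rightarrow> ('a \<Rightarrow> real) topology" where
  "points_topology B = subtopology (product_topology (\<lambda>_. euclideanreal) B) (real_points B)"

definition basic_closed :: "'a::real_comm_algebra set \<Rightarrow> ('a \<Rightarrow> real) set \<Rightarrow> bool" where
  "basic_closed B K \<longleftrightarrow>
     (\<exists>S. finite S \<and> S \<subseteq> B \<and> K = {x \<in> real_points B. \<forall>f\<in>S. 0 \<le> x f})"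

definition quadratic_module :: "'a::real_comm_algebra set \<Rightarrow> 'a set \<Rightarrow> bool" where
  "quadratic_module B M \<longleftrightarrow>
     M \<subseteq> B \<and> 1 \<in> M \<and> (\<forall>f\<in>M. \<forall>g\<in>M. f + g \<in> M) \<and> (\<forall>a\<in>B. \<forall>f\<in>M. a ^ 2 * f \<in> M)"

definition nonneg_on :: "'a::real_comm_algebra set \<Rightarrow> ('a \<Rightarrow> real) set \<Rightarrow> 'a set" where
  "nonneg_on B X = {f \<in> B. \<forall>x\<in>X. 0 \<le> x f}"


section \<open>The finest locally convex topology\<close>

definition locally_convex_vector_topology :: "'a::real_vector set \<Rightarrow> 'a topology \<Rightarrow> bool" where
  "locally_convex_vector_topology E T \<longleftrightarrow>
     topspace T = E \<and>
     continuous_map (prod_topology T T) T (\<lambda>(x, y). x + y) \<and>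
     continuous_map (prod_topology euclideanreal T) T (\<lambda>(c, x). c *\<^sub>R x) \<and>
     (\<forall>U. openin T U \<and> 0 \<in> U \<longrightarrow>
        (\<exists>O' C. openin T O' \<and> convex C \<and> 0 \<in> O' \<and> O' \<subseteq> C \<and> C \<subseteq> U))"

definition finest_locally_convex_topology :: "'a::real_vector set \<Rightarrow> 'a topology" where
  "finest_locally_convex_topology E =
     topology_generated_by {U. \<exists>T. locally_convex_vector_topology E T \<and> openin T U}"

lemma openin_finest_locally_convex_topology:
  assumes "locally_convex_vector_topology E T" and "openin T U"
  shows "openin (finest_locally_convex_topology E) U"
  unfolding finest_locally_convex_topology_def
  by (rule topology_generated_by_Basis) (use assms in blast)

text \<open>The supremum of all locally convex vector space topologies is again of this kind.\<close>

lemma locally_convex_vector_topology_finest: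
  assumes E: "subspace E"
  shows "locally_convex_vector_topology E (finest_locally_convex_topology E)"
proof -
  let ?S = "{U. \<exists>T. locally_convex_vector_topology E T \<and> openin T U}"
  let ?F = "finest_locally_convex_topology E"
  have triv_top: "istopology (\<lambda>U. U = {} \<or> U = E)"
    unfolding istopology_def by blast
  define T0 where "T0 = topology (\<lambda>U. U = {} \<or> U = E)"
  have o0: "openin T0 U \<longleftrightarrow> U = {} \<or> U = E" for U
    unfolding T0_def using topology_inverse'[OF triv_top] by simp
  have t0: "topspace T0 = E"
    unfolding topspace_def o0 by auto
  have cont0: "continuous_map X T0 f" if "\<And>x. x \<in> topspace X \<Longrightarrow> f x \<in> E" for X f
  proof -
    have "openin X {x \<in> topspace X. f x \<in> U}" if "openin T0 U" for U
    proof -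
      have "U = {} \<or> U = E" using that o0 by simp
      then show ?thesis
      proof
        assume "U = {}"
        then show ?thesis by simp
      next
        assume "U = E"
        then have "{x \<in> topspace X. f x \<in> U} = topspace X"
          using \<open>\<And>x. x \<in> topspace X \<Longrightarrow> f x \<in> E\<close> by blast
        then show ?thesis by simp
      qed
    qed
    then show ?thesis
      unfolding continuous_map_def using that t0 by auto
  qed
  have lc0: "locally_convex_vector_topology E T0"
    unfolding locally_convex_vector_topology_def
  proof (intro conjI allI impI)
    show "continuous_map (prod_topology T0 T0) T0 (\<lambda>(x, y). x + y)"
      by (rule cont0) (use E in \<open>auto simp: t0 subspace_add\<close>)
    show "continuous_map (prod_topology euclideanreal T0) T0 (\<lambda>(c, x). c *\<^sub>R x)"
      by (rule cont0) (use E in \<open>auto simp: t0 subspace_scale\<close>)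
    fix U assume "openin T0 U \<and> 0 \<in> U"
    then show "\<exists>O' C. openin T0 O' \<and> convex C \<and> 0 \<in> O' \<and> O' \<subseteq> C \<and> C \<subseteq> U"
      using o0 subspace_imp_convex[OF E] by blast
  qed (rule t0)
  have sub: "U \<subseteq> E" if "U \<in> ?S" for U
    using that openin_subset by (fastforce simp: locally_convex_vector_topology_def)
  have "E \<in> ?S"
    using lc0 o0 by blast
  then have top: "topspace ?F = E"
    unfolding finest_locally_convex_topology_def topology_generated_by_topspace using sub by blast
  have finer: "continuous_map ?F T id" if "locally_convex_vector_topology E T" for T
  proof -
    have "topspace T = E"
      using that by (simp add: locally_convex_vector_topology_def)
    moreover have "{x \<in> E. id x \<in> U} = U" if "openin T U" for U
      using openin_subset[OF that] calculation by auto
    ultimately show ?thesis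
      using openin_finest_locally_convex_topology[OF that] top
      by (auto simp: continuous_map_def)
  qed
  have contF: "continuous_map X ?F f"
    if *: "\<And>T. locally_convex_vector_topology E T \<Longrightarrow> continuous_map X T f" for X f
    unfolding finest_locally_convex_topology_def
  proof (rule continuous_on_generated_topo)
    fix U assume "U \<in> ?S"
    then obtain T where "locally_convex_vector_topology E T" "openin T U" by blast
    then have "openin X {x \<in> topspace X. f x \<in> U}"
      using * openin_continuous_map_preimage by blast
    then show "openin X (f -` U \<inter> topspace X)"
      by (simp add: vimage_def Int_def conj_commute)
  next
    have "f ` topspace X \<subseteq> E"
      using *[OF lc0] t0 by (auto simp: continuous_map_def)
    then show "f ` topspace X \<subseteq> \<Union>?S"
      using \<open>E \<in> ?S\<close> by blast
  qed
  show ?thesis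
    unfolding locally_convex_vector_topology_def
  proof (intro conjI allI impI)
    show "topspace ?F = E" by (rule top)
    show "continuous_map (prod_topology ?F ?F) ?F (\<lambda>(x, y). x + y)"
    proof (rule contF)
      fix T assume T: "locally_convex_vector_topology E T"
      then have c: "continuous_map (prod_topology T T) T (\<lambda>(x, y). x + y)"
        by (simp add: locally_convex_vector_topology_def)
      have "continuous_map (prod_topology ?F ?F) (prod_topology T T) (\<lambda>(x, y). (id x, id y))"
        using finer[OF T] by (simp only: continuous_map_prod_top) simp
      from continuous_map_compose[OF this c]
      show "continuous_map (prod_topology ?F ?F) T (\<lambda>(x, y). x + y)"
        by (simp add: o_def case_prod_unfold)
    qed
    show "continuous_map (prod_topology euclideanreal ?F) ?F (\<lambda>(c, x). c *\<^sub>R x)"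
    proof (rule contF)
      fix T assume T: "locally_convex_vector_topology E T"
      then have c: "continuous_map (prod_topology euclideanreal T) T (\<lambda>(c, x). c *\<^sub>R x)"
        by (simp add: locally_convex_vector_topology_def)
      have "continuous_map (prod_topology euclideanreal ?F) (prod_topology euclideanreal T)
              (\<lambda>(x, y). (id x, id y))"
        using finer[OF T] by (simp only: continuous_map_prod_top) simp
      from continuous_map_compose[OF this c]
      show "continuous_map (prod_topology euclideanreal ?F) T (\<lambda>(c, x). c *\<^sub>R x)"
        by (simp add: o_def case_prod_unfold)
    qed
    fix U assume U: "openin ?F U \<and> 0 \<in> U"
    then have "generate_topology_on ?S U"
      by (simp add: finest_locally_convex_topology_def openin_topology_generated_by_iff)
    then have "0 \<in> U \<longrightarrow> (\<exists>O' C. openin ?F O' \<and> convex C \<and> 0 \<in> O' \<and> O' \<subseteq> C \<and> C \<subseteq> U)"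
    proof (induction rule: generate_topology_on.induct)
      case Empty
      then show ?case by simp
    next
      case (Int a b)
      show ?case
      proof
        assume "0 \<in> a \<inter> b"
        then obtain P C Q D where
          "openin ?F P" "convex C" "0 \<in> P" "P \<subseteq> C" "C \<subseteq> a"
          "openin ?F Q" "convex D" "0 \<in> Q" "Q \<subseteq> D" "D \<subseteq> b"
          using Int.IH by blast
        then show "\<exists>O' C. openin ?F O' \<and> convex C \<and> 0 \<in> O' \<and> O' \<subseteq> C \<and> C \<subseteq> a \<inter> b"
          by (intro exI[of _ "P \<inter> Q"] exI[of _ "C \<inter> D"]) (auto intro: convex_Int)
      qed
    next
      case (UN K)
      then show ?case by (meson Union_iff Union_upper subset_trans)
    next
      case (Basis s)
      then obtain T where T: "locally_convex_vector_topology E T" "openin T s" by blast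
      show ?case
      proof
        assume "0 \<in> s"
        have "openin T s \<and> 0 \<in> s \<longrightarrow>
            (\<exists>O' C. openin T O' \<and> convex C \<and> 0 \<in> O' \<and> O' \<subseteq> C \<and> C \<subseteq> s)"
          using T(1) by (simp add: locally_convex_vector_topology_def)
        with T(2) \<open>0 \<in> s\<close> obtain P C
          where P: "openin T P" and C: "convex C \<and> 0 \<in> P \<and> P \<subseteq> C \<and> C \<subseteq> s"
          by auto
        show "\<exists>O' C. openin ?F O' \<and> convex C \<and> 0 \<in> O' \<and> O' \<subseteq> C \<and> C \<subseteq> s"
          by (rule exI[of _ P], rule exI[of _ C])
             (use openin_finest_locally_convex_topology[OF T(1) P] C in simp)
      qed
    qed
    then show "\<exists>O' C. openin ?F O' \<and> convex C \<and> 0 \<in> O' \<and> O' \<subseteq> C \<and> C \<subseteq> U"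
      using U by blast
  qed
qed


section \<open>Linear algebraic groups and their actions\<close>

text \<open>
  A linear algebraic group \<open>G\<close> over \<open>\<real>\<close> whose real points are Zariski dense is determined by the
  group \<open>G(\<real>)\<close>, a Zariski closed subgroup of some \<open>GL\<^sub>n(\<real>)\<close>; conversely each such subgroup is
  \<open>G(\<real>)\<close> for its Zariski closure \<open>G\<close> in \<open>GL\<^sub>n\<close>. So \<open>G\<close> is represented by \<open>G(\<real>)\<close>.
  On the finite-dimensional space of matrices, \<^const>\<open>real_polynomial_function\<close> describes the
  polynomials in the matrix entries.
\<close>

definition linear_algebraic_group :: "(real^'n^'n) set \<Rightarrow> bool" where
  "linear_algebraic_group G \<longleftrightarrow>
     (\<exists>P. (\<forall>p\<in>P. real_polynomial_function p) \<and> G = {g. invertible g \<and> (\<forall>p\<in>P. p g = 0)}) \<and>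
     mat 1 \<in> G \<and> (\<forall>g\<in>G. \<forall>h\<in>G. g ** h \<in> G) \<and> (\<forall>g\<in>G. matrix_inv g \<in> G)"

text \<open>
  The coordinate ring \<open>\<real>[G]\<close>, generated by the matrix entries and the inverse of the determinant.
  By density, its elements are determined by their values on \<open>G(\<real>)\<close>.
\<close>

definition regular_function_on :: "(real^'n^'n) set \<Rightarrow> (real^'n^'n \<Rightarrow> real) \<Rightarrow> bool" where
  "regular_function_on G p \<longleftrightarrow>
     (\<exists>q k. real_polynomial_function q \<and> (\<forall>g\<in>G. p g = q g / det g ^ k))"

text \<open>
  An action \<open>G \<times> V \<rightarrow> V\<close> by a morphism, where \<open>\<real>[V]\<close> is the whole type. It is given by the
  operators \<open>act g f = f\<^sup>g\<close>, \<open>f\<^sup>g(x) = f(gx)\<close>; as \<open>f \<mapsto> f\<^sup>g\<close> is a right action, \<open>f\<^sup>g\<^sup>h = (f\<^sup>g)\<^sup>h\<close>.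
  The last conjunct says that \<open>g \<mapsto> f\<^sup>g\<close> lies in \<open>\<real>[G] \<otimes> \<real>[V]\<close>, which embeds into the maps
  \<open>G(\<real>) \<rightarrow> \<real>[V]\<close> because \<open>G(\<real>)\<close> is dense in \<open>G\<close>; so \<open>act\<close> is the same as an algebra homomorphism
  \<open>\<real>[V] \<rightarrow> \<real>[G] \<otimes> \<real>[V]\<close>, that is, a morphism \<open>G \<times> V \<rightarrow> V\<close>, and the axioms of an action
  hold for \<open>G\<close> if and only if they hold for \<open>G(\<real>)\<close>.
\<close>

definition affine_G_variety ::
    "(real^'n^'n) set \<Rightarrow> (real^'n^'n \<Rightarrow> 'a \<Rightarrow> 'a::real_comm_algebra) \<Rightarrow> bool" where
  "affine_G_variety G act \<longleftrightarrow>
     affine_coordinate_ring (UNIV :: 'a set) \<and>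
     (\<forall>g\<in>G. linear (act g) \<and> act g 1 = 1 \<and> (\<forall>a b. act g (a * b) = act g a * act g b)) \<and>
     (\<forall>f. act (mat 1) f = f) \<and>
     (\<forall>g\<in>G. \<forall>h\<in>G. \<forall>f. act (g ** h) f = act h (act g f)) \<and>
     (\<forall>f. \<exists>(m::nat) p a. (\<forall>i<m. regular_function_on G (p i)) \<and>
            (\<forall>g\<in>G. act g f = (\<Sum>i<m. p i g *\<^sub>R a i)))"

definition move :: "(real^'n^'n \<Rightarrow> 'a \<Rightarrow> 'a) \<Rightarrow> real^'n^'n \<Rightarrow> ('a \<Rightarrow> real) \<Rightarrow> ('a \<Rightarrow> real)" where
  "move act g x = (\<lambda>f. x (act g f))"

definition G_invariant_set ::
    "(real^'n^'n) set \<Rightarrow> (real^'n^'n \<Rightarrow> 'a \<Rightarrow> 'a) \<Rightarrow> ('a \<Rightarrow> real) set \<Rightarrow> bool" where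
  "G_invariant_set G act K \<longleftrightarrow> (\<forall>g\<in>G. \<forall>x\<in>K. move act g x \<in> K)"

definition G_invariant_functional ::
    "(real^'n^'n) set \<Rightarrow> (real^'n^'n \<Rightarrow> 'a \<Rightarrow> 'a) \<Rightarrow> ('a \<Rightarrow> real) \<Rightarrow> bool" where
  "G_invariant_functional G act L \<longleftrightarrow> (\<forall>g\<in>G. \<forall>f. L (act g f) = L f)"

text \<open>\<open>\<real>[V]\<^sup>G\<close>, the coordinate ring of \<open>W = V//G\<close>.\<close>

definition invariant_ring :: "(real^'n^'n) set \<Rightarrow> (real^'n^'n \<Rightarrow> 'a \<Rightarrow> 'a) \<Rightarrow> 'a set" where
  "invariant_ring G act = {f. \<forall>g\<in>G. act g f = f}"

text \<open>The map \<open>V(\<real>) \<rightarrow> W(\<real>)\<close> induced by the inclusion of \<open>\<real>[V]\<^sup>G\<close> in \<open>\<real>[V]\<close>.\<close>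

definition quotient_map_points ::
    "(real^'n^'n) set \<Rightarrow> (real^'n^'n \<Rightarrow> 'a \<Rightarrow> 'a) \<Rightarrow> ('a \<Rightarrow> real) \<Rightarrow> ('a \<Rightarrow> real)" where
  "quotient_map_points G act x = restrict x (invariant_ring G act)"


section \<open>Moment problems\<close>

text \<open>A positive Borel measure on \<open>X\<close> for which all elements of the coordinate ring are integrable.\<close>

definition moment_measure ::
    "'a::real_comm_algebra set \<Rightarrow> ('a \<Rightarrow> real) set \<Rightarrow> ('a \<Rightarrow> real) measure \<Rightarrow> bool" where
  "moment_measure B X M \<longleftrightarrow>
     sets M = sets (sigma X {U. openin (subtopology (points_topology B) X) U}) \<and>
     (\<forall>f\<in>B. integrable M (\<lambda>x. x f))"

definition G_invariant_measure ::
    "(real^'n^'n) set \<Rightarrow> (real^'n^'n \<Rightarrow> 'a \<Rightarrow> 'a) \<Rightarrow> ('a \<Rightarrow> real) measure \<Rightarrow> bool" where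
  "G_invariant_measure G act M \<longleftrightarrow> (\<forall>g\<in>G. distr M M (move act g) = M)"

definition solves_invariant_moment_problem ::
    "(real^'n^'n) set \<Rightarrow> (real^'n^'n \<Rightarrow> 'a::real_comm_algebra \<Rightarrow> 'a)
       \<Rightarrow> ('a \<Rightarrow> real) set \<Rightarrow> 'a set \<Rightarrow> bool" where
  "solves_invariant_moment_problem G act K N \<longleftrightarrow>
     (\<forall>L. linear L \<and> G_invariant_functional G act L \<longrightarrow>
        ((\<exists>M. moment_measure UNIV K M \<and> G_invariant_measure G act M \<and>
             (\<forall>f. L f = (\<integral>x. x f \<partial>M))) \<longleftrightarrow> (\<forall>f\<in>N. 0 \<le> L f)))"

text \<open>
  A linear functional on \<open>B\<close> is represented by any function that is linear on \<open>B\<close>;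
  its values outside \<open>B\<close> are irrelevant.
\<close>

definition linear_functional_on :: "'a::real_vector set \<Rightarrow> ('a \<Rightarrow> real) \<Rightarrow> bool" where
  "linear_functional_on B F \<longleftrightarrow>
     (\<forall>a\<in>B. \<forall>b\<in>B. F (a + b) = F a + F b) \<and> (\<forall>c. \<forall>a\<in>B. F (c *\<^sub>R a) = c * F a)"

definition solves_moment_problem ::
    "'a::real_comm_algebra set \<Rightarrow> ('a \<Rightarrow> real) set \<Rightarrow> 'a set \<Rightarrow> bool" where
  "solves_moment_problem B X N \<longleftrightarrow>
     (\<forall>F. linear_functional_on B F \<longrightarrow>
        ((\<forall>f\<in>N. 0 \<le> F f) \<longleftrightarrow>
        (\<exists>M. moment_measure B X M \<and> (\<forall>f\<in>B. F f = (\<integral>x. x f \<partial>M)))))"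

end

theory Submission
  imports Defs "HOL-Library.Function_Algebras"
begin

text \<open>
  All three conditions say that \<open>N\<close> and \<open>P = \<P>\<^sub>W(\<pi>K)\<close> have the same dual cone in the linear
  functionals on \<open>\<real>[V]\<^sup>G\<close>. For (ii) this is Hahn--Banach separation in the finest locally convex
  topology, where every linear functional is continuous. For (i) and (iii), the Reynolds operator
  identifies functionals on \<open>\<real>[V]\<^sup>G\<close> with invariant functionals on \<open>\<real>[V]\<close>. Such a functional \<open>L\<close>
  with \<open>L \<ge> 0\<close> on \<open>P\<close> is nonnegative on all \<open>f \<ge> 0\<close> on \<open>K\<close>, because the Reynolds operator
  preserves these; so Haviland's theorem on \<open>K\<close> represents it by a measure. Averaging over Haar
  measure makes this measure invariant, and its image under \<open>\<pi>\<close> lives on \<open>\<pi>(K)\<close>. Working on \<open>K\<close>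
  avoids finite generation of \<open>\<real>[V]\<^sup>G\<close> and closedness of \<open>\<pi>(K)\<close>.

  Haar measure comes from von Neumann's mean: left and right averages of a continuous function on
  \<open>G\<close> both approach constants, and the two constants agree since left and right translations
  commute.
\<close>

section \<open>Extension of positive functionals\<close>

text \<open>Two obstacles shape the proof. Different ring elements can agree on \<open>K\<close>,
  whose points need not be Zariski dense; therefore functionals are handled as graphs, whose
  single-valuedness comes out of positivity. And \<open>K\<close> may be unbounded; therefore
  coordinates are rounded to finitely many values, which live in a compact product where finitely
  additive laws become measures. Rounding \<open>t\<close> at precision \<open>k\<close> costs at
  most \<open>(1 + t\<^sup>2) * (1/2) ^ k\<close>, so second moments, available because the ring
  contains squares, give convergence in L1 and keep mass from escaping to infinity. The same
  theorem, fed with monomials on a compact set, yields Riesz-Markov and through it Haar measure. As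
  for (ii), \<open>P\<close> is an intersection of half-spaces defined by the points of \<pi>(K),
  hence closed and recovered from its dual cone; so equal dual cones amount to \<open>P\<close>
  being the closure of \<open>N\<close>.\<close>

instantiation "fun" :: (type, real_vector) real_vector
begin

definition scaleR_fun :: "real \<Rightarrow> ('a \<Rightarrow> 'b) \<Rightarrow> 'a \<Rightarrow> 'b" where
  "scaleR_fun c f = (\<lambda>x. c *\<^sub>R f x)"

instance
  by standard (simp_all add: scaleR_fun_def fun_eq_iff scaleR_add_left scaleR_add_right)

end

text \<open>With \<open>C\<close> as positive cone, \<open>c\<close> has to lie above the values of
  \<open>g\<close> at all \<open>m\<close> below \<open>v\<close> and under those at all
  \<open>m\<close> above \<open>v\<close>. Cofinality at \<open>v\<close> and at \<open>- v\<close>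
  makes both families nonempty, and the supremum of the first serves. Dividing by \<open>s\<close>
  reduces a general combination to these comparisons.\<close>

lemma positive_extension_step:
  fixes g :: "('v::real_vector \<times> real) set"
  assumes g: "subspace g" and E: "subspace E" and gE: "fst ` g \<subseteq> E"
    and C: "\<And>a b. a \<in> C \<Longrightarrow> b \<in> C \<Longrightarrow> a + b \<in> C" "\<And>a c. a \<in> C \<Longrightarrow> 0 \<le> c \<Longrightarrow> c *\<^sub>R a \<in> C"
    and cof: "\<And>w. w \<in> E \<Longrightarrow> \<exists>(m, t) \<in> g. m - w \<in> C"
    and pos: "\<And>m t. (m, t) \<in> g \<Longrightarrow> m \<in> C \<Longrightarrow> 0 \<le> t"
    and v: "v \<in> E"
  obtains c where "\<And>m t s. (m, t) \<in> g \<Longrightarrow> m + s *\<^sub>R v \<in> C \<Longrightarrow> 0 \<le> t + s * c"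
proof -
  let ?A = "{t. \<exists>m. (m, t) \<in> g \<and> v - m \<in> C}"
  define c where "c = Sup ?A"
  have le: "t \<le> t'" if "(m, t) \<in> g" "v - m \<in> C" "(m', t') \<in> g" "m' - v \<in> C" for m t m' t'
  proof -
    have "(m' - m, t' - t) \<in> g" using subspace_diff[OF g that(3,1)] by simp
    moreover have "m' - m \<in> C" using C(1)[OF that(2,4)] by simp
    ultimately show ?thesis using pos by fastforce
  qed
  obtain m1 t1 where 1: "(m1, t1) \<in> g" "m1 - v \<in> C" using cof[OF v] by auto
  obtain m0 t0 where 0: "(m0, t0) \<in> g" "m0 - (- v) \<in> C"
    using cof[OF subspace_neg[OF E v]] by auto
  have neg0: "(- m0, - t0) \<in> g" "v - (- m0) \<in> C"
    using subspace_neg[OF g 0(1)] 0(2) by (simp_all add: add.commute)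
  have ne: "?A \<noteq> {}" using neg0 by blast
  have bdd: "bdd_above ?A" using le[OF _ _ 1] by (auto intro!: bdd_aboveI)
  have up: "t \<le> c" if "(m, t) \<in> g" "v - m \<in> C" for m t
    unfolding c_def by (rule cSup_upper[OF _ bdd]) (use that in blast)
  have lo: "c \<le> t" if "(m, t) \<in> g" "m - v \<in> C" for m t
    unfolding c_def by (rule cSup_least[OF ne]) (use le that in blast)
  have "0 \<le> t + s * c" if m: "(m, t) \<in> g" "m + s *\<^sub>R v \<in> C" for m t s
  proof (cases s "0::real" rule: linorder_cases)
    case equal
    then show ?thesis using pos m by simp
  next
    case greater
    have "(- (1/s) *\<^sub>R m, - (1/s) * t) \<in> g" using subspace_scale[OF g m(1), of "-(1/s)"] by simp
    moreover have "v - (- (1/s) *\<^sub>R m) \<in> C"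
      using C(2)[OF m(2), of "1/s"] greater by (simp add: scaleR_add_right add.commute)
    ultimately have "- (1/s) * t \<le> c" by (rule up)
    then show ?thesis using greater by (simp add: field_simps)
  next
    case less
    have "((-1/s) *\<^sub>R m, (-1/s) * t) \<in> g" using subspace_scale[OF g m(1), of "-1/s"] by simp
    moreover have "(-1/s) *\<^sub>R m - v \<in> C"
      using C(2)[OF m(2), of "-1/s"] less by (simp add: scaleR_add_right divide_nonneg_neg)
    ultimately have "c \<le> (-1/s) * t" by (rule lo)
    then show ?thesis using less by (simp add: field_simps)
  qed
  then show thesis by (rule that)
qed

text \<open>The functional is given by its graph \<open>g\<close>, which need not be known to be single-valued.\<close>

theorem Riesz_positive_extension:
  fixes g :: "('v::real_vector \<times> real) set"
  assumes g: "subspace g" and E: "subspace E" and gE: "fst ` g \<subseteq> E"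
    and C: "0 \<in> C" "\<And>a b. a \<in> C \<Longrightarrow> b \<in> C \<Longrightarrow> a + b \<in> C"
           "\<And>a c. a \<in> C \<Longrightarrow> 0 \<le> c \<Longrightarrow> c *\<^sub>R a \<in> C"
    and cof: "\<And>w. w \<in> E \<Longrightarrow> \<exists>(m, t) \<in> g. m - w \<in> C"
    and pos: "\<And>m t. (m, t) \<in> g \<Longrightarrow> m \<in> C \<Longrightarrow> 0 \<le> t"
  obtains F where "linear_functional_on E F" "\<And>m t. (m, t) \<in> g \<Longrightarrow> F m = t"
    "\<And>w. w \<in> E \<Longrightarrow> w \<in> C \<Longrightarrow> 0 \<le> F w"
proof -
  define S where "S = {h. subspace h \<and> g \<subseteq> h \<and> fst ` h \<subseteq> E \<and> (\<forall>(m, t)\<in>h. m \<in> C \<longrightarrow> 0 \<le> t)}"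
  have "\<exists>M\<in>S. \<forall>X\<in>S. M \<subseteq> X \<longrightarrow> X = M"
  proof (rule subset_Zorn_nonempty)
    show "S \<noteq> {}" using g gE pos by (auto simp: S_def)
    fix \<C> assume ne: "\<C> \<noteq> {}" and ch: "subset.chain S \<C>"
    have sub: "subspace h" if "h \<in> \<C>" for h
      using that ch by (auto simp: subset.chain_def S_def)
    have "subspace (\<Union>\<C>)"
      unfolding subspace_def
    proof (intro conjI ballI allI)
      show "0 \<in> \<Union>\<C>" using ne sub subspace_0 by blast
    next
      fix x y assume "x \<in> \<Union>\<C>" "y \<in> \<Union>\<C>"
      then obtain h k where hk: "h \<in> \<C>" "x \<in> h" "k \<in> \<C>" "y \<in> k" by blast
      then have "h \<subseteq> k \<or> k \<subseteq> h" using ch by (auto simp: subset.chain_def)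
      then show "x + y \<in> \<Union>\<C>" using hk sub subspace_add by blast
    next
      fix c x assume "x \<in> \<Union>\<C>"
      then show "c *\<^sub>R x \<in> \<Union>\<C>" using sub subspace_scale by blast
    qed
    moreover have "g \<subseteq> h" "fst ` h \<subseteq> E" "\<forall>(m, t)\<in>h. m \<in> C \<longrightarrow> 0 \<le> t" if "h \<in> \<C>" for h
      using that ch by (auto simp: subset.chain_def S_def)
    then have "g \<subseteq> \<Union>\<C>" "fst ` \<Union>\<C> \<subseteq> E" "\<forall>(m, t)\<in>\<Union>\<C>. m \<in> C \<longrightarrow> 0 \<le> t"
      using ne by blast+
    ultimately show "\<Union>\<C> \<in> S" unfolding S_def by simp
  qed
  then obtain h where hS: "h \<in> S" and max: "\<And>k. k \<in> S \<Longrightarrow> h \<subseteq> k \<Longrightarrow> k = h" by blast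
  have h: "subspace h" "g \<subseteq> h" "fst ` h \<subseteq> E" and hpos: "\<And>m t. (m, t) \<in> h \<Longrightarrow> m \<in> C \<Longrightarrow> 0 \<le> t"
    using hS by (auto simp: S_def)
  have dom: "v \<in> fst ` h" if v: "v \<in> E" for v
  proof -
    obtain c where c: "\<And>m t s. (m, t) \<in> h \<Longrightarrow> m + s *\<^sub>R v \<in> C \<Longrightarrow> 0 \<le> t + s * c"
    proof (rule positive_extension_step[OF h(1) E h(3) C(2,3) _ _ v])
      show "\<exists>(m, t)\<in>h. m - w \<in> C" if "w \<in> E" for w using cof[OF that] h(2) by blast
    qed (use hpos in auto)
    define k where "k = {x + y |x y. x \<in> h \<and> y \<in> span {(v, c)}}"
    have "subspace k" unfolding k_def by (rule subspace_sums[OF h(1) subspace_span])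
    have kE: "k = {(m + s *\<^sub>R v, t + s * c) | m t s. (m, t) \<in> h}"
      unfolding k_def span_singleton by force
    have "h \<subseteq> k" unfolding kE by (force intro: exI[of _ 0])
    moreover have "k \<in> S"
      unfolding S_def
    proof (intro CollectI conjI)
      show "g \<subseteq> k" using h(2) \<open>h \<subseteq> k\<close> by blast
      show "fst ` k \<subseteq> E" using h(3) v E by (force simp: kE intro: subspace_add subspace_scale)
      show "\<forall>(m, t)\<in>k. m \<in> C \<longrightarrow> 0 \<le> t" using c by (auto simp: kE)
    qed fact
    ultimately have "k = h" using max by blast
    moreover have "(v, c) \<in> k"
      unfolding kE using subspace_0[OF h(1)] by (force simp: zero_prod_def intro: exI[of _ 1])
    ultimately show ?thesis by force
  qed
  \<comment> \<open>Two values over \<open>m\<close> would put \<open>(0, t - t')\<close> and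
    \<open>(0, t' - t)\<close> into \<open>h\<close>; as \<open>0 \<in> C\<close>, positivity makes
    both differences nonnegative.\<close>
  have uniq: "t = t'" if "(m, t) \<in> h" "(m, t') \<in> h" for m t t'
    using hpos[of 0 "t - t'"] hpos[of 0 "t' - t"] subspace_diff[OF h(1) that]
      subspace_diff[OF h(1) that(2,1)] C(1) by force
  define F where "F v = (THE t. (v, t) \<in> h)" for v
  have F: "F m = t" if "(m, t) \<in> h" for m t
    unfolding F_def using that uniq by blast
  have Fh: "(m, F m) \<in> h" if "m \<in> E" for m
    using dom[OF that] F by force
  show thesis
  proof
    show "linear_functional_on E F"
      unfolding linear_functional_on_def
    proof (intro conjI ballI allI)
      fix a b assume "a \<in> E" "b \<in> E"
      then show "F (a + b) = F a + F b"
        using F subspace_add[OF h(1) Fh Fh, of a b] by simp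
    next
      fix c a assume "a \<in> E"
      then show "F (c *\<^sub>R a) = c * F a"
        using F subspace_scale[OF h(1) Fh, of a c] by simp
    qed
    show "F m = t" if "(m, t) \<in> g" for m t using F h(2) that by blast
    show "0 \<le> F w" if "w \<in> E" "w \<in> C" for w using hpos Fh that by blast
  qed
qed

section \<open>Closures in the finest locally convex topology\<close>

text \<open>The topology pulled back along \<open>F\<close> is among those whose supremum is the
  finest locally convex one. Hence every linear functional is continuous for the latter.\<close>

lemma locally_convex_pullback_functional:
  assumes E: "subspace E" and F: "linear_functional_on E F"
  shows "locally_convex_vector_topology E (pullback_topology E F euclideanreal)"
  unfolding locally_convex_vector_topology_def
proof (intro conjI allI impI)
  let ?T = "pullback_topology E F euclideanreal"
  have Fa: "F (a + b) = F a + F b" if "a \<in> E" "b \<in> E" for a b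
    using F that by (simp add: linear_functional_on_def)
  have Fs: "F (c *\<^sub>R a) = c * F a" if "a \<in> E" for a c
    using F that by (simp add: linear_functional_on_def)
  show top: "topspace ?T = E" by (simp add: topspace_pullback_topology)
  have FT: "continuous_map ?T euclideanreal F"
    using continuous_map_pullback[of euclideanreal euclideanreal id E F] by simp
  show "continuous_map (prod_topology ?T ?T) ?T (\<lambda>(x, y). x + y)"
  proof (rule continuous_map_pullback')
    have "continuous_map (prod_topology ?T ?T) euclideanreal (\<lambda>z. F (fst z) + F (snd z))"
      by (intro continuous_map_add continuous_map_compose[OF continuous_map_fst FT, unfolded o_def]
            continuous_map_compose[OF continuous_map_snd FT, unfolded o_def])
    then show "continuous_map (prod_topology ?T ?T) euclideanreal (F \<circ> (\<lambda>(x, y). x + y))"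
      by (rule continuous_map_eq) (auto simp: top Fa)
  qed (use E top in \<open>auto simp: subspace_add\<close>)
  show "continuous_map (prod_topology euclideanreal ?T) ?T (\<lambda>(c, x). c *\<^sub>R x)"
  proof (rule continuous_map_pullback')
    have "continuous_map (prod_topology euclideanreal ?T) euclideanreal (\<lambda>z. fst z * F (snd z))"
      by (intro continuous_map_real_mult continuous_map_fst
            continuous_map_compose[OF continuous_map_snd FT, unfolded o_def])
    then show "continuous_map (prod_topology euclideanreal ?T) euclideanreal (F \<circ> (\<lambda>(c, x). c *\<^sub>R x))"
      by (rule continuous_map_eq) (auto simp: top Fs)
  qed (use E top in \<open>auto simp: subspace_scale\<close>)
  fix U assume "openin ?T U \<and> 0 \<in> U"
  then obtain V where V: "open V" "U = F -` V \<inter> E" "F 0 \<in> V"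
    by (auto simp: openin_pullback_topology)
  then obtain e where e: "0 < e" "ball (F 0) e \<subseteq> V" using open_contains_ball by blast
  let ?C = "F -` ball (F 0) e \<inter> E"
  have "openin ?T ?C" unfolding openin_pullback_topology by auto
  moreover have "convex ?C"
  proof (rule convexI)
    fix x y and u v :: real
    assume xy: "x \<in> ?C" "y \<in> ?C" and uv: "0 \<le> u" "0 \<le> v" "u + v = 1"
    have "F (u *\<^sub>R x + v *\<^sub>R y) = u *\<^sub>R F x + v *\<^sub>R F y"
      using xy E by (simp add: Fa Fs subspace_scale)
    moreover have "u *\<^sub>R F x + v *\<^sub>R F y \<in> ball (F 0) e"
      using xy uv by (intro convexD[OF convex_ball]) auto
    ultimately show "u *\<^sub>R x + v *\<^sub>R y \<in> ?C"
      using xy E by (simp add: subspace_add subspace_scale)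
  qed
  moreover have "0 \<in> ?C" using e subspace_0[OF E] by simp
  moreover have "?C \<subseteq> U" using V e by blast
  ultimately show "\<exists>O' C. openin ?T O' \<and> convex C \<and> 0 \<in> O' \<and> O' \<subseteq> C \<and> C \<subseteq> U" by blast
qed

text \<open>If \<open>F p < 0\<close>, the half-space \<open>F < 0\<close> is an open neighbourhood
  of \<open>p\<close> that misses \<open>N\<close>.\<close>

lemma closure_of_finest_locally_convex_nonneg:
  assumes E: "subspace E" and F: "linear_functional_on E F"
    and N: "\<And>f. f \<in> N \<Longrightarrow> 0 \<le> F f"
    and p: "p \<in> finest_locally_convex_topology E closure_of N"
  shows "0 \<le> F p"
proof (rule ccontr)
  assume "\<not> 0 \<le> F p"
  have "p \<in> E"
    using p locally_convex_vector_topology_finest[OF E]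
    by (auto simp: in_closure_of locally_convex_vector_topology_def)
  let ?U = "F -` {..<0} \<inter> E"
  have "openin (pullback_topology E F euclideanreal) ?U"
    unfolding openin_pullback_topology by (intro exI[of _ "{..<0}"]) auto
  then have "openin (finest_locally_convex_topology E) ?U"
    by (rule openin_finest_locally_convex_topology[OF locally_convex_pullback_functional[OF E F]])
  moreover have "p \<in> ?U" using \<open>p \<in> E\<close> \<open>\<not> 0 \<le> F p\<close> by simp
  ultimately have "\<exists>y. y \<in> N \<and> y \<in> ?U"
    using iffD1[OF in_closure_of p] by metis
  then obtain y where "y \<in> N" "y \<in> ?U" by blast
  then show False using N[of y] by simp
qed

text \<open>Hahn-Banach by positive extension. For a convex neighbourhood \<open>C\<close> of 0 with
  \<open>p + C\<close> disjoint from \<open>N\<close>, the cone \<open>Q\<close> generated by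
  \<open>N\<close> and \<open>-(p + C)\<close> contains no \<open>r *\<^sub>R p\<close> with
  \<open>r > 0\<close>. So the functional on the line through \<open>p\<close> with value -1 at
  \<open>p\<close> is positive there and extends to one that is nonnegative on
  \<open>Q\<close>.\<close>

lemma separate_from_closure_of_cone:
  assumes E: "subspace E" and NE: "N \<subseteq> E" and N0: "0 \<in> N"
    and N: "\<And>a b. a \<in> N \<Longrightarrow> b \<in> N \<Longrightarrow> a + b \<in> N" "\<And>a c. a \<in> N \<Longrightarrow> 0 \<le> c \<Longrightarrow> c *\<^sub>R a \<in> N"
    and p: "p \<in> E" "p \<notin> finest_locally_convex_topology E closure_of N"
  obtains F where "linear_functional_on E F" "\<And>f. f \<in> N \<Longrightarrow> 0 \<le> F f" "F p < 0"
proof -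
  let ?T = "finest_locally_convex_topology E"
  have lc: "locally_convex_vector_topology E ?T"
    by (rule locally_convex_vector_topology_finest[OF E])
  then have top: "topspace ?T = E"
    and add: "continuous_map (prod_topology ?T ?T) ?T (\<lambda>(x, y). x + y)"
    and scale: "continuous_map (prod_topology euclideanreal ?T) ?T (\<lambda>(c, x). c *\<^sub>R x)"
    and base: "\<And>U. openin ?T U \<and> 0 \<in> U \<Longrightarrow>
       \<exists>O' C. openin ?T O' \<and> convex C \<and> 0 \<in> O' \<and> O' \<subseteq> C \<and> C \<subseteq> U"
    unfolding locally_convex_vector_topology_def by blast+
  obtain U where U: "openin ?T U" "p \<in> U" "U \<inter> N = {}"
    using p unfolding in_closure_of top by (metis disjoint_iff)
  have "continuous_map ?T (prod_topology ?T ?T) (\<lambda>x. (p, x))"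
    by (intro continuous_map_pairedI) (use p top in auto)
  from continuous_map_compose[OF this add]
  have "continuous_map ?T ?T (\<lambda>x. p + x)" by (simp add: o_def)
  define V where "V = {x \<in> topspace ?T. p + x \<in> U}"
  have "openin ?T V"
    unfolding V_def using \<open>continuous_map ?T ?T (\<lambda>x. p + x)\<close>
    by (rule openin_continuous_map_preimage[OF _ U(1)])
  moreover have "0 \<in> V" using U(2) top subspace_0[OF E] by (simp add: V_def)
  ultimately obtain O' C where OC: "openin ?T O'" "convex C" "0 \<in> O'" "O' \<subseteq> C"
      and CV: "C \<subseteq> V"
    using base[of V] by metis
  have CU: "C \<subseteq> {x \<in> topspace ?T. p + x \<in> U}" using CV unfolding V_def .
  have CE: "C \<subseteq> E" using CU top by blast
  \<comment> \<open>Continuity of \<open>c *\<^sub>R v\<close> at \<open>c = 0\<close>. This is what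
    makes the line through \<open>p\<close> cofinal below.\<close>
  have absorb: "\<exists>e>0. e *\<^sub>R v \<in> C" if v: "v \<in> E" for v
  proof -
    have "continuous_map euclideanreal (prod_topology euclideanreal ?T) (\<lambda>c. (c, v))"
      by (intro continuous_map_pairedI) (use v top in auto)
    from continuous_map_compose[OF this scale]
    have "continuous_map euclideanreal ?T (\<lambda>c. c *\<^sub>R v)" by (simp add: o_def)
    then have "openin euclideanreal {c \<in> topspace euclideanreal. c *\<^sub>R v \<in> O'}"
      by (rule openin_continuous_map_preimage[OF _ OC(1)])
    then have "open {c. c *\<^sub>R v \<in> O'}" by simp
    moreover have "0 \<in> {c. c *\<^sub>R v \<in> O'}" using OC(3) by simp
    ultimately obtain e where "0 < e" "ball 0 e \<subseteq> {c. c *\<^sub>R v \<in> O'}"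
      by (rule openE)
    moreover have "e/2 \<in> ball 0 e" using \<open>0 < e\<close> by simp
    ultimately show ?thesis using OC(4) by (intro exI[of _ "e/2"]) (auto simp: subset_iff)
  qed
  define Q where "Q = {n - t *\<^sub>R (p + c) | n t c. n \<in> N \<and> 0 \<le> t \<and> c \<in> C}"
  have Q0: "0 \<in> Q"
    unfolding Q_def using N0 OC by (auto intro!: exI[of _ "0::'a"] exI[of _ "0::real"])
  have NQ: "N \<subseteq> Q"
    unfolding Q_def using OC by (force intro: exI[of _ "0::real"])
  define g where "g = span {(p, -1::real)}"
  have gE: "g = {(s *\<^sub>R p, - s) | s. True}"
    unfolding g_def span_singleton by auto
  obtain F where F: "linear_functional_on E F" "\<And>m t. (m, t) \<in> g \<Longrightarrow> F m = t"
    "\<And>w. w \<in> E \<Longrightarrow> w \<in> Q \<Longrightarrow> 0 \<le> F w"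
  proof (rule Riesz_positive_extension[of g E Q])
    show "subspace g" unfolding g_def by (rule subspace_span)
    show "fst ` g \<subseteq> E" using p E by (auto simp: gE subspace_scale)
    show "a + b \<in> Q" if ab: "a \<in> Q" "b \<in> Q" for a b
    proof -
      obtain n t c where a: "a = n - t *\<^sub>R (p + c)" "n \<in> N" "0 \<le> t" "c \<in> C"
        using ab(1) unfolding Q_def by blast
      obtain n' t' c' where b: "b = n' - t' *\<^sub>R (p + c')" "n' \<in> N" "0 \<le> t'" "c' \<in> C"
        using ab(2) unfolding Q_def by blast
      show ?thesis
      proof (cases "t + t' = 0")
        case True
        then have "t = 0" "t' = 0" using a b by auto
        then show ?thesis using a b N(1) NQ by auto
      next
        case False
        then have pos: "t + t' > 0" using a b by auto
        \<comment> \<open>The convex combination that merges \<open>t *\<^sub>R (p + c)\<close> and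
          \<open>t' *\<^sub>R (p + c')\<close> into one multiple of an element of
          \<open>p + C\<close>.\<close>
        define d where "d = (t / (t + t')) *\<^sub>R c + (t' / (t + t')) *\<^sub>R c'"
        have "d \<in> C"
          unfolding d_def
          by (rule convexD[OF OC(2)]) (use a b pos in \<open>auto simp: add_divide_distrib[symmetric]\<close>)
        moreover have "(t + t') *\<^sub>R d = t *\<^sub>R c + t' *\<^sub>R c'"
          unfolding d_def using pos by (simp add: scaleR_add_right)
        then have "a + b = (n + n') - (t + t') *\<^sub>R (p + d)"
          unfolding a b by (simp add: algebra_simps)
        ultimately show ?thesis unfolding Q_def using N(1)[OF a(2) b(2)] pos by force
      qed
    qed
    show "k *\<^sub>R a \<in> Q" if ak: "a \<in> Q" "0 \<le> k" for a k
    proof -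
      obtain n t c where a: "a = n - t *\<^sub>R (p + c)" "n \<in> N" "0 \<le> t" "c \<in> C"
        using ak(1) unfolding Q_def by blast
      have "k *\<^sub>R a = k *\<^sub>R n - (k * t) *\<^sub>R (p + c)" unfolding a(1) by (simp add: algebra_simps)
      then show ?thesis unfolding Q_def using a N(2)[OF a(2) ak(2)] ak(2) by force
    qed
    show "\<exists>(m, t)\<in>g. m - w \<in> Q" if w: "w \<in> E" for w
    proof -
      obtain e where e: "e > 0" "e *\<^sub>R w \<in> C" using absorb[OF w] by blast
      have "(- (1/e)) *\<^sub>R p - w = 0 - (1/e) *\<^sub>R (p + e *\<^sub>R w)"
        using e by (simp add: algebra_simps)
      then have "(- (1/e)) *\<^sub>R p - w \<in> Q" unfolding Q_def using N0 e
        by (intro CollectI exI[of _ 0] exI[of _ "1/e"] exI[of _ "e *\<^sub>R w"]) auto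
      then show ?thesis unfolding gE by blast
    qed
    show "0 \<le> s" if ms: "(m, s) \<in> g" "m \<in> Q" for m s
    proof (rule ccontr)
      assume "\<not> 0 \<le> s"
      define r where "r = - s"
      have r: "r > 0" "m = r *\<^sub>R p" using \<open>\<not> 0 \<le> s\<close> ms(1) by (auto simp: r_def gE)
      obtain n t c where a: "m = n - t *\<^sub>R (p + c)" "n \<in> N" "0 \<le> t" "c \<in> C"
        using ms(2) unfolding Q_def by blast
      \<comment> \<open>Division by \<open>r + t\<close> turns \<open>n\<close> into an element of
        \<open>N\<close> that lies in \<open>p + C\<close>, hence in \<open>U\<close>: the vector
        \<open>(t/(r+t)) *\<^sub>R c\<close> is between 0 and \<open>c\<close>.\<close>
      have "n = (r + t) *\<^sub>R p + t *\<^sub>R c"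
        using a(1) unfolding r(2) by (simp add: algebra_simps)
      then have "(1/(r+t)) *\<^sub>R n = p + (t/(r+t)) *\<^sub>R c"
        using r a by (simp add: scaleR_add_right)
      moreover have "(1/(r+t)) *\<^sub>R n \<in> N" using N(2)[OF a(2)] r a by simp
      moreover have "(t/(r+t)) *\<^sub>R c + (r/(r+t)) *\<^sub>R 0 \<in> C"
        by (rule convexD[OF OC(2)]) (use a r OC in \<open>auto simp: add_divide_distrib[symmetric]\<close>)
      then have "p + (t/(r+t)) *\<^sub>R c \<in> U" using CU by auto
      ultimately show False using U(3) by auto
    qed
  qed (use E Q0 in auto)
  show thesis
  proof
    show "linear_functional_on E F" by fact
    show "0 \<le> F f" if "f \<in> N" for f using F(3) that NE NQ by blast
    have "(p, -1) \<in> g" unfolding g_def by (rule span_base) simp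
    then show "F p < 0" using F(2) by fastforce
  qed
qed

section \<open>From finitely additive laws to measures\<close>

text \<open>Positivity is tested on \<open>X\<close> only, so values off \<open>X\<close> cannot
  influence \<open>\<Lambda>\<close> (\<open>cong\<close>).\<close>

locale positive_functional =
  fixes X :: "'x set" and E :: "('x \<Rightarrow> real) set" and \<Lambda> :: "('x \<Rightarrow> real) \<Rightarrow> real"
  assumes subspace: "subspace E" and linear: "linear_functional_on E \<Lambda>"
    and nonneg: "\<And>h. h \<in> E \<Longrightarrow> (\<And>x. x \<in> X \<Longrightarrow> 0 \<le> h x) \<Longrightarrow> 0 \<le> \<Lambda> h"
begin

lemma in_add: "f \<in> E \<Longrightarrow> g \<in> E \<Longrightarrow> (\<lambda>x. f x + g x) \<in> E"
  using subspace_add[OF subspace, of f g] by (simp add: plus_fun_def)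

lemma in_diff: "f \<in> E \<Longrightarrow> g \<in> E \<Longrightarrow> (\<lambda>x. f x - g x) \<in> E"
  using subspace_diff[OF subspace, of f g] by (simp add: fun_diff_def)

lemma in_mult: "f \<in> E \<Longrightarrow> (\<lambda>x. c * f x) \<in> E"
  using subspace_scale[OF subspace, of f c] by (simp add: scaleR_fun_def)

lemma in_zero: "(\<lambda>x. 0) \<in> E"
  using subspace_0[OF subspace] by (simp add: zero_fun_def)

lemma add: "f \<in> E \<Longrightarrow> g \<in> E \<Longrightarrow> \<Lambda> (\<lambda>x. f x + g x) = \<Lambda> f + \<Lambda> g"
  using linear by (simp add: linear_functional_on_def plus_fun_def)

lemma mult: "f \<in> E \<Longrightarrow> \<Lambda> (\<lambda>x. c * f x) = c * \<Lambda> f"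
  using linear by (simp add: linear_functional_on_def scaleR_fun_def)

lemma zero: "\<Lambda> (\<lambda>x. 0) = 0"
  using mult[OF in_zero, of 0] by simp

lemma diff: "f \<in> E \<Longrightarrow> g \<in> E \<Longrightarrow> \<Lambda> (\<lambda>x. f x - g x) = \<Lambda> f - \<Lambda> g"
  using add[of f "\<lambda>x. - 1 * g x"] mult[of g "-1"] in_mult[of g "-1"] by simp

lemma in_sum: "finite I \<Longrightarrow> (\<And>i. i \<in> I \<Longrightarrow> f i \<in> E) \<Longrightarrow> (\<lambda>x. \<Sum>i\<in>I. f i x) \<in> E"
  by (induction I rule: finite_induct) (auto intro: in_zero in_add)

lemma sum: "finite I \<Longrightarrow> (\<And>i. i \<in> I \<Longrightarrow> f i \<in> E) \<Longrightarrow> \<Lambda> (\<lambda>x. \<Sum>i\<in>I. f i x) = (\<Sum>i\<in>I. \<Lambda> (f i))"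
  by (induction I rule: finite_induct) (auto simp: zero add in_sum)

lemma mono: "f \<in> E \<Longrightarrow> g \<in> E \<Longrightarrow> (\<And>x. x \<in> X \<Longrightarrow> f x \<le> g x) \<Longrightarrow> \<Lambda> f \<le> \<Lambda> g"
  using nonneg[of "\<lambda>x. g x - f x"] diff[of g f] in_diff[of g f] by force

lemma cong: "f \<in> E \<Longrightarrow> g \<in> E \<Longrightarrow> (\<And>x. x \<in> X \<Longrightarrow> f x = g x) \<Longrightarrow> \<Lambda> f = \<Lambda> g"
  by (intro antisym mono) auto

end

text \<open>
  Kolmogorov extension for variables of finite range: their cylinder sets are clopen in a compact
  product, so that every finitely additive law is countably additive on them.
\<close>

lemma (in positive_functional) joint_law:
  fixes d :: "nat \<Rightarrow> 'x \<Rightarrow> real"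
  assumes fin: "\<And>j. finite (d j ` X)" and simp_E: "\<And>h. finite (h ` X) \<Longrightarrow> h \<in> E"
  defines "\<Omega> \<equiv> {\<omega>. \<forall>j. \<omega> j \<in> d j ` X}"
  obtains \<mu> where "space \<mu> = \<Omega>" "finite_measure \<mu>"
    "\<And>\<phi> k. (\<And>\<omega> \<omega>'. \<omega> \<in> \<Omega> \<Longrightarrow> \<omega>' \<in> \<Omega> \<Longrightarrow> (\<And>j. j < k \<Longrightarrow> \<omega> j = \<omega>' j) \<Longrightarrow> \<phi> \<omega> = \<phi> \<omega>') \<Longrightarrow>
       has_bochner_integral \<mu> \<phi> (\<Lambda> (\<lambda>x. \<phi> (\<lambda>j. d j x)))"
proof -
  define D where "D x = (\<lambda>j. d j x)" for x
  have D: "D x \<in> \<Omega>" if "x \<in> X" for x using that by (auto simp: D_def \<Omega>_def)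
  define cyl where "cyl k C \<longleftrightarrow> C \<subseteq> \<Omega> \<and> (\<forall>\<omega>\<in>\<Omega>. \<forall>\<omega>'\<in>\<Omega>. (\<forall>j<k. \<omega> j = \<omega>' j) \<longrightarrow> \<omega> \<in> C \<longrightarrow> \<omega>' \<in> C)"
    for k :: nat and C
  have cyl_mono: "cyl k C \<Longrightarrow> k \<le> l \<Longrightarrow> cyl l C" for k l C
    unfolding cyl_def by (meson order_less_le_trans)
  define \<A> where "\<A> = {C. \<exists>k. cyl k C}"
  interpret algebra \<Omega> \<A>
    unfolding algebra_iff_Un
  proof (intro conjI ballI)
    show "\<A> \<subseteq> Pow \<Omega>" by (auto simp: \<A>_def cyl_def)
    show "{} \<in> \<A>" by (auto simp: \<A>_def cyl_def)
    fix a assume "a \<in> \<A>"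
    then obtain k where k: "cyl k a" by (auto simp: \<A>_def)
    then have "cyl k (\<Omega> - a)" unfolding cyl_def by (metis DiffD1 DiffD2 DiffI subsetI)
    then show "\<Omega> - a \<in> \<A>" by (auto simp: \<A>_def)
    fix b assume "b \<in> \<A>"
    then obtain l where "cyl l b" by (auto simp: \<A>_def)
    then have "cyl (max k l) a" "cyl (max k l) b" using k cyl_mono by simp_all
    then have "cyl (max k l) (a \<union> b)" unfolding cyl_def by blast
    then show "a \<union> b \<in> \<A>" by (auto simp: \<A>_def)
  qed
  define m where "m C = \<Lambda> (\<lambda>x. indicator C (D x))" for C
  have indE: "(\<lambda>x. indicator C (D x)) \<in> E" for C
    by (rule simp_E) (rule finite_subset[of _ "{0, 1}"], auto simp: indicator_def)
  have m0: "0 \<le> m C" for C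
    unfolding m_def by (rule nonneg[OF indE]) simp
  have "\<exists>\<mu>. (\<forall>s\<in>\<A>. \<mu> s = ennreal (m s)) \<and> measure_space \<Omega> (sigma_sets \<Omega> \<A>) \<mu>"
  proof (rule caratheodory_empty_continuous)
    show "positive \<A> (\<lambda>C. ennreal (m C))"
      unfolding positive_def m_def by (simp add: zero)
    show "additive \<A> (\<lambda>C. ennreal (m C))"
      unfolding additive_def
    proof (intro ballI impI)
      fix a b :: "(nat \<Rightarrow> real) set" assume "a \<inter> b = {}"
      then have "(\<lambda>x. indicator (a \<union> b) (D x)) = (\<lambda>x. indicator a (D x) + indicator b (D x) :: real)"
        by (auto simp: indicator_def fun_eq_iff)
      then have "m (a \<union> b) = m a + m b" unfolding m_def by (simp add: add indE)
      then show "ennreal (m (a \<union> b)) = ennreal (m a) + ennreal (m b)" using m0 by simp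
    qed
    show "ennreal (m A) \<noteq> \<infinity>" for A by simp
    fix A :: "nat \<Rightarrow> (nat \<Rightarrow> real) set"
    assume A: "range A \<subseteq> \<A>" "decseq A" "(\<Inter>i. A i) = {}"
    \<comment> \<open>Finiteness of the ranges makes \<open>\<Omega>\<close> compact, although
      \<open>X\<close> carries no topology.\<close>
    have "compactin (product_topology (\<lambda>_. euclidean) UNIV) (PiE UNIV (\<lambda>j. d j ` X))"
      unfolding compactin_PiE using fin by (simp add: finite_imp_compact)
    moreover have "PiE UNIV (\<lambda>j. d j ` X) = \<Omega>" by (auto simp: \<Omega>_def PiE_def)
    ultimately have comp: "compact \<Omega>"
      by (simp add: euclidean_product_topology)
    have closed_A: "closed (A n)" for n
    proof -
      obtain k where k: "cyl k (A n)" using A(1) by (auto simp: \<A>_def)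
      let ?V = "(\<lambda>\<omega>. restrict \<omega> {..<k}) ` A n"
      have "?V \<subseteq> PiE {..<k} (\<lambda>j. d j ` X)" using k by (force simp: cyl_def \<Omega>_def)
      then have fV: "finite ?V" by (rule finite_subset) (simp add: finite_PiE fin)
      have "A n = (\<Union>v\<in>?V. \<Omega> \<inter> (\<Inter>j\<in>{..<k}. {\<omega>. \<omega> j = v j}))"
      proof (intro set_eqI iffI)
        fix \<omega> assume "\<omega> \<in> A n"
        then show "\<omega> \<in> (\<Union>v\<in>?V. \<Omega> \<inter> (\<Inter>j\<in>{..<k}. {\<omega>. \<omega> j = v j}))"
          using k by (auto simp: cyl_def)
      next
        fix \<omega> assume "\<omega> \<in> (\<Union>v\<in>?V. \<Omega> \<inter> (\<Inter>j\<in>{..<k}. {\<omega>. \<omega> j = v j}))"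
        then obtain \<omega>' where "\<omega>' \<in> A n" "\<omega> \<in> \<Omega>" "\<forall>j<k. \<omega>' j = \<omega> j" by auto
        then show "\<omega> \<in> A n" using k unfolding cyl_def by blast
      qed
      also have "closed \<dots>"
        by (intro closed_UN fV ballI closed_Int closed_INT compact_imp_closed[OF comp]
              closed_Collect_eq continuous_on_product_coordinates continuous_on_const)
      finally show ?thesis .
    qed
    \<comment> \<open>Closed sets in a compact space: a decreasing sequence with empty intersection
      reaches \<open>{}\<close>. So continuity at the empty set, the condition in Caratheodory's
      theorem, becomes trivial.\<close>
    have "\<exists>n. A n = {}"
    proof (rule ccontr)
      assume ne: "\<nexists>n. A n = {}"
      have "\<Omega> \<inter> \<Inter>(range A) \<noteq> {}"
      proof (rule compact_imp_fip[OF comp])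
        show "closed T" if "T \<in> range A" for T using that closed_A by auto
        fix F assume "finite F" "F \<subseteq> range A"
        then obtain I where I: "finite I" "F = A ` I"
          using finite_subset_image[OF \<open>finite F\<close> \<open>F \<subseteq> range A\<close>] by metis
        have "A (Max (insert 0 I)) \<subseteq> A i" if "i \<in> I" for i
          by (rule decseqD[OF A(2)]) (use I that in simp)
        moreover have "A (Max (insert 0 I)) \<subseteq> \<Omega>" using A(1) by (auto simp: \<A>_def cyl_def)
        ultimately have "A (Max (insert 0 I)) \<subseteq> \<Omega> \<inter> \<Inter>F" unfolding I(2) by blast
        then show "\<Omega> \<inter> \<Inter>F \<noteq> {}" using ne by blast
      qed
      then show False using A(3) by blast
    qed
    then obtain n where "A n = {}" by blast
    then have "A i = {}" if "i \<ge> n" for i using decseqD[OF A(2) that] by simp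
    then have "\<forall>\<^sub>F i in sequentially. ennreal (m (A i)) = 0"
      unfolding eventually_sequentially by (intro exI[of _ n]) (simp add: m_def zero)
    then show "(\<lambda>i. ennreal (m (A i))) \<longlonglongrightarrow> 0" by (rule tendsto_eventually)
  qed
  then obtain \<mu>0 where \<mu>0: "\<And>s. s \<in> \<A> \<Longrightarrow> \<mu>0 s = ennreal (m s)"
      "measure_space \<Omega> (sigma_sets \<Omega> \<A>) \<mu>0" by blast
  define \<mu> where "\<mu> = measure_of \<Omega> \<A> \<mu>0"
  have sp: "space \<mu> = \<Omega>" unfolding \<mu>_def by (rule space_measure_of[OF space_closed])
  have sets: "sets \<mu> = sigma_sets \<Omega> \<A>" unfolding \<mu>_def by (rule sets_measure_of[OF space_closed])
  have em: "emeasure \<mu> C = ennreal (m C)" if "C \<in> \<A>" for C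
    by (subst emeasure_measure_of[OF \<mu>_def space_closed])
       (use \<mu>0 that in \<open>auto simp: measure_space_def sets\<close>)
  have fm: "finite_measure \<mu>"
    by (rule finite_measureI) (simp add: sp em)
  show thesis
  proof (rule that[OF sp fm])
    fix \<phi> :: "(nat \<Rightarrow> real) \<Rightarrow> real" and k
    assume dep: "\<And>\<omega> \<omega>'. \<omega> \<in> \<Omega> \<Longrightarrow> \<omega>' \<in> \<Omega> \<Longrightarrow> (\<And>j. j < k \<Longrightarrow> \<omega> j = \<omega>' j) \<Longrightarrow> \<phi> \<omega> = \<phi> \<omega>'"
    \<comment> \<open>On \<open>\<Omega>\<close>, \<open>\<phi>\<close> factors through the finite
      set of restrictions to the first \<open>k\<close> coordinates. It is thus a finite combination
      of indicators of cylinder sets, where the measure was defined by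
      \<open>\<Lambda>\<close>.\<close>
    define r where "r \<omega> = restrict \<omega> {..<k}" for \<omega> :: "nat \<Rightarrow> real"
    have "r ` \<Omega> \<subseteq> PiE {..<k} (\<lambda>j. d j ` X)" by (force simp: \<Omega>_def r_def)
    then have fV: "finite (r ` \<Omega>)" by (rule finite_subset) (simp add: finite_PiE fin)
    have "\<phi> ` \<Omega> = (\<lambda>v. \<phi> (inv_into \<Omega> r v)) ` r ` \<Omega>"
      unfolding image_image
    proof (rule image_cong[OF refl])
      fix \<omega> assume \<omega>: "\<omega> \<in> \<Omega>"
      have "inv_into \<Omega> r (r \<omega>) \<in> \<Omega>" "r (inv_into \<Omega> r (r \<omega>)) = r \<omega>"
        using \<omega> by (simp_all add: inv_into_into f_inv_into_f)
      then show "\<phi> \<omega> = \<phi> (inv_into \<Omega> r (r \<omega>))"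
        unfolding r_def by (intro dep \<omega>) (metis lessThan_iff restrict_apply')+
    qed
    then have fin\<phi>: "finite (\<phi> ` \<Omega>)" using fV by simp
    define C where "C v = {\<omega> \<in> \<Omega>. \<phi> \<omega> = v}" for v
    have "cyl k (C v)" for v
      unfolding cyl_def
    proof (intro conjI ballI impI)
      show "C v \<subseteq> \<Omega>" by (auto simp: C_def)
      fix \<omega> \<omega>' assume "\<omega> \<in> \<Omega>" "\<omega>' \<in> \<Omega>" "\<forall>j<k. \<omega> j = \<omega>' j" "\<omega> \<in> C v"
      then show "\<omega>' \<in> C v" using dep[of \<omega> \<omega>'] by (simp add: C_def)
    qed
    then have CA: "C v \<in> \<A>" for v by (auto simp: \<A>_def)
    have expand: "\<phi> \<omega> = (\<Sum>v\<in>\<phi> ` \<Omega>. v * indicator (C v) \<omega>)" if "\<omega> \<in> \<Omega>" for \<omega>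
    proof -
      have "(\<Sum>v\<in>\<phi> ` \<Omega>. v * indicator (C v) \<omega>) = (\<Sum>v\<in>\<phi> ` \<Omega>. if v = \<phi> \<omega> then v else 0)"
        using that by (intro sum.cong) (auto simp: C_def indicator_def)
      then show ?thesis using that fin\<phi> by (simp add: sum.delta)
    qed
    have "has_bochner_integral \<mu> (\<lambda>\<omega>. \<Sum>v\<in>\<phi> ` \<Omega>. v * indicator (C v) \<omega>) (\<Sum>v\<in>\<phi> ` \<Omega>. v * measure \<mu> (C v))"
      using CA by (intro has_bochner_integral_sum has_bochner_integral_mult_right
        has_bochner_integral_real_indicator) (auto simp: sets em)
    moreover have "measure \<mu> (C v) = m (C v)" for v
      using em[OF CA] m0 by (simp add: measure_def)
    moreover have "(\<Sum>v\<in>\<phi> ` \<Omega>. v * m (C v)) = \<Lambda> (\<lambda>x. \<Sum>v\<in>\<phi> ` \<Omega>. v * indicator (C v) (D x))"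
      unfolding m_def by (subst sum[OF fin\<phi> in_mult[OF indE]]) (simp only: mult[OF indE])
    moreover have "\<dots> = \<Lambda> (\<lambda>x. \<phi> (D x))"
    proof (rule cong)
      show "(\<lambda>x. \<phi> (D x)) \<in> E"
        by (rule simp_E) (rule finite_subset[OF _ fin\<phi>], use D in auto)
      show "(\<lambda>x. \<Sum>v\<in>\<phi> ` \<Omega>. v * indicator (C v) (D x)) \<in> E"
        by (intro in_sum fin\<phi> in_mult indE)
    qed (rule expand[OF D, symmetric])
    ultimately have "has_bochner_integral \<mu> (\<lambda>\<omega>. \<Sum>v\<in>\<phi> ` \<Omega>. v * indicator (C v) \<omega>) (\<Lambda> (\<lambda>x. \<phi> (D x)))"
      by simp
    then show "has_bochner_integral \<mu> \<phi> (\<Lambda> (\<lambda>x. \<phi> (\<lambda>j. d j x)))"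
      unfolding D_def by (subst has_bochner_integral_cong[OF refl expand refl]) (simp_all add: sp)
  qed
qed

text \<open>The increments \<open>\<delta> (Suc k) - \<delta> k\<close> have summable L1 norms, so
  the sum of their absolute values is finite almost everywhere and the sequence converges there.
  Fatou's lemma, with \<open>l\<close> tending to infinity in the bound, gives L1 convergence at a
  geometric rate and with it convergence of the integrals.\<close>

lemma geometric_L1_Cauchy:
  fixes \<delta> :: "nat \<Rightarrow> 'a \<Rightarrow> real"
  assumes int: "\<And>k. integrable \<mu> (\<delta> k)"
    and bound: "\<And>k l. (\<integral>\<omega>. \<bar>\<delta> k \<omega> - \<delta> l \<omega>\<bar> \<partial>\<mu>) \<le> C * ((1/2) ^ k + (1/2) ^ l)"
  shows "AE \<omega> in \<mu>. (\<lambda>k. \<delta> k \<omega>) \<longlonglongrightarrow> lim (\<lambda>k. \<delta> k \<omega>)"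
    and "integrable \<mu> (\<lambda>\<omega>. lim (\<lambda>k. \<delta> k \<omega>))"
    and "(\<lambda>k. \<integral>\<omega>. \<delta> k \<omega> \<partial>\<mu>) \<longlonglongrightarrow> (\<integral>\<omega>. lim (\<lambda>k. \<delta> k \<omega>) \<partial>\<mu>)"
proof -
  have [measurable]: "\<delta> k \<in> borel_measurable \<mu>" for k using int by (rule borel_measurable_integrable)
  let ?Y = "\<lambda>\<omega>. lim (\<lambda>k. \<delta> k \<omega>)"
  \<comment> \<open>The case \<open>k = l = 0\<close> of the bound.\<close>
  have "0 \<le> C * 2"
    using order_trans[OF integral_nonneg_AE bound[of 0 0]] by simp
  then have C: "0 \<le> C" by simp
  have nn: "(\<integral>\<^sup>+\<omega>. ennreal \<bar>\<delta> k \<omega> - \<delta> l \<omega>\<bar> \<partial>\<mu>) \<le> ennreal (C * ((1/2) ^ k + (1/2) ^ l))" for k l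
    using bound[of k l] int by (subst nn_integral_eq_integral) (auto intro!: ennreal_leI)
  have "(\<integral>\<^sup>+\<omega>. (\<Sum>k. ennreal \<bar>\<delta> (Suc k) \<omega> - \<delta> k \<omega>\<bar>) \<partial>\<mu>)
      = (\<Sum>k. \<integral>\<^sup>+\<omega>. ennreal \<bar>\<delta> (Suc k) \<omega> - \<delta> k \<omega>\<bar> \<partial>\<mu>)"
    by (rule nn_integral_suminf) simp
  also have "\<dots> \<le> (\<Sum>k. ennreal (2 * C * (1/2) ^ k))"
  proof (rule suminf_le)
    show "(\<integral>\<^sup>+\<omega>. ennreal \<bar>\<delta> (Suc k) \<omega> - \<delta> k \<omega>\<bar> \<partial>\<mu>) \<le> ennreal (2 * C * (1/2) ^ k)" for k
    proof (rule order_trans[OF nn ennreal_leI])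
      have "C * (1/2) ^ Suc k \<le> C * (1/2) ^ k" using C by (intro mult_left_mono) auto
      then show "C * ((1/2) ^ Suc k + (1/2) ^ k) \<le> 2 * C * (1/2) ^ k"
        by (simp add: distrib_left)
    qed
  qed simp_all
  also have "\<dots> < \<infinity>"
    using C by (subst suminf_ennreal2) (auto intro!: summable_mult)
  finally have "AE \<omega> in \<mu>. (\<Sum>k. ennreal \<bar>\<delta> (Suc k) \<omega> - \<delta> k \<omega>\<bar>) \<noteq> \<infinity>"
    by (intro nn_integral_PInf_AE) auto
  then show conv: "AE \<omega> in \<mu>. (\<lambda>k. \<delta> k \<omega>) \<longlonglongrightarrow> ?Y \<omega>"
  proof eventually_elim
    case (elim \<omega>)
    then have "summable (\<lambda>k. \<bar>\<delta> (Suc k) \<omega> - \<delta> k \<omega>\<bar>)"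
      by (intro summable_suminf_not_top) auto
    then have "summable (\<lambda>k. \<delta> (Suc k) \<omega> - \<delta> k \<omega>)" by (rule summable_rabs_cancel)
    then have "convergent (\<lambda>n. \<delta> n \<omega> - \<delta> 0 \<omega>)"
      unfolding summable_iff_convergent sum_lessThan_telescope[of "\<lambda>k. \<delta> k \<omega>"] .
    then have "convergent (\<lambda>n. \<delta> n \<omega>)"
      using convergent_add[of "\<lambda>n. \<delta> n \<omega> - \<delta> 0 \<omega>" "\<lambda>n. \<delta> 0 \<omega>"] by (simp add: convergent_const)
    then show ?case by (simp add: convergent_LIMSEQ_iff)
  qed
  have dist: "(\<integral>\<^sup>+\<omega>. ennreal (norm (?Y \<omega> - \<delta> k \<omega>)) \<partial>\<mu>) \<le> ennreal (2 * C * (1/2) ^ k)" for k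
  proof -
    have "(\<integral>\<^sup>+\<omega>. ennreal (norm (?Y \<omega> - \<delta> k \<omega>)) \<partial>\<mu>)
        = (\<integral>\<^sup>+\<omega>. liminf (\<lambda>l. ennreal \<bar>\<delta> l \<omega> - \<delta> k \<omega>\<bar>) \<partial>\<mu>)"
    proof (rule nn_integral_cong_AE, use conv in eventually_elim)
      case (elim \<omega>)
      then have "(\<lambda>l. ennreal \<bar>\<delta> l \<omega> - \<delta> k \<omega>\<bar>) \<longlonglongrightarrow> ennreal \<bar>?Y \<omega> - \<delta> k \<omega>\<bar>"
        by (intro tendsto_ennrealI tendsto_intros)
      from lim_imp_Liminf[OF trivial_limit_sequentially this] show ?case by (simp only: real_norm_def)
    qed
    also have "\<dots> \<le> liminf (\<lambda>l. \<integral>\<^sup>+\<omega>. ennreal \<bar>\<delta> l \<omega> - \<delta> k \<omega>\<bar> \<partial>\<mu>)"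
      by (rule nn_integral_liminf) simp
    also have "\<dots> \<le> ennreal (2 * C * (1/2) ^ k)"
    proof (rule Liminf_le)
      show "\<forall>\<^sub>F l in sequentially. (\<integral>\<^sup>+\<omega>. ennreal \<bar>\<delta> l \<omega> - \<delta> k \<omega>\<bar> \<partial>\<mu>) \<le> ennreal (2 * C * (1/2) ^ k)"
        using eventually_ge_at_top[of k]
      proof eventually_elim
        case (elim l)
        have "C * (1/2) ^ l \<le> C * (1/2) ^ k" using C elim by (intro mult_left_mono power_decreasing) auto
        then show ?case by (intro order_trans[OF nn ennreal_leI]) (simp add: distrib_left)
      qed
    qed simp
    finally show ?thesis .
  qed
  have diff: "integrable \<mu> (\<lambda>\<omega>. ?Y \<omega> - \<delta> k \<omega>)" for k
    by (rule integrableI_bounded) (use dist[of k] in \<open>auto simp: less_top[symmetric] top_unique\<close>)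
  from Bochner_Integration.integrable_add[OF diff[of 0] int[of 0]]
  show Y: "integrable \<mu> ?Y" by simp
  show "(\<lambda>k. \<integral>\<omega>. \<delta> k \<omega> \<partial>\<mu>) \<longlonglongrightarrow> (\<integral>\<omega>. ?Y \<omega> \<partial>\<mu>)"
  proof (rule tendsto_L1_int[OF int Y])
    have "(\<lambda>k. ennreal (2 * C * (1/2) ^ k)) \<longlonglongrightarrow> ennreal (2 * C * 0)"
      by (intro tendsto_ennrealI tendsto_intros LIMSEQ_power_zero) simp
    then have lim: "(\<lambda>k. ennreal (2 * C * (1/2) ^ k)) \<longlonglongrightarrow> 0" by simp
    have "(\<integral>\<^sup>+\<omega>. ennreal (norm (\<delta> k \<omega> - ?Y \<omega>)) \<partial>\<mu>) \<le> ennreal (2 * C * (1/2) ^ k)" for k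
      using dist[of k] by (simp only: norm_minus_commute)
    then show "(\<lambda>k. \<integral>\<^sup>+\<omega>. ennreal (norm (\<delta> k \<omega> - ?Y \<omega>)) \<partial>\<mu>) \<longlonglongrightarrow> 0"
      by (intro tendsto_sandwich[OF _ _ tendsto_const lim] always_eventually allI) auto
  qed
qed

section \<open>Rounding to finitely many dyadic values\<close>

definition dyadic_round :: "nat \<Rightarrow> real \<Rightarrow> real" where
  "dyadic_round k t = of_int \<lfloor>2 ^ k * max (- (2 ^ k)) (min (2 ^ k) t)\<rfloor> / 2 ^ k"

text \<open>Clamping to \<open>[- (2 ^ k), 2 ^ k]\<close> leaves only fractions with denominator
  \<open>2 ^ k\<close> and numerator between \<open>- (4 ^ k)\<close> and
  \<open>4 ^ k\<close>.\<close>

lemma finite_dyadic_round: "finite (range (dyadic_round k))"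
proof (rule finite_subset)
  show "range (dyadic_round k) \<subseteq> (\<lambda>z. of_int z / 2 ^ k) ` {- (4 ^ k)..4 ^ k}"
  proof
    fix y assume "y \<in> range (dyadic_round k)"
    then obtain t where y: "y = dyadic_round k t" by blast
    define c :: real where "c = max (- (2 ^ k)) (min (2 ^ k) t)"
    have c: "- (2 ^ k) \<le> c" "c \<le> 2 ^ k" by (auto simp: c_def)
    have "2 ^ k * c \<le> 2 ^ k * 2 ^ k" "2 ^ k * - (2 ^ k) \<le> 2 ^ k * c"
      by (rule mult_left_mono; use c in simp)+
    moreover have four: "(2::real) ^ k * 2 ^ k = of_int (4 ^ k)"
      by (simp add: power_mult_distrib[symmetric])
    ultimately have "2 ^ k * c \<le> of_int (4 ^ k)" "of_int (- (4 ^ k)) \<le> 2 ^ k * c" by simp_all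
    then have "\<lfloor>2 ^ k * c\<rfloor> \<in> {- (4 ^ k)..4 ^ k}"
      unfolding atLeastAtMost_iff le_floor_iff by (simp add: floor_le_iff)
    then show "y \<in> (\<lambda>z. of_int z / 2 ^ k) ` {- (4 ^ k)..4 ^ k}"
      unfolding y dyadic_round_def c_def by blast
  qed
qed simp

lemma dyadic_round_inside: "\<bar>t\<bar> \<le> 2 ^ k \<Longrightarrow> \<bar>dyadic_round k t - t\<bar> \<le> (1/2) ^ k"
proof -
  assume "\<bar>t\<bar> \<le> 2 ^ k"
  then have "dyadic_round k t = of_int \<lfloor>2 ^ k * t\<rfloor> / 2 ^ k" by (simp add: dyadic_round_def)
  then have "dyadic_round k t - t = (of_int \<lfloor>2 ^ k * t\<rfloor> - 2 ^ k * t) / 2 ^ k"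
    by (simp add: diff_divide_distrib)
  moreover have "\<bar>of_int \<lfloor>2 ^ k * t\<rfloor> - 2 ^ k * t\<bar> \<le> 1" by linarith
  ultimately have "\<bar>dyadic_round k t - t\<bar> \<le> 1 / 2 ^ k"
    by (simp only: abs_divide) (simp add: divide_right_mono)
  then show ?thesis by (simp add: power_one_over)
qed

lemma dyadic_round_outside: "2 ^ k < \<bar>t\<bar> \<Longrightarrow> dyadic_round k t = sgn t * 2 ^ k"
proof -
  assume t: "2 ^ k < \<bar>t\<bar>"
  have sq: "(2::real) ^ k * 2 ^ k = of_int (2 ^ k * 2 ^ k)" by simp
  have "(0::real) < 2 ^ k" by simp
  show ?thesis
  proof (cases "0 \<le> t")
    case True
    then have "max (- (2 ^ k)) (min (2 ^ k) t) = 2 ^ k" "sgn t = 1" using t by (auto simp: sgn_if)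
    then show ?thesis unfolding dyadic_round_def sq by simp
  next
    case False
    then have "max (- (2 ^ k)) (min (2 ^ k) t) = - (2 ^ k)" "sgn t = - 1"
      using t \<open>0 < 2 ^ k\<close> by (auto simp: sgn_if)
    moreover have "(2::real) ^ k * - (2 ^ k) = of_int (- (2 ^ k * 2 ^ k))" by simp
    ultimately show ?thesis unfolding dyadic_round_def by (simp only: floor_of_int) simp
  qed
qed

text \<open>Clamped numbers are rounded to the end points of the window, so a rounded value strictly
  inside certifies that \<open>t\<close> was inside. In \<open>Haviland\<close> this bounds a
  coordinate of which only the rounding is known.\<close>

lemma dyadic_round_close: "\<bar>dyadic_round k t\<bar> < 2 ^ k \<Longrightarrow> \<bar>dyadic_round k t - t\<bar> \<le> (1/2) ^ k"
  by (cases "\<bar>t\<bar> \<le> 2 ^ k")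
     (auto simp: dyadic_round_inside dyadic_round_outside abs_mult abs_sgn_eq split: if_splits)

text \<open>Outside the window \<open>2 ^ k < \<bar>t\<bar>\<close>, hence
  \<open>\<bar>t\<bar> \<le> t\<^sup>2 * (1/2) ^ k\<close>: the clamping error is paid for by the
  square. This is why \<open>Haviland\<close> asks for the squares of the coordinates in its
  domain.\<close>

lemma dyadic_round_error: "\<bar>dyadic_round k t - t\<bar> \<le> (1 + t\<^sup>2) * (1/2) ^ k"
proof (cases "\<bar>t\<bar> \<le> 2 ^ k")
  case True
  have "(1/2) ^ k \<le> (1 + t\<^sup>2) * (1/2) ^ k" by simp
  then show ?thesis using dyadic_round_inside[OF True] by linarith
next
  case False
  have "dyadic_round k t - t = sgn t * (2 ^ k - \<bar>t\<bar>)"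
    using False by (simp add: dyadic_round_outside right_diff_distrib sgn_mult_abs)
  then have "\<bar>dyadic_round k t - t\<bar> \<le> \<bar>t\<bar> - 2 ^ k"
    using False by (simp add: abs_mult abs_sgn_eq)
  also have "\<dots> \<le> \<bar>t\<bar>" by simp
  also have "\<bar>t\<bar> * 2 ^ k \<le> \<bar>t\<bar> * \<bar>t\<bar>" using False by (intro mult_left_mono) auto
  then have "\<bar>t\<bar> \<le> t\<^sup>2 * (1/2) ^ k"
    by (simp add: power_one_over divide_simps power2_eq_square abs_mult[symmetric])
  also have "\<dots> \<le> (1 + t\<^sup>2) * (1/2) ^ k" by (intro mult_right_mono) auto
  finally show ?thesis .
qed


lemma tendsto_fun_iff:
  fixes f :: "'a \<Rightarrow> 'i \<Rightarrow> 'b::topological_space"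
  shows "(f \<longlongrightarrow> l) F \<longleftrightarrow> (\<forall>i. ((\<lambda>a. f a i) \<longlongrightarrow> l i) F)"
  using limitin_componentwise[of "\<lambda>_. euclidean :: 'b topology" UNIV f l F]
  by (simp add: euclidean_product_topology)

text \<open>
  The functional is extended to all functions lying between elements of its domain. Its values on
  functions of the dyadic roundings of the \<open>e i\<close> form a finitely additive law, which becomes a
  measure on sequences of roundings; these sequences converge almost surely, with limits in the
  image of \<open>X\<close>.
\<close>

theorem Haviland:
  fixes g :: "(('x \<Rightarrow> real) \<times> real) set" and e :: "nat \<Rightarrow> 'x \<Rightarrow> real"
  assumes g: "subspace g"
    and pos: "\<And>m t. (m, t) \<in> g \<Longrightarrow> (\<And>x. x \<in> X \<Longrightarrow> 0 \<le> m x) \<Longrightarrow> 0 \<le> t"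
    and one: "(\<lambda>x. 1, c) \<in> g"
    and e: "\<And>i. (e i, l i) \<in> g" and sq: "\<And>i. ((\<lambda>x. (e i x)\<^sup>2), s i) \<in> g"
    and cl: "closed ((\<lambda>x i. e i x) ` X)"
  obtains M where "sets M = sets borel" "finite_measure M"
    "AE y in M. y \<in> (\<lambda>x i. e i x) ` X" "\<And>i. has_bochner_integral M (\<lambda>y. y i) (l i)"
proof -
  \<comment> \<open>Exactly the functions for which the domain of \<open>g\<close> is cofinal in
    both directions, as the extension theorem demands. Since constants belong to \<open>g\<close>,
    every function with finite range on \<open>X\<close> is included.\<close>
  define E where "E = {h. \<exists>(m, t)\<in>g. \<exists>(m', t')\<in>g. \<forall>x\<in>X. m x \<le> h x \<and> h x \<le> m' x}"
  have EI: "h \<in> E" if "(m, t) \<in> g" "(m', t') \<in> g" "\<And>x. x \<in> X \<Longrightarrow> m x \<le> h x \<and> h x \<le> m' x"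
    for h m t m' t'
    unfolding E_def using that by blast
  have EE: "\<exists>m t m' t'. (m, t) \<in> g \<and> (m', t') \<in> g \<and> (\<forall>x\<in>X. m x \<le> h x \<and> h x \<le> m' x)"
    if "h \<in> E" for h
    using that unfolding E_def by blast
  have gadd: "((\<lambda>x. m x + m' x), t + t') \<in> g" if "(m, t) \<in> g" "(m', t') \<in> g" for m t m' t'
    using subspace_add[OF g that] by (simp add: plus_fun_def)
  have gmult: "((\<lambda>x. r * m x), r * t) \<in> g" if "(m, t) \<in> g" for m t r
    using subspace_scale[OF g that, of r] by (simp add: scaleR_fun_def)
  have Esub: "subspace E"
    unfolding subspace_def
  proof (intro conjI ballI allI)
    have z: "(\<lambda>x. 0, 0) \<in> g" using gmult[OF one, of 0] by simp
    show "0 \<in> E" by (rule EI[OF z z]) simp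
  next
    fix h k assume "h \<in> E" "k \<in> E"
    then obtain m t m' t' n u n' u' where *: "(m, t) \<in> g" "(m', t') \<in> g" "(n, u) \<in> g" "(n', u') \<in> g"
      "\<forall>x\<in>X. m x \<le> h x \<and> h x \<le> m' x" "\<forall>x\<in>X. n x \<le> k x \<and> k x \<le> n' x"
      using EE by metis
    show "h + k \<in> E"
      by (rule EI[OF gadd[OF *(1,3)] gadd[OF *(2,4)]]) (use * in \<open>auto intro: add_mono\<close>)
  next
    fix r h assume "h \<in> E"
    then obtain m t m' t' where *: "(m, t) \<in> g" "(m', t') \<in> g"
      "\<forall>x\<in>X. m x \<le> h x \<and> h x \<le> m' x"
      using EE by metis
    show "r *\<^sub>R h \<in> E"
    proof (cases "0 \<le> r")
      case True
      show ?thesis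
        by (rule EI[OF gmult[OF *(1), of r] gmult[OF *(2), of r]])
           (use * True in \<open>auto simp: scaleR_fun_def mult_left_mono\<close>)
    next
      case False
      show ?thesis
        by (rule EI[OF gmult[OF *(2), of r] gmult[OF *(1), of r]])
           (use * False in \<open>auto simp: scaleR_fun_def mult_left_mono_neg\<close>)
    qed
  qed
  obtain \<Lambda> where \<Lambda>: "linear_functional_on E \<Lambda>" "\<And>m t. (m, t) \<in> g \<Longrightarrow> \<Lambda> m = t"
    "\<And>w. w \<in> E \<Longrightarrow> w \<in> {h. \<forall>x\<in>X. 0 \<le> h x} \<Longrightarrow> 0 \<le> \<Lambda> w"
  proof (rule Riesz_positive_extension[OF g Esub, of "{h. \<forall>x\<in>X. 0 \<le> h x}"])
    show "fst ` g \<subseteq> E" by (auto intro: EI)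
    show "\<exists>(m, t)\<in>g. m - w \<in> {h. \<forall>x\<in>X. 0 \<le> h x}" if "w \<in> E" for w
      using EE[OF that] by fastforce
  qed (use pos in \<open>auto simp: scaleR_fun_def\<close>)
  interpret positive_functional X E \<Lambda>
    by standard (use Esub \<Lambda> in auto)
  have gE: "m \<in> E" if "(m, t) \<in> g" for m t using EI[OF that that] by simp
  have simp_E: "h \<in> E" if fin: "finite (h ` X)" for h
  proof -
    obtain b where b: "\<And>x. x \<in> X \<Longrightarrow> \<bar>h x\<bar> \<le> b"
      using finite_imp_bounded[OF fin] by (auto simp: bounded_iff)
    show ?thesis
      by (rule EI[OF gmult[OF one, of "-b"] gmult[OF one, of b]]) (use b in \<open>auto simp: abs_le_iff minus_le_iff\<close>)
  qed
  \<comment> \<open>One sequence running through all pairs of a coordinate and a precision.\<close>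
  define d where "d n x = dyadic_round (snd (prod_decode n)) (e (fst (prod_decode n)) x)" for n x
  have d: "d (prod_encode (i, k)) x = dyadic_round k (e i x)" for i k x by (simp add: d_def)
  have "d j ` X \<subseteq> range (dyadic_round (snd (prod_decode j)))" for j by (auto simp: d_def)
  then have fin_d: "finite (d j ` X)" for j by (rule finite_subset[OF _ finite_dyadic_round])
  define \<Omega> where "\<Omega> = {\<omega>. \<forall>j. \<omega> j \<in> d j ` X}"
  obtain \<mu> where \<mu>: "space \<mu> = \<Omega>" "finite_measure \<mu>"
    and law: "\<And>\<phi> k. (\<And>\<omega> \<omega>'. \<omega> \<in> \<Omega> \<Longrightarrow> \<omega>' \<in> \<Omega> \<Longrightarrow> (\<And>j. j < k \<Longrightarrow> \<omega> j = \<omega>' j) \<Longrightarrow> \<phi> \<omega> = \<phi> \<omega>') \<Longrightarrow>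
       has_bochner_integral \<mu> \<phi> (\<Lambda> (\<lambda>x. \<phi> (\<lambda>j. d j x)))"
    using joint_law[of d, OF fin_d simp_E, folded \<Omega>_def] by metis
  define \<delta> where "\<delta> i k \<omega> = \<omega> (prod_encode (i, k))" for i k and \<omega> :: "nat \<Rightarrow> real"
  have \<delta>: "has_bochner_integral \<mu> (\<delta> i k) (\<Lambda> (\<lambda>x. dyadic_round k (e i x)))" for i k
    using law[of "Suc (prod_encode (i, k))" "\<delta> i k"] by (simp add: \<delta>_def d)
  have roundE: "(\<lambda>x. dyadic_round k (e i x)) \<in> E" for i k
    using simp_E[OF fin_d, of "prod_encode (i, k)"] unfolding d[symmetric] .
  have boundE: "(\<lambda>x. r * (1 + (e i x)\<^sup>2)) \<in> E" for i r
    by (intro in_mult gE[OF gadd[OF one sq]])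
  have bound\<Lambda>: "\<Lambda> (\<lambda>x. r * (1 + (e i x)\<^sup>2)) = (c + s i) * r" for i r
    using \<Lambda>(2)[OF gadd[OF one sq]] mult[OF gE[OF gadd[OF one sq]]] by (simp add: mult.commute)
  \<comment> \<open>The integrand depends on two coordinates of \<open>\<omega>\<close>, so its
    integral is a value of \<open>\<Lambda>\<close>; by \<open>dyadic_round_error\<close> that value
    is at most a multiple of \<open>\<Lambda>\<close> at \<open>1 + (e i x)\<^sup>2\<close>, which
    is \<open>c + s i\<close>.\<close>
  have bound: "(\<integral>\<omega>. \<bar>\<delta> i k \<omega> - \<delta> i k' \<omega>\<bar> \<partial>\<mu>) \<le> (c + s i) * ((1/2) ^ k + (1/2) ^ k')" for i k k'
  proof -
    let ?h = "\<lambda>x. \<bar>dyadic_round k (e i x) - dyadic_round k' (e i x)\<bar>"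
    have "has_bochner_integral \<mu> (\<lambda>\<omega>. \<bar>\<delta> i k \<omega> - \<delta> i k' \<omega>\<bar>) (\<Lambda> ?h)"
      using law[of "Suc (max (prod_encode (i, k)) (prod_encode (i, k')))" "\<lambda>\<omega>. \<bar>\<delta> i k \<omega> - \<delta> i k' \<omega>\<bar>"]
      by (simp add: \<delta>_def d less_Suc_eq_le)
    then have "(\<integral>\<omega>. \<bar>\<delta> i k \<omega> - \<delta> i k' \<omega>\<bar> \<partial>\<mu>) = \<Lambda> ?h" by (simp add: has_bochner_integral_iff)
    also have "\<dots> \<le> \<Lambda> (\<lambda>x. ((1/2) ^ k + (1/2) ^ k') * (1 + (e i x)\<^sup>2))"
    proof (rule mono)
      have "finite ((\<lambda>(a, b). \<bar>a - b\<bar>) ` (range (dyadic_round k) \<times> range (dyadic_round k')))"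
        by (intro finite_imageI finite_cartesian_product finite_dyadic_round)
      then show "?h \<in> E" by (rule simp_E[OF finite_subset, rotated]) auto
      show "?h x \<le> ((1/2) ^ k + (1/2) ^ k') * (1 + (e i x)\<^sup>2)" for x
        using dyadic_round_error[of k "e i x"] dyadic_round_error[of k' "e i x"]
        unfolding mult.commute[of _ "1 + (e i x)\<^sup>2"] distrib_left[of "1 + (e i x)\<^sup>2"] by linarith
    qed (rule boundE)
    finally show ?thesis by (simp add: bound\<Lambda>)
  qed
  have int\<delta>: "integrable \<mu> (\<delta> i k)" for i k using \<delta> by (rule integrable.intros)
  note L1 = geometric_L1_Cauchy[OF int\<delta> bound]
  define \<Xi> where "\<Xi> \<omega> = (\<lambda>i. lim (\<lambda>k. \<delta> i k \<omega>))" for \<omega>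
  have \<Xi>_meas: "\<Xi> \<in> borel_measurable \<mu>"
    unfolding \<Xi>_def
    by (intro measurable_coordinatewise_then_product borel_measurable_integrable L1(2))
  have int_\<Xi>: "has_bochner_integral \<mu> (\<lambda>\<omega>. \<Xi> \<omega> i) (l i)" for i
  proof -
    have "(\<lambda>k. \<Lambda> (\<lambda>x. dyadic_round k (e i x))) \<longlonglongrightarrow> l i"
    proof (rule LIM_zero_cancel, rule Lim_null_comparison)
      show "\<forall>\<^sub>F k in sequentially. norm (\<Lambda> (\<lambda>x. dyadic_round k (e i x)) - l i) \<le> (c + s i) * (1/2) ^ k"
      proof (intro always_eventually allI)
        fix k
        have dif: "\<Lambda> (\<lambda>x. dyadic_round k (e i x) - e i x) = \<Lambda> (\<lambda>x. dyadic_round k (e i x)) - l i"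
          using diff[OF roundE gE[OF e]] \<Lambda>(2)[OF e] by simp
        have le: "dyadic_round k (e i x) - e i x \<le> (1/2) ^ k * (1 + (e i x)\<^sup>2)"
          "(- ((1/2) ^ k)) * (1 + (e i x)\<^sup>2) \<le> dyadic_round k (e i x) - e i x" for x
          using dyadic_round_error[of k "e i x"] by (simp_all add: abs_le_iff mult.commute)
        have "\<Lambda> (\<lambda>x. dyadic_round k (e i x) - e i x) \<le> (c + s i) * (1/2) ^ k"
          "(c + s i) * (- ((1/2) ^ k)) \<le> \<Lambda> (\<lambda>x. dyadic_round k (e i x) - e i x)"
          unfolding bound\<Lambda>[symmetric]
          by (intro mono boundE in_diff[OF roundE gE[OF e]] le)+
        then show "norm (\<Lambda> (\<lambda>x. dyadic_round k (e i x)) - l i) \<le> (c + s i) * (1/2) ^ k"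
          unfolding dif by (simp add: abs_le_iff)
      qed
      have "(\<lambda>k. (c + s i) * (1/2) ^ k) \<longlonglongrightarrow> (c + s i) * 0"
        by (intro tendsto_intros LIMSEQ_power_zero) simp
      then show "(\<lambda>k. (c + s i) * (1/2) ^ k) \<longlonglongrightarrow> 0" by simp
    qed
    moreover have "(\<integral>\<omega>. \<delta> i k \<omega> \<partial>\<mu>) = \<Lambda> (\<lambda>x. dyadic_round k (e i x))" for k
      using \<delta> by (rule has_bochner_integral_integral_eq)
    ultimately have "(\<integral>\<omega>. \<Xi> \<omega> i \<partial>\<mu>) = l i"
      using LIMSEQ_unique[OF L1(3)[of i]] by (simp add: \<Xi>_def)
    then show ?thesis using L1(2)[of i] by (simp add: has_bochner_integral_iff \<Xi>_def)
  qed
  \<comment> \<open>The sequences whose first \<open>k\<close> entries come from no point of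
    \<open>X\<close> are null: their indicator vanishes at the roundings of every point of
    \<open>X\<close>, so its integral is \<open>\<Lambda>\<close> of the zero function.\<close>
  have "AE \<omega> in \<mu>. \<exists>x\<in>X. \<forall>j<k. d j x = \<omega> j" for k
  proof -
    let ?\<phi> = "\<lambda>\<omega>. if \<exists>x\<in>X. \<forall>j<k. d j x = \<omega> j then 0 else 1 :: real"
    have "has_bochner_integral \<mu> ?\<phi> (\<Lambda> (\<lambda>x. ?\<phi> (\<lambda>j. d j x)))"
      by (rule law[of k]) simp
    moreover have "\<Lambda> (\<lambda>x. ?\<phi> (\<lambda>j. d j x)) = \<Lambda> (\<lambda>x. 0)"
    proof (rule cong[OF simp_E in_zero])
      show "finite ((\<lambda>x. ?\<phi> (\<lambda>j. d j x)) ` X)"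
        by (rule finite_subset[of _ "{0, 1}"]) auto
    qed auto
    ultimately have "integrable \<mu> ?\<phi>" "(\<integral>\<omega>. ?\<phi> \<omega> \<partial>\<mu>) = 0"
      by (simp_all add: has_bochner_integral_iff zero)
    then have "AE \<omega> in \<mu>. ?\<phi> \<omega> = 0"
      using integral_nonneg_eq_0_iff_AE[of \<mu> ?\<phi>] by simp
    then show ?thesis by eventually_elim (auto split: if_splits)
  qed
  then have "AE \<omega> in \<mu>. \<forall>k. \<exists>x\<in>X. \<forall>j<k. d j x = \<omega> j" by (simp add: AE_all_countable)
  moreover have "AE \<omega> in \<mu>. \<forall>i. (\<lambda>k. \<delta> i k \<omega>) \<longlonglongrightarrow> \<Xi> \<omega> i"
    unfolding AE_all_countable \<Xi>_def using L1(1) by blast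
  ultimately have in_X: "AE \<omega> in \<mu>. \<Xi> \<omega> \<in> (\<lambda>x i. e i x) ` X"
  proof eventually_elim
    case (elim \<omega>)
    \<comment> \<open>\<open>x k\<close> imitates the first \<open>k\<close> entries of
      \<open>\<omega>\<close>. The coordinates of these points converge to
      \<open>\<Xi> \<omega>\<close>, which the closedness of the image keeps inside it.\<close>
    then obtain x where x: "\<And>k. x k \<in> X" "\<And>k j. j < k \<Longrightarrow> d j (x k) = \<omega> j" by metis
    have "(\<lambda>k. e i (x k)) \<longlonglongrightarrow> \<Xi> \<omega> i" for i
    proof (rule LIMSEQ_I)
      fix r :: real assume r: "0 < r"
      have conv: "(\<lambda>k. \<delta> i k \<omega>) \<longlonglongrightarrow> \<Xi> \<omega> i" using elim by blast
      \<comment> \<open>The 1, together with \<open>\<bar>\<Xi> \<omega> i\<bar> + 1 < 2 ^ k\<close>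
        below, places the rounded value strictly inside the window, so that
        \<open>dyadic_round_close\<close> applies. One \<open>r/2\<close> is for the distance to the
        limit, the other for the rounding.\<close>
      have "\<forall>\<^sub>F k in sequentially. dist (\<delta> i k \<omega>) (\<Xi> \<omega> i) < min 1 (r/2)"
        by (rule tendstoD[OF conv]) (use r in simp)
      moreover have "\<forall>\<^sub>F k in sequentially. (1/2) ^ k < r/2"
        by (rule order_tendstoD(2)[OF LIMSEQ_power_zero]) (use r in simp_all)
      moreover have "\<forall>\<^sub>F k in sequentially. \<bar>\<Xi> \<omega> i\<bar> + 1 < 2 ^ k"
        using eventually_gt_at_top[of "nat \<lceil>\<bar>\<Xi> \<omega> i\<bar> + 1\<rceil>"]
      proof eventually_elim
        case (elim k)
        then have "\<bar>\<Xi> \<omega> i\<bar> + 1 < real k" by linarith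
        then show ?case using of_nat_less_two_power[of k, where ?'a = real] by linarith
      qed
      ultimately have "\<forall>\<^sub>F k in sequentially. dist (\<delta> i k \<omega>) (\<Xi> \<omega> i) < min 1 (r/2) \<and>
          (1/2) ^ k < r/2 \<and> \<bar>\<Xi> \<omega> i\<bar> + 1 < 2 ^ k"
        by (intro eventually_conj)
      then obtain k where k: "\<bar>\<delta> i k \<omega> - \<Xi> \<omega> i\<bar> < 1" "\<bar>\<delta> i k \<omega> - \<Xi> \<omega> i\<bar> < r/2"
          "(1/2) ^ k < r/2" "\<bar>\<Xi> \<omega> i\<bar> + 1 < 2 ^ k"
        by (auto simp: eventually_sequentially dist_real_def)
      show "\<exists>n. \<forall>m\<ge>n. norm (e i (x m) - \<Xi> \<omega> i) < r"
      proof (intro exI allI impI)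
        \<comment> \<open>The rounding of \<open>e i\<close> at precision \<open>k\<close> sits at
          index \<open>prod_encode (i, k)\<close>, and \<open>x m\<close> is controlled only at
          indices less than \<open>m\<close>.\<close>
        fix m assume "Suc (prod_encode (i, k)) \<le> m"
        then have "dyadic_round k (e i (x m)) = \<delta> i k \<omega>"
          using x(2)[of "prod_encode (i, k)" m] by (simp add: d \<delta>_def)
        moreover from this have "\<bar>dyadic_round k (e i (x m)) - e i (x m)\<bar> \<le> (1/2) ^ k"
          using k by (intro dyadic_round_close) linarith
        ultimately show "norm (e i (x m) - \<Xi> \<omega> i) < r" using k unfolding real_norm_def by linarith
      qed
    qed
    then have "(\<lambda>k i. e i (x k)) \<longlonglongrightarrow> \<Xi> \<omega>" by (simp add: tendsto_fun_iff)
    then show ?case by (rule closed_sequentially[OF cl, rotated]) (use x(1) in blast)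
  qed
  show thesis
  proof
    show "sets (distr \<mu> borel \<Xi>) = sets borel" by simp
    interpret finite_measure \<mu> by fact
    show "finite_measure (distr \<mu> borel \<Xi>)" by (rule finite_measure_distr[OF \<Xi>_meas])
    show "AE y in distr \<mu> borel \<Xi>. y \<in> (\<lambda>x i. e i x) ` X"
      using in_X cl by (subst AE_distr_iff[OF \<Xi>_meas]) auto
    show "has_bochner_integral (distr \<mu> borel \<Xi>) (\<lambda>y. y i) (l i)" for i
      by (rule has_bochner_integral_distr[OF _ \<Xi>_meas])
         (use int_\<Xi> in \<open>auto intro: borel_measurable_continuous_onI\<close>)
  qed
qed

section \<open>Measures on compact sets\<close>

text \<open>For closed nonempty \<open>S\<close> the indicator is the limit of the continuous
  functions \<open>max 0 (1 - real k * infdist x S)\<close>, so dominated convergence gives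
  agreement on closed sets; these are stable under intersection and generate the Borel sets.\<close>

lemma borel_measure_eqI_continuous:
  fixes M N :: "'a::metric_space measure"
  assumes sets: "sets M = sets borel" "sets N = sets borel"
    and fin: "finite_measure M" "finite_measure N"
    and eq: "\<And>\<phi> :: 'a \<Rightarrow> real. continuous_on UNIV \<phi> \<Longrightarrow> (\<And>x. 0 \<le> \<phi> x \<and> \<phi> x \<le> 1) \<Longrightarrow> (\<integral>x. \<phi> x \<partial>M) = (\<integral>x. \<phi> x \<partial>N)"
  shows "M = N"
proof -
  have lim: "(\<lambda>k. \<integral>x. max 0 (1 - real k * infdist x S) \<partial>P) \<longlonglongrightarrow> measure P S"
    if S: "closed S" "S \<noteq> {}" and P: "sets P = sets borel" "finite_measure P" for S and P :: "'a measure"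
  proof -
    interpret finite_measure P by fact
    have meas: "(\<lambda>x. max 0 (1 - real k * infdist x S)) \<in> borel_measurable P" for k
      unfolding measurable_cong_sets[OF P(1) refl]
      by (intro borel_measurable_continuous_onI continuous_intros)
    have SP: "S \<in> sets P" using S by (simp add: P)
    have "(\<lambda>k. \<integral>x. max 0 (1 - real k * infdist x S) \<partial>P) \<longlonglongrightarrow> (\<integral>x. indicator S x \<partial>P)"
    proof (rule integral_dominated_convergence[where w = "\<lambda>_. 1"])
      show "AE x in P. (\<lambda>k. max 0 (1 - real k * infdist x S)) \<longlonglongrightarrow> indicator S x"
      proof (rule AE_I2)
        fix x
        show "(\<lambda>k. max 0 (1 - real k * infdist x S)) \<longlonglongrightarrow> indicator S x"
        proof (cases "x \<in> S")
          case True
          then show ?thesis by simp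
        next
          case False
          then have pos: "0 < infdist x S"
            using S infdist_pos_not_in_closed by blast
          obtain n where n: "1 < real n * infdist x S" using reals_Archimedean3[OF pos] by blast
          have "\<forall>\<^sub>F k in sequentially. max 0 (1 - real k * infdist x S) = 0"
            using eventually_ge_at_top[of n]
          proof eventually_elim
            case (elim k)
            then have "real n * infdist x S \<le> real k * infdist x S"
              using pos by (intro mult_right_mono) auto
            then show ?case using n by simp
          qed
          then show ?thesis using False by (simp add: tendsto_eventually)
        qed
      qed
      show "AE x in P. norm (max 0 (1 - real k * infdist x S)) \<le> 1" for k
        by (simp add: infdist_nonneg)
    qed (use meas SP in auto)
    then show ?thesis using SP sets.sets_into_space[OF SP] by (simp add: Int_absorb2)
  qed
  interpret M: finite_measure M by fact
  interpret N: finite_measure N by fact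
  have "emeasure M S = emeasure N S" if "closed S" for S
  \<comment> \<open>By convention \<open>infdist x {}\<close> is 0, so for the empty set the
    approximating functions would be constantly 1.\<close>
  proof (cases "S = {}")
    case False
    have "(\<integral>x. max 0 (1 - real k * infdist x S) \<partial>M) = (\<integral>x. max 0 (1 - real k * infdist x S) \<partial>N)" for k
      by (rule eq) (auto intro!: continuous_intros simp: infdist_nonneg)
    then have "measure M S = measure N S"
      using LIMSEQ_unique[OF lim[OF that False sets(1) fin(1)]] lim[OF that False sets(2) fin(2)]
      by simp
    then show ?thesis by (simp add: M.emeasure_eq_measure N.emeasure_eq_measure)
  qed simp
  then show ?thesis
  proof (intro measure_eqI_generator_eq[where E = "Collect closed" and \<Omega> = UNIV and A = "\<lambda>_. UNIV"])
    show "Int_stable (Collect closed)" by (auto simp: Int_stable_def)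
    show "sets M = sigma_sets UNIV (Collect closed)" "sets N = sigma_sets UNIV (Collect closed)"
      unfolding sets borel_eq_closed by simp_all
  qed auto
qed

section \<open>Monomials and the Riesz-Markov theorem on compact sets\<close>

definition monomial :: "'a::euclidean_space list \<Rightarrow> 'a \<Rightarrow> real" where
  "monomial bs x = (\<Prod>b\<leftarrow>bs. x \<bullet> b)"

lemma continuous_on_monomial: "continuous_on S (monomial bs)"
  unfolding monomial_def by (induction bs) (auto intro!: continuous_intros)

instance "fun" :: (type, real_algebra) real_algebra
  by standard (simp_all add: scaleR_fun_def times_fun_def)

lemma span_mult_closed:
  fixes S :: "'a::real_algebra set"
  assumes S: "\<And>f g. f \<in> S \<Longrightarrow> g \<in> S \<Longrightarrow> f * g \<in> S" and f: "f \<in> span S" and g: "g \<in> span S"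
  shows "f * g \<in> span S"
proof -
  have one: "f * g \<in> span S" if f: "f \<in> S" for f
    using g
    by (induction rule: span_induct_alt)
       (simp_all add: distrib_left span_zero span_add span_scale span_base S[OF f])
  show ?thesis
    using f
    by (induction rule: span_induct_alt)
       (simp_all add: distrib_right span_zero span_add span_scale one)
qed

text \<open>With lists as indices, multiplication is concatenation. There are only countably many
  monomials, so they can serve as the sequence \<open>e\<close> in \<open>Haviland\<close>.\<close>

lemma polynomial_in_span_monomials:
  fixes p :: "'a::euclidean_space \<Rightarrow> real"
  assumes "real_polynomial_function p"
  shows "p \<in> span (monomial ` lists Basis)"
  using assms
proof induction
  case (linear f)
  interpret bounded_linear f by fact
  have "f = (\<Sum>b\<in>Basis. f b *\<^sub>R monomial [b])"
  proof
    fix x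
    have "f x = f (\<Sum>b\<in>Basis. (x \<bullet> b) *\<^sub>R b)" by (simp add: euclidean_representation)
    also have "\<dots> = (\<Sum>b\<in>Basis. f b * monomial [b] x)"
      by (simp add: sum scaleR monomial_def mult.commute)
    also have "\<dots> = (\<Sum>b\<in>Basis. f b *\<^sub>R monomial [b]) x"
      using finite_Basis by (induction rule: finite_induct) (auto simp: scaleR_fun_def)
    finally show "f x = (\<Sum>b\<in>Basis. f b *\<^sub>R monomial [b]) x" .
  qed
  also have "\<dots> \<in> span (monomial ` lists Basis)"
    by (intro span_sum span_scale span_base imageI) auto
  finally show ?case .
next
  case (const c)
  have "c *\<^sub>R monomial [] \<in> span (monomial ` lists (Basis :: 'a set))"
    by (intro span_scale span_base imageI) auto
  moreover have "c *\<^sub>R monomial [] = (\<lambda>x :: 'a. c)" by (simp add: fun_eq_iff scaleR_fun_def monomial_def)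
  ultimately show ?case by simp
next
  case (add f g)
  then show ?case using span_add[of f _ g] by (simp add: plus_fun_def)
next
  case (mult f g)
  have "f * g \<in> span (monomial ` lists Basis)"
  proof (rule span_mult_closed[OF _ mult.IH])
    fix f g :: "'a \<Rightarrow> real"
    assume "f \<in> monomial ` lists Basis" "g \<in> monomial ` lists Basis"
    then obtain as bs where *: "f = monomial as" "g = monomial bs" "as \<in> lists Basis" "bs \<in> lists Basis"
      by blast
    then have "f * g = monomial (as @ bs)" by (auto simp: monomial_def times_fun_def)
    then show "f * g \<in> monomial ` lists Basis"
      by (rule image_eqI) (use *(3,4) in simp)
  qed
  then show ?case by (simp add: times_fun_def)
qed

text \<open>\<open>Haviland\<close> with all monomials as coordinates; their joint image is closed
  because \<open>X\<close> is compact. The monomials of degree one recover the point, so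
  \<open>\<Psi>\<close> carries the measure back to \<open>X\<close>, with the right integrals for
  polynomials. Stone-Weierstrass does the rest.\<close>

theorem Riesz_Markov_compact:
  fixes X :: "'a::euclidean_space set" and \<Lambda> :: "('a \<Rightarrow> real) \<Rightarrow> real"
  assumes X: "compact X"
    and lin: "linear_functional_on {\<phi>. continuous_on X \<phi>} \<Lambda>"
    and pos: "\<And>\<phi>. continuous_on X \<phi> \<Longrightarrow> (\<And>x. x \<in> X \<Longrightarrow> 0 \<le> \<phi> x) \<Longrightarrow> 0 \<le> \<Lambda> \<phi>"
  obtains M where "sets M = sets borel" "finite_measure M" "AE x in M. x \<in> X"
    "\<And>\<phi>. continuous_on UNIV \<phi> \<Longrightarrow> has_bochner_integral M \<phi> (\<Lambda> \<phi>)"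
proof -
  have sub: "subspace {\<phi> :: 'a \<Rightarrow> real. continuous_on X \<phi>}"
    by (auto simp: subspace_def zero_fun_def plus_fun_def scaleR_fun_def intro!: continuous_intros)
  interpret positive_functional X "{\<phi>. continuous_on X \<phi>}" \<Lambda>
    by standard (use sub lin pos in auto)
  define e where "e i = monomial (from_nat_into (lists (Basis :: 'a set)) i)" for i
  have cnt: "countable (lists (Basis :: 'a set))" by (intro countable_lists countable_finite finite_Basis)
  have e_surj: "\<exists>i. e i = monomial bs" if "bs \<in> lists Basis" for bs :: "'a list"
    using from_nat_into_surj[OF cnt that] unfolding e_def by metis
  have e_cont: "continuous_on S (e i)" for S i unfolding e_def by (rule continuous_on_monomial)
  define k where "k b = (SOME i. e i = monomial [b])" for b :: 'a
  have k: "e (k b) = monomial [b]" if "b \<in> Basis" for b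
    unfolding k_def by (rule someI_ex) (rule e_surj, use that in simp)
  define \<Phi> where "\<Phi> = (\<lambda>x i. e i x)"
  define \<Psi> :: "(nat \<Rightarrow> real) \<Rightarrow> 'a" where "\<Psi> y = (\<Sum>b\<in>Basis. y (k b) *\<^sub>R b)" for y
  have \<Psi>\<Phi>: "\<Psi> (\<Phi> x) = x" for x
  proof -
    have "\<Psi> (\<Phi> x) = (\<Sum>b\<in>Basis. (x \<bullet> b) *\<^sub>R b)"
      unfolding \<Psi>_def \<Phi>_def by (intro sum.cong refl) (simp add: k monomial_def)
    then show ?thesis by (simp add: euclidean_representation)
  qed
  define g where "g = {(\<phi>, \<Lambda> \<phi>) | \<phi>. continuous_on X \<phi>}"
  obtain M where M: "sets M = sets borel" "finite_measure M" "AE y in M. y \<in> \<Phi> ` X"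
    "\<And>i. has_bochner_integral M (\<lambda>y. y i) (\<Lambda> (e i))"
    unfolding \<Phi>_def
  proof (rule Haviland[of g X "\<Lambda> (\<lambda>x. 1)" e "\<lambda>i. \<Lambda> (e i)" "\<lambda>i. \<Lambda> (\<lambda>x. (e i x)\<^sup>2)"])
    show "subspace g"
      unfolding subspace_def
    proof (intro conjI ballI allI)
      show "0 \<in> g" unfolding g_def using zero
        by (auto simp: zero_prod_def zero_fun_def intro!: exI[of _ "\<lambda>x. 0 :: real"])
    next
      fix a b assume "a \<in> g" "b \<in> g"
      then show "a + b \<in> g" unfolding g_def
        using add in_add by (auto simp: plus_fun_def)
    next
      fix c a assume "a \<in> g"
      then show "c *\<^sub>R a \<in> g" unfolding g_def
        using mult in_mult by (auto simp: scaleR_fun_def)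
    qed
    have "continuous_on X (\<lambda>x i. e i x)"
      by (rule continuous_on_coordinatewise_then_product) (rule e_cont)
    then show "closed ((\<lambda>x i. e i x) ` X)"
      by (intro compact_imp_closed compact_continuous_image X)
  qed (use pos e_cont in \<open>auto simp: g_def intro!: continuous_intros\<close>)
  interpret M: finite_measure M by fact
  have \<Psi>_meas: "\<Psi> \<in> measurable M borel"
    unfolding measurable_cong_sets[OF M(1) refl] \<Psi>_def
    by (intro borel_measurable_continuous_onI continuous_intros continuous_on_product_coordinates)
  define P where "P = distr M borel \<Psi>"
  have P: "sets P = sets borel" by (simp add: P_def)
  interpret P: finite_measure P unfolding P_def by (rule M.finite_measure_distr[OF \<Psi>_meas])
  have P_X: "AE x in P. x \<in> X"
    unfolding P_def
  proof (subst AE_distr_iff[OF \<Psi>_meas])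
    show "{x \<in> space borel. x \<in> X} \<in> sets borel" using compact_imp_closed[OF X] by simp
    show "AE y in M. \<Psi> y \<in> X" using M(3) by eventually_elim (auto simp: \<Psi>\<Phi>)
  qed
  have int_e: "has_bochner_integral P (e i) (\<Lambda> (e i))" for i
    unfolding P_def
  proof (rule has_bochner_integral_distr[OF _ \<Psi>_meas])
    show "e i \<in> borel_measurable borel" using e_cont by (rule borel_measurable_continuous_onI)
    have "AE y in M. y i = e i (\<Psi> y)" using M(3) by eventually_elim (auto simp: \<Psi>\<Phi>, simp add: \<Phi>_def)
    moreover have "(\<lambda>y. e i (\<Psi> y)) \<in> borel_measurable M"
      by (rule measurable_compose[OF \<Psi>_meas]) fact
    ultimately show "has_bochner_integral M (\<lambda>y. e i (\<Psi> y)) (\<Lambda> (e i))"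
      using M(4)[of i] by (subst has_bochner_integral_cong_AE[where g = "\<lambda>y. y i"])
        (auto simp: has_bochner_integral_iff dest: borel_measurable_integrable)
  qed
  \<comment> \<open>Continuity is carried through the induction because additivity of
    \<open>\<Lambda>\<close> is available for continuous functions only.\<close>
  have int_p: "has_bochner_integral P p (\<Lambda> p) \<and> continuous_on X p"
    if p: "real_polynomial_function p" for p
    using polynomial_in_span_monomials[OF p]
  proof (induction rule: span_induct_alt)
    case base
    show ?case
      using has_bochner_integral_zero[of P] zero by (simp add: zero_fun_def)
  next
    case (step c f h)
    then obtain bs where bs: "f = monomial bs" "bs \<in> lists Basis" by (elim imageE)
    obtain i where f: "f = e i" using e_surj[OF bs(2)] bs(1) by metis
    have "continuous_on X (\<lambda>x. c * f x)" unfolding f by (intro continuous_intros e_cont)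
    then have "\<Lambda> (\<lambda>x. c * f x + h x) = c * \<Lambda> f + \<Lambda> h"
      using step e_cont f by (subst add) (auto simp: mult)
    moreover have "has_bochner_integral P (\<lambda>x. c * f x + h x) (c * \<Lambda> f + \<Lambda> h)"
      using step unfolding f by (intro has_bochner_integral_add has_bochner_integral_mult_right int_e) auto
    ultimately show ?case
      using step f e_cont by (auto simp: plus_fun_def scaleR_fun_def intro!: continuous_intros)
  qed
  have int_\<phi>: "has_bochner_integral P \<phi> (\<Lambda> \<phi>)" if \<phi>: "continuous_on UNIV \<phi>" for \<phi>
  proof -
    have \<phi>X: "continuous_on X \<phi>" using \<phi> by (rule continuous_on_subset) simp
    obtain b where b: "\<And>x. x \<in> X \<Longrightarrow> \<bar>\<phi> x\<bar> \<le> b"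
      using compact_imp_bounded[OF compact_continuous_image[OF \<phi>X X]] by (auto simp: bounded_iff)
    have meas: "\<phi> \<in> borel_measurable P"
      unfolding measurable_cong_sets[OF P refl] by (rule borel_measurable_continuous_onI[OF \<phi>])
    have int: "integrable P \<phi>"
      by (rule P.integrable_const_bound[where B = b]) (use P_X b meas in auto)
    let ?m = "measure P (space P)" and ?c = "\<Lambda> (\<lambda>x. 1)"
    have c0: "0 \<le> ?c" by (rule pos) auto
    have close: "\<bar>(\<integral>x. \<phi> x \<partial>P) - \<Lambda> \<phi>\<bar> \<le> (?m + ?c) * r" if r: "0 < r" for r
    proof -
      obtain p where p: "real_polynomial_function p" "\<And>x. x \<in> X \<Longrightarrow> \<bar>\<phi> x - p x\<bar> < r"
        using Stone_Weierstrass_real_polynomial_function[OF X \<phi>X r] by metis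
      note ip = int_p[OF p(1)]
      have "\<bar>(\<integral>x. \<phi> x \<partial>P) - (\<integral>x. p x \<partial>P)\<bar> = \<bar>\<integral>x. \<phi> x - p x \<partial>P\<bar>"
        using int ip by (simp add: has_bochner_integral_iff)
      also have "\<dots> \<le> (\<integral>x. \<bar>\<phi> x - p x\<bar> \<partial>P)" by (rule integral_abs_bound)
      also have "\<dots> \<le> (\<integral>x. r \<partial>P)"
        using int ip P_X p(2) by (intro integral_mono_AE) (auto simp: has_bochner_integral_iff less_imp_le)
      finally have 1: "\<bar>(\<integral>x. \<phi> x \<partial>P) - \<Lambda> p\<bar> \<le> ?m * r"
        using ip by (simp add: has_bochner_integral_iff mult.commute)
      have d: "\<Lambda> (\<lambda>x. \<phi> x - p x) = \<Lambda> \<phi> - \<Lambda> p" using \<phi>X ip by (intro diff) auto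
      have cr: "\<Lambda> (\<lambda>x. s * 1) = s * ?c" for s by (rule mult) auto
      have b1: "\<phi> x - p x \<le> r * 1" "- r * 1 \<le> \<phi> x - p x" if "x \<in> X" for x
        using p(2)[OF that] by auto
      have "\<Lambda> (\<lambda>x. \<phi> x - p x) \<le> r * ?c" "- r * ?c \<le> \<Lambda> (\<lambda>x. \<phi> x - p x)"
        unfolding cr[symmetric]
        by (rule mono; use \<phi>X ip b1 in \<open>auto intro!: continuous_intros\<close>)+
      then have "\<bar>\<Lambda> \<phi> - \<Lambda> p\<bar> \<le> ?c * r" unfolding d by (simp add: abs_le_iff mult.commute)
      then show ?thesis using 1 unfolding distrib_right by linarith
    qed
    have "\<bar>(\<integral>x. \<phi> x \<partial>P) - \<Lambda> \<phi>\<bar> \<le> 0"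
    proof (rule field_le_epsilon)
      fix r :: real assume r: "0 < r"
      \<comment> \<open>The added 1 keeps the denominator positive when both masses vanish.\<close>
      have mc: "0 < ?m + ?c + 1" using c0 measure_nonneg[of P "space P"] by linarith
      have "\<bar>(\<integral>x. \<phi> x \<partial>P) - \<Lambda> \<phi>\<bar> \<le> (?m + ?c) * (r / (?m + ?c + 1))"
        by (rule close) (use r mc in simp)
      also have "\<dots> \<le> (?m + ?c + 1) * (r / (?m + ?c + 1))"
        using r mc by (intro mult_right_mono) auto
      also have "\<dots> = r" using mc by simp
      finally show "\<bar>(\<integral>x. \<phi> x \<partial>P) - \<Lambda> \<phi>\<bar> \<le> 0 + r" by simp
    qed
    then show ?thesis using int by (simp add: has_bochner_integral_iff)
  qed
  show thesis by (rule that[OF P P.finite_measure_axioms P_X int_\<phi>])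
qed

section \<open>The invariant mean\<close>

text \<open>Convex combinations of translates, kept as operators: the same combination has to be
  applied to several functions and to other averages.\<close>

inductive averager :: "('x \<Rightarrow> 'x) set \<Rightarrow> (('x \<Rightarrow> real) \<Rightarrow> 'x \<Rightarrow> real) \<Rightarrow> bool" for T where
  trans: "t \<in> T \<Longrightarrow> averager T (\<lambda>\<phi> x. \<phi> (t x))"
| convex: "averager T A \<Longrightarrow> averager T B \<Longrightarrow> 0 \<le> c \<Longrightarrow> c \<le> 1 \<Longrightarrow>
    averager T (\<lambda>\<phi> x. c * A \<phi> x + (1 - c) * B \<phi> x)"

lemma averager_comp:
  assumes T: "\<And>s t. s \<in> T \<Longrightarrow> t \<in> T \<Longrightarrow> s \<circ> t \<in> T"
    and A: "averager T A" and B: "averager T B"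
  shows "averager T (\<lambda>\<phi>. A (B \<phi>))"
  using A
proof induction
  case (trans t)
  show ?case
    using B
  proof induction
    case (trans s)
    then show ?case using averager.trans[OF T[OF trans \<open>t \<in> T\<close>]] by (simp add: o_def)
  next
    case (convex A B c)
    then show ?case using averager.convex[OF convex.IH convex.hyps(3,4)] by simp
  qed
next
  case (convex A' B' c)
  then show ?case using averager.convex[OF convex.IH convex.hyps(3,4)] by simp
qed

lemma averager_linear:
  assumes "averager T A"
  shows "A (\<lambda>x. a * \<phi> x + b * \<psi> x) = (\<lambda>x. a * A \<phi> x + b * A \<psi> x)"
  using assms by induction (simp_all add: fun_eq_iff algebra_simps)

text \<open>Linearity of \<open>B\<close> moves it past the convex combinations in \<open>A\<close>,
  which reduces the claim to the maps themselves.\<close>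

lemma averager_commute:
  assumes A: "averager S A" and B: "averager T B"
    and ST: "\<And>s t x. s \<in> S \<Longrightarrow> t \<in> T \<Longrightarrow> s (t x) = t (s x)"
  shows "A (B \<phi>) = B (A \<phi>)"
  using A
proof induction
  case (trans s)
  show ?case
    using B by induction (simp_all add: ST trans fun_eq_iff)
next
  case (convex A' B' c)
  then show ?case
    using averager_linear[OF B, of c "A' \<phi>" "1 - c" "B' \<phi>"] by simp
qed

lemma averager_lower:
  assumes "averager T A" "\<And>t. t \<in> T \<Longrightarrow> t ` X \<subseteq> X" "\<And>x. x \<in> X \<Longrightarrow> a \<le> \<phi> x" "x \<in> X"
  shows "a \<le> A \<phi> x"
  using assms
proof (induction arbitrary: x)
  case (convex A B c)
  have "a = c * a + (1 - c) * a" by (simp add: algebra_simps)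
  also have "\<dots> \<le> c * A \<phi> x + (1 - c) * B \<phi> x"
    using convex by (intro add_mono mult_left_mono) auto
  finally show ?case .
qed auto

lemma averager_upper:
  assumes A: "averager T A" and "\<And>t. t \<in> T \<Longrightarrow> t ` X \<subseteq> X" "\<And>x. x \<in> X \<Longrightarrow> \<phi> x \<le> a" "x \<in> X"
  shows "A \<phi> x \<le> a"
proof -
  have "- a \<le> A (\<lambda>x. - \<phi> x) x" by (rule averager_lower[OF A]) (use assms in auto)
  moreover have "A (\<lambda>x. - \<phi> x) x = - A \<phi> x"
    using averager_linear[OF A, of "-1" \<phi> 0 \<phi>] by simp
  ultimately show ?thesis by simp
qed

lemma averager_close:
  assumes A: "averager T A" and T: "\<And>t. t \<in> T \<Longrightarrow> t ` X \<subseteq> X" and \<phi>: "\<And>x. x \<in> X \<Longrightarrow> \<bar>\<phi> x - c\<bar> \<le> r"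
    and x: "x \<in> X"
  shows "\<bar>A \<phi> x - c\<bar> \<le> r"
proof -
  have "c - r \<le> \<phi> y" "\<phi> y \<le> c + r" if "y \<in> X" for y using \<phi>[OF that] by linarith+
  then have "c - r \<le> A \<phi> x" "A \<phi> x \<le> c + r"
    using averager_lower[OF A T _ x, where a = "c - r" and \<phi> = \<phi>]
      averager_upper[OF A T _ x, where a = "c + r" and \<phi> = \<phi>] by blast+
  then show ?thesis by linarith
qed

text \<open>Through this, equicontinuity of \<open>T\<close> gives all averages of \<phi> one common
  modulus of continuity.\<close>

lemma averager_modulus:
  assumes "averager T A" "\<And>t. t \<in> T \<Longrightarrow> \<bar>\<phi> (t x) - \<phi> (t y)\<bar> \<le> r"
  shows "\<bar>A \<phi> x - A \<phi> y\<bar> \<le> r"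
  using assms
proof induction
  case (convex A B c)
  have "\<bar>(c * A \<phi> x + (1 - c) * B \<phi> x) - (c * A \<phi> y + (1 - c) * B \<phi> y)\<bar>
      = \<bar>c * (A \<phi> x - A \<phi> y) + (1 - c) * (B \<phi> x - B \<phi> y)\<bar>" by (simp add: algebra_simps)
  also have "\<dots> \<le> c * \<bar>A \<phi> x - A \<phi> y\<bar> + (1 - c) * \<bar>B \<phi> x - B \<phi> y\<bar>"
    using convex by (intro order_trans[OF abs_triangle_ineq]) (simp add: abs_mult)
  also have "\<dots> \<le> c * r + (1 - c) * r"
    using convex by (intro add_mono mult_left_mono) auto
  finally show ?case by (simp add: algebra_simps)
qed auto

lemma averager_continuous:
  assumes "averager T A" "\<And>t. t \<in> T \<Longrightarrow> continuous_on X t" "\<And>t. t \<in> T \<Longrightarrow> t ` X \<subseteq> X"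
    "continuous_on X \<phi>"
  shows "continuous_on X (A \<phi>)"
  using assms
proof induction
  case (trans t)
  then show ?case by (intro continuous_on_compose2[of X \<phi> X t]) auto
qed (auto intro!: continuous_intros)

lemma averager_mean:
  assumes "finite I" "I \<noteq> {}" "I \<subseteq> T"
  shows "averager T (\<lambda>\<phi> x. (\<Sum>t\<in>I. \<phi> (t x)) / card I)"
  using assms
proof (induction rule: finite_ne_induct)
  case (singleton t)
  then show ?case using averager.trans[of t T] by simp
next
  case (insert t I)
  let ?c = "1 / real (card (insert t I))"
  have "averager T (\<lambda>\<phi> x. ?c * \<phi> (t x) + (1 - ?c) * ((\<Sum>t\<in>I. \<phi> (t x)) / card I))"
    using insert by (intro averager.convex averager.trans) (auto simp: divide_simps)
  also have "(\<lambda>\<phi> x. ?c * \<phi> (t x) + (1 - ?c) * ((\<Sum>t\<in>I. \<phi> (t x)) / card I))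
      = (\<lambda>\<phi> x. (\<Sum>t\<in>insert t I. \<phi> (t x)) / card (insert t I))"
    using insert by (auto simp: fun_eq_iff divide_simps)
  finally show ?case .
qed

text \<open>What the left translations and the right translations of a compact group have in common,
  so that one argument covers both.\<close>

locale compact_transitive =
  fixes X :: "'a::metric_space set" and T :: "('a \<Rightarrow> 'a) set"
  assumes X: "compact X" "X \<noteq> {}"
    and T_maps: "\<And>t. t \<in> T \<Longrightarrow> t ` X \<subseteq> X"
    and T_comp: "\<And>s t. s \<in> T \<Longrightarrow> t \<in> T \<Longrightarrow> s \<circ> t \<in> T"
    and T_transitive: "\<And>x y. x \<in> X \<Longrightarrow> y \<in> X \<Longrightarrow> \<exists>t\<in>T. t x = y"
    and T_equicontinuous: "\<And>r. 0 < r \<Longrightarrow>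
      \<exists>d>0. \<forall>t\<in>T. \<forall>x\<in>X. \<forall>y\<in>X. dist x y < d \<longrightarrow> dist (t x) (t y) < r"
begin

lemma T_in: "t \<in> T \<Longrightarrow> x \<in> X \<Longrightarrow> t x \<in> X"
  using T_maps by blast

lemma T_continuous: "t \<in> T \<Longrightarrow> continuous_on X t"
  unfolding continuous_on_iff using T_equicontinuous by (metis dist_commute)

text \<open>Take a finite net \<open>Y\<close> of \<open>X\<close> and for every \<open>y\<close> in
  it a map sending \<open>y\<close> to \<open>z\<close>; equicontinuity sends the points around
  \<open>y\<close> close to \<open>z\<close>. The bound \<open>k = card Y\<close> does not depend on
  \<open>z\<close>, which matters because \<open>z\<close> is chosen later as a near-minimum of an
  average.\<close>

lemma covering_translates:
  assumes r: "0 < r"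
  obtains k where "0 < k" "\<And>z. z \<in> X \<Longrightarrow> \<exists>I\<subseteq>T. finite I \<and> I \<noteq> {} \<and> card I \<le> k \<and> (\<forall>x\<in>X. \<exists>t\<in>I. dist (t x) z < r)"
proof -
  obtain d where d: "d > 0" "\<And>t x y. t \<in> T \<Longrightarrow> x \<in> X \<Longrightarrow> y \<in> X \<Longrightarrow> dist x y < d \<Longrightarrow> dist (t x) (t y) < r"
    using T_equicontinuous[OF r] by blast
  obtain Y where Y: "finite Y" "Y \<subseteq> X" "X \<subseteq> (\<Union>y\<in>Y. ball y d)"
  proof (rule compactE_image[OF X(1), of X "\<lambda>y. ball y d"])
    show "X \<subseteq> (\<Union>y\<in>X. ball y d)" using d(1) by auto
  qed auto
  have "Y \<noteq> {}" using Y X by auto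
  show thesis
  proof (rule that[of "card Y"])
    show "0 < card Y" using Y \<open>Y \<noteq> {}\<close> by (simp add: card_gt_0_iff)
    fix z assume z: "z \<in> X"
    have "\<forall>y\<in>Y. \<exists>t\<in>T. t y = z" using T_transitive z Y(2) by blast
    then obtain \<tau> where \<tau>: "\<And>y. y \<in> Y \<Longrightarrow> \<tau> y \<in> T" "\<And>y. y \<in> Y \<Longrightarrow> \<tau> y y = z" by metis
    show "\<exists>I\<subseteq>T. finite I \<and> I \<noteq> {} \<and> card I \<le> card Y \<and> (\<forall>x\<in>X. \<exists>t\<in>I. dist (t x) z < r)"
    proof (intro exI[of _ "\<tau> ` Y"] conjI ballI)
      show "\<tau> ` Y \<subseteq> T" using \<tau>(1) by auto
      show "card (\<tau> ` Y) \<le> card Y" by (rule card_image_le[OF Y(1)])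
      fix x assume x: "x \<in> X"
      then obtain y where y: "y \<in> Y" "dist y x < d" using Y(3) by auto
      then have "dist (\<tau> y x) (\<tau> y y) < r"
        using d(2)[OF \<tau>(1)] x Y(2) by (auto simp: dist_commute)
      then show "\<exists>t\<in>\<tau> ` Y. dist (t x) z < r" using y \<tau>(2) by auto
    qed (use Y \<open>Y \<noteq> {}\<close> in auto)
  qed
qed

text \<open>
  If the infimum \<open>w\<^sub>0\<close> of the oscillations of averages of \<open>\<phi>\<close> were positive, averaging once more over
  translates that move every point close to a minimum would decrease it by a definite amount.
\<close>

lemma averages_nearly_constant:
  assumes \<phi>: "continuous_on X \<phi>" and \<delta>: "0 < \<delta>"
  obtains A c where "averager T A" "\<And>x. x \<in> X \<Longrightarrow> \<bar>A \<phi> x - c\<bar> \<le> \<delta>"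
proof -
  define S where "S = {w. 0 \<le> w \<and> (\<exists>A a. averager T A \<and> (\<forall>x\<in>X. a \<le> A \<phi> x \<and> A \<phi> x \<le> a + w))}"
  obtain b where b: "\<And>x. x \<in> X \<Longrightarrow> \<bar>\<phi> x\<bar> \<le> b"
    using compact_imp_bounded[OF compact_continuous_image[OF \<phi> X(1)]] by (auto simp: bounded_iff)
  obtain x0 where x0: "x0 \<in> X" using X by blast
  then obtain t0 where "t0 \<in> T" using T_transitive by blast
  then have "2 * b \<in> S"
    unfolding S_def using b b[OF x0] T_in
    by (auto intro!: exI[of _ "\<lambda>\<phi> x. \<phi> (t0 x)"] exI[of _ "-b"] averager.trans simp: abs_le_iff minus_le_iff)
  have bdd: "bdd_below S" by (auto simp: S_def)
  define w0 where "w0 = Inf S"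
  have w0: "w0 \<le> w" if "w \<in> S" for w
    unfolding w0_def by (rule cInf_lower[OF that bdd])
  have w0_nonneg: "0 \<le> w0"
    unfolding w0_def
  proof (rule cInf_greatest)
    show "S \<noteq> {}" using \<open>2 * b \<in> S\<close> by blast
  qed (simp add: S_def)
  have "w0 = 0"
  proof (rule ccontr)
    assume "w0 \<noteq> 0"
    then have pos: "0 < w0" using w0_nonneg by simp
    have "uniformly_continuous_on X \<phi>" by (rule compact_uniformly_continuous[OF \<phi> X(1)])
    then obtain r where r: "r > 0" "\<And>x y. x \<in> X \<Longrightarrow> y \<in> X \<Longrightarrow> dist x y < r \<Longrightarrow> dist (\<phi> x) (\<phi> y) < w0/4"
      unfolding uniformly_continuous_on_def using pos by (metis dist_commute divide_pos_pos zero_less_numeral)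
    obtain d where d: "d > 0" "\<And>t x y. t \<in> T \<Longrightarrow> x \<in> X \<Longrightarrow> y \<in> X \<Longrightarrow> dist x y < d \<Longrightarrow> dist (t x) (t y) < r"
      using T_equicontinuous[OF r(1)] by blast
    obtain k where k: "0 < k" "\<And>z. z \<in> X \<Longrightarrow>
        \<exists>I\<subseteq>T. finite I \<and> I \<noteq> {} \<and> card I \<le> k \<and> (\<forall>x\<in>X. \<exists>t\<in>I. dist (t x) z < d)"
      using covering_translates[OF d(1)] by metis
    \<comment> \<open>The slack is the amount that the additional averaging over at most
      \<open>k\<close> translates is going to gain.\<close>
    have "Inf S < w0 + w0 / (4 * real k)" using pos k by (simp add: w0_def)
    then obtain w where w: "w \<in> S" "w < w0 + w0 / (4 * real k)"
      using cInf_lessD[of S] \<open>2 * b \<in> S\<close> by blast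
    then obtain A a where A: "averager T A" "\<And>x. x \<in> X \<Longrightarrow> a \<le> A \<phi> x \<and> A \<phi> x \<le> a + w"
      unfolding S_def by blast
    have "w0 / (4 * real k) \<le> w0 / 4" using pos k(1) by (intro divide_left_mono) auto
    then have w': "w0 \<le> w" "w < w0 + w0/4" using w w0 by auto
    \<comment> \<open>Otherwise all values lie between \<open>a + w0/2\<close> and
      \<open>a + w\<close>, an interval shorter than \<open>w0\<close>.\<close>
    have "\<exists>z\<in>X. A \<phi> z \<le> a + w0/2"
    proof (rule ccontr)
      assume no: "\<not> (\<exists>z\<in>X. A \<phi> z \<le> a + w0/2)"
      have "w - w0/2 \<in> S"
        unfolding S_def
      proof (intro CollectI conjI exI[of _ A] exI[of _ "a + w0/2"] ballI)
        show "0 \<le> w - w0/2" using w' pos by simp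
        show "averager T A" by fact
        show "a + w0/2 \<le> A \<phi> x" "A \<phi> x \<le> a + w0/2 + (w - w0/2)" if "x \<in> X" for x
          using no that A(2)[OF that] by force+
      qed
      then show False using w0 w' pos by fastforce
    qed
    then obtain z where z: "z \<in> X" "A \<phi> z \<le> a + w0/2" by blast
    obtain I where I: "I \<subseteq> T" "finite I" "I \<noteq> {}" "card I \<le> k" "\<forall>x\<in>X. \<exists>t\<in>I. dist (t x) z < d"
      using k(2)[OF z(1)] by blast
    define B where "B = (\<lambda>\<phi> x. (\<Sum>t\<in>I. \<phi> (t x)) / card I :: real)"
    have B: "averager T B" unfolding B_def by (rule averager_mean[OF I(2,3,1)])
    have cI: "0 < card I" using I by (simp add: card_gt_0_iff)
    have low: "a \<le> B (A \<phi>) x" if "x \<in> X" for x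
      by (rule averager_lower[OF B T_maps _ that]) (use A(2) in auto)
    \<comment> \<open>Among the translates of \<open>x\<close> one is near \<open>z\<close> and
      contributes at most \<open>a + 3 * w0/4\<close>, the others at most \<open>a + w\<close>. As
      \<open>w0 \<le> w\<close>, the bound on the sum drops by at least \<open>w0/4\<close>, that on
      the mean by at least \<open>w0 / (4 * real k)\<close>.\<close>
    have up: "B (A \<phi>) x \<le> a + (w - w0 / (4 * real k))" if x: "x \<in> X" for x
    proof -
      obtain s where s: "s \<in> I" "dist (s x) z < d" using I(5) x by blast
      have sx: "s x \<in> X" using s I x T_in by blast
      have "\<bar>A \<phi> (s x) - A \<phi> z\<bar> \<le> w0/4"
        by (rule averager_modulus[OF A(1)])
           (use r(2) d(2) s sx z T_in in \<open>auto simp: dist_real_def intro!: less_imp_le\<close>)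
      then have s_le: "A \<phi> (s x) \<le> a + 3 * w0/4" using z by linarith
      have "(\<Sum>t\<in>I. A \<phi> (t x)) = A \<phi> (s x) + (\<Sum>t\<in>I - {s}. A \<phi> (t x))"
        using s I by (simp add: sum.remove)
      also have "(\<Sum>t\<in>I - {s}. A \<phi> (t x)) \<le> of_nat (card (I - {s})) * (a + w)"
        by (rule sum_bounded_above) (use A(2) I T_in x in auto)
      also have "of_nat (card (I - {s})) = real (card I) - 1"
        using s I cI by (simp add: card_Diff_singleton of_nat_diff)
      finally have "(\<Sum>t\<in>I. A \<phi> (t x)) \<le> card I * (a + w) - (w - 3 * w0/4)"
        using s_le by (simp add: algebra_simps)
      then have "(\<Sum>t\<in>I. A \<phi> (t x)) \<le> card I * (a + w) - w0/4" using w' by linarith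
      then have "B (A \<phi>) x \<le> (card I * (a + w) - w0/4) / card I"
        unfolding B_def by (simp add: divide_right_mono)
      also have "\<dots> = a + w - w0 / (4 * real (card I))" using cI by (simp add: diff_divide_distrib)
      also have "\<dots> \<le> a + w - w0 / (4 * real k)"
        using pos cI k I(4) by (auto intro!: divide_left_mono)
      finally show ?thesis by simp
    qed
    have "w - w0 / (4 * real k) \<in> S"
      unfolding S_def
    proof (intro CollectI conjI exI[of _ "\<lambda>\<phi>. B (A \<phi>)"] exI[of _ a] ballI)
      show "0 \<le> w - w0 / (4 * real k)" using low[OF x0] up[OF x0] by linarith
      show "averager T (\<lambda>\<phi>. B (A \<phi>))" by (rule averager_comp[OF T_comp B A(1)])
    qed (use low up in auto)
    then show False using w0 w by fastforce
  qed
  then have "Inf S < \<delta>" using \<delta> by (simp add: w0_def)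
  then obtain w where w: "w \<in> S" "w < \<delta>" using cInf_lessD[of S] \<open>2 * b \<in> S\<close> by blast
  then obtain A a where A: "averager T A" "\<And>x. x \<in> X \<Longrightarrow> a \<le> A \<phi> x \<and> A \<phi> x \<le> a + w"
    unfolding S_def by blast
  show thesis
    by (rule that[OF A(1), of a]) (use A(2) w in fastforce)
qed

end

section \<open>The mean of two commuting transitive families\<close>

definition nearly :: "'a set \<Rightarrow> ('a \<Rightarrow> 'a) set \<Rightarrow> ('a \<Rightarrow> real) \<Rightarrow> real \<Rightarrow> real \<Rightarrow> bool" where
  "nearly X T \<phi> c \<delta> \<longleftrightarrow> (\<exists>A. averager T A \<and> (\<forall>x\<in>X. \<bar>A \<phi> x - c\<bar> \<le> \<delta>))"

locale compact_bitransitive = L: compact_transitive X L + R: compact_transitive X R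
  for X :: "'a::metric_space set" and L R +
  assumes commute: "\<And>s t x. s \<in> L \<Longrightarrow> t \<in> R \<Longrightarrow> s (t x) = t (s x)"
begin

lemma averagers_commute: "averager L A \<Longrightarrow> averager R B \<Longrightarrow> A (B \<phi>) = B (A \<phi>)"
  by (rule averager_commute) (auto intro: commute)

text \<open>The function \<open>A (B \<phi>) = B (A \<phi>)\<close> is within
  \<open>\<delta>\<close> of \<open>c\<close> and within \<open>\<epsilon>\<close> of
  \<open>d\<close>, since averaging does not enlarge the distance to a constant.\<close>

lemma nearly_close:
  assumes "nearly X L \<phi> c \<delta>" "nearly X R \<phi> d \<epsilon>"
  shows "\<bar>c - d\<bar> \<le> \<delta> + \<epsilon>"
proof -
  obtain A B where A: "averager L A" "\<And>x. x \<in> X \<Longrightarrow> \<bar>A \<phi> x - c\<bar> \<le> \<delta>"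
    and B: "averager R B" "\<And>x. x \<in> X \<Longrightarrow> \<bar>B \<phi> x - d\<bar> \<le> \<epsilon>"
    using assms unfolding nearly_def by blast
  obtain x where x: "x \<in> X" using L.X by blast
  have "\<bar>B (A \<phi>) x - c\<bar> \<le> \<delta>" by (rule averager_close[OF B(1) R.T_maps A(2) x])
  moreover have "\<bar>A (B \<phi>) x - d\<bar> \<le> \<epsilon>" by (rule averager_close[OF A(1) L.T_maps B(2) x])
  ultimately show ?thesis using averagers_commute[OF A(1) B(1), of \<phi>] by (simp add: abs_le_iff)
qed

text \<open>By \<open>nearly_close\<close>, each lower bound \<open>c - \<delta>\<close> from the
  left family is below each upper bound \<open>d + \<epsilon>\<close> from the right one. The
  supremum of the lower bounds is the common constant.\<close>

lemma mean_exists: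
  assumes \<phi>: "continuous_on X \<phi>"
  shows "\<exists>c. \<forall>\<delta>>0. nearly X L \<phi> c \<delta> \<and> nearly X R \<phi> c \<delta>"
proof -
  have exL: "\<exists>c. nearly X L \<phi> c \<delta>" and exR: "\<exists>c. nearly X R \<phi> c \<delta>" if "0 < \<delta>" for \<delta>
    using L.averages_nearly_constant[OF \<phi> that] R.averages_nearly_constant[OF \<phi> that]
    unfolding nearly_def by metis+
  define S where "S = {c - \<delta> | c \<delta>. 0 < \<delta> \<and> nearly X L \<phi> c \<delta>}"
  obtain c1 where "nearly X L \<phi> c1 1" using exL[of 1] by auto
  then have "c1 - 1 \<in> S" unfolding S_def by (intro CollectI exI[of _ c1] exI[of _ 1]) simp
  then have ne: "S \<noteq> {}" by blast
  have ub: "s \<le> d + \<epsilon>" if "s \<in> S" "nearly X R \<phi> d \<epsilon>" for s d \<epsilon>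
    using nearly_close[OF _ that(2)] that(1) by (fastforce simp: S_def)
  obtain d1 where "nearly X R \<phi> d1 1" using exR[of 1] by auto
  then have bdd: "bdd_above S" using ub by (auto intro!: bdd_aboveI)
  define c where "c = Sup S"
  have lo: "c0 - \<delta> \<le> c" if "0 < \<delta>" "nearly X L \<phi> c0 \<delta>" for c0 \<delta>
    unfolding c_def by (rule cSup_upper[OF _ bdd]) (use that in \<open>auto simp: S_def\<close>)
  have hi: "c \<le> d + \<epsilon>" if "nearly X R \<phi> d \<epsilon>" for d \<epsilon>
    unfolding c_def by (rule cSup_least[OF ne]) (use ub that in auto)
  have weaken: "nearly X T \<phi> c \<delta>" if "nearly X T \<phi> c0 \<epsilon>" "\<bar>c - c0\<bar> + \<epsilon> \<le> \<delta>" for T c0 \<epsilon> \<delta>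
    using that unfolding nearly_def by (fastforce simp: abs_le_iff)
  show ?thesis
  proof (intro exI[of _ c] allI impI conjI)
    fix \<delta> :: real assume "0 < \<delta>"
    \<comment> \<open>Three parts bound the distance of the approximate constant from
      \<open>c\<close>, the fourth is its own error.\<close>
    define \<epsilon> where "\<epsilon> = \<delta> / 4"
    have \<epsilon>: "0 < \<epsilon>" using \<open>0 < \<delta>\<close> by (simp add: \<epsilon>_def)
    obtain a b where ab: "nearly X L \<phi> a \<epsilon>" "nearly X R \<phi> b \<epsilon>" using exL[OF \<epsilon>] exR[OF \<epsilon>] by blast
    have "\<bar>c - a\<bar> \<le> 3 * \<epsilon>" "\<bar>c - b\<bar> \<le> 3 * \<epsilon>"
      using lo[OF \<epsilon> ab(1)] hi[OF ab(2)] nearly_close[OF ab] by (auto simp: abs_le_iff)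
    then show "nearly X L \<phi> c \<delta>" "nearly X R \<phi> c \<delta>"
      using ab by (auto intro!: weaken simp: \<epsilon>_def)
  qed
qed

definition mean :: "('a \<Rightarrow> real) \<Rightarrow> real" where
  "mean \<phi> = (SOME c. \<forall>\<delta>>0. nearly X L \<phi> c \<delta> \<and> nearly X R \<phi> c \<delta>)"

lemma mean:
  assumes "continuous_on X \<phi>" "0 < \<delta>"
  shows "nearly X L \<phi> (mean \<phi>) \<delta>" "nearly X R \<phi> (mean \<phi>) \<delta>"
  using someI_ex[OF mean_exists[OF assms(1)]] assms(2) unfolding mean_def by blast+

text \<open>Approximations from one side suffice, because \<open>nearly_close\<close> compares them
  with those of the mean from the other side.\<close>

lemma mean_unique_L:
  assumes \<phi>: "continuous_on X \<phi>" and c: "\<And>\<delta>. 0 < \<delta> \<Longrightarrow> nearly X L \<phi> c \<delta>"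
  shows "mean \<phi> = c"
proof -
  have "\<bar>c - mean \<phi>\<bar> \<le> 0"
  proof (rule field_le_epsilon)
    fix e :: real assume "0 < e"
    then show "\<bar>c - mean \<phi>\<bar> \<le> 0 + e"
      using nearly_close[OF c[of "e/2"] mean(2)[OF \<phi>, of "e/2"]] by simp
  qed
  then show ?thesis by simp
qed

lemma mean_unique_R:
  assumes \<phi>: "continuous_on X \<phi>" and c: "\<And>\<delta>. 0 < \<delta> \<Longrightarrow> nearly X R \<phi> c \<delta>"
  shows "mean \<phi> = c"
proof -
  have "\<bar>mean \<phi> - c\<bar> \<le> 0"
  proof (rule field_le_epsilon)
    fix e :: real assume "0 < e"
    then show "\<bar>mean \<phi> - c\<bar> \<le> 0 + e"
      using nearly_close[OF mean(1)[OF \<phi>, of "e/2"] c[of "e/2"]] by simp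
  qed
  then show ?thesis by simp
qed

lemma mean_lower:
  assumes \<phi>: "continuous_on X \<phi>" and a: "\<And>x. x \<in> X \<Longrightarrow> a \<le> \<phi> x"
  shows "a \<le> mean \<phi>"
proof (rule field_le_epsilon)
  fix e :: real assume "0 < e"
  then obtain A where A: "averager L A" "\<And>x. x \<in> X \<Longrightarrow> \<bar>A \<phi> x - mean \<phi>\<bar> \<le> e"
    using mean(1)[OF \<phi>] unfolding nearly_def by blast
  obtain x where x: "x \<in> X" using L.X by blast
  have "a \<le> A \<phi> x" by (rule averager_lower[OF A(1) L.T_maps a x])
  then show "a \<le> mean \<phi> + e" using A(2)[OF x] by (simp add: abs_le_iff)
qed

lemma mean_scale:
  assumes \<phi>: "continuous_on X \<phi>"
  shows "mean (\<lambda>x. c * \<phi> x) = c * mean \<phi>"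
proof (rule mean_unique_L)
  show "continuous_on X (\<lambda>x. c * \<phi> x)" using \<phi> by (intro continuous_intros)
  fix \<delta> :: real assume "0 < \<delta>"
  then have "0 < \<delta> / (\<bar>c\<bar> + 1)" by (simp add: add_nonneg_pos)
  then obtain A where A: "averager L A" "\<And>x. x \<in> X \<Longrightarrow> \<bar>A \<phi> x - mean \<phi>\<bar> \<le> \<delta> / (\<bar>c\<bar> + 1)"
    using mean(1)[OF \<phi>] unfolding nearly_def by blast
  have "\<bar>A (\<lambda>x. c * \<phi> x) x - c * mean \<phi>\<bar> \<le> \<delta>" if "x \<in> X" for x
  proof -
    have "\<bar>A (\<lambda>x. c * \<phi> x) x - c * mean \<phi>\<bar> = \<bar>c\<bar> * \<bar>A \<phi> x - mean \<phi>\<bar>"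
      using averager_linear[OF A(1), of c \<phi> 0 \<phi>] by (simp add: abs_mult[symmetric] algebra_simps)
    also have "\<dots> \<le> (\<bar>c\<bar> + 1) * (\<delta> / (\<bar>c\<bar> + 1))"
      using A(2)[OF that] \<open>0 < \<delta>\<close> by (intro mult_mono) auto
    also have "\<dots> = \<delta>" by (simp add: add_nonneg_pos less_imp_neq[symmetric])
    finally show ?thesis .
  qed
  then show "nearly X L (\<lambda>x. c * \<phi> x) (c * mean \<phi>) \<delta>" unfolding nearly_def using A(1) by blast
qed

text \<open>A right averager that flattens \<phi> also flattens \<open>B \<phi>\<close>, to the same
  constant, because it commutes with \<open>B\<close>. A single translation is an averager, so left
  invariance is a special case.\<close>

lemma mean_averager_L:
  assumes \<phi>: "continuous_on X \<phi>" and B: "averager L B"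
  shows "mean (B \<phi>) = mean \<phi>"
proof (rule mean_unique_R)
  show "continuous_on X (B \<phi>)"
    by (rule averager_continuous[OF B L.T_continuous L.T_maps \<phi>])
  fix \<delta> :: real assume "0 < \<delta>"
  then obtain A where A: "averager R A" "\<And>x. x \<in> X \<Longrightarrow> \<bar>A \<phi> x - mean \<phi>\<bar> \<le> \<delta>"
    using mean(2)[OF \<phi>] unfolding nearly_def by blast
  have "\<bar>B (A \<phi>) x - mean \<phi>\<bar> \<le> \<delta>" if x: "x \<in> X" for x
    by (rule averager_close[OF B L.T_maps A(2) x])
  then show "nearly X R (B \<phi>) (mean \<phi>) \<delta>"
    unfolding nearly_def averagers_commute[OF B A(1)] using A(1) by blast
qed

lemma mean_averager_R:
  assumes \<phi>: "continuous_on X \<phi>" and B: "averager R B"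
  shows "mean (B \<phi>) = mean \<phi>"
proof (rule mean_unique_L)
  show "continuous_on X (B \<phi>)"
    by (rule averager_continuous[OF B R.T_continuous R.T_maps \<phi>])
  fix \<delta> :: real assume "0 < \<delta>"
  then obtain A where A: "averager L A" "\<And>x. x \<in> X \<Longrightarrow> \<bar>A \<phi> x - mean \<phi>\<bar> \<le> \<delta>"
    using mean(1)[OF \<phi>] unfolding nearly_def by blast
  have "\<bar>B (A \<phi>) x - mean \<phi>\<bar> \<le> \<delta>" if x: "x \<in> X" for x
    by (rule averager_close[OF B R.T_maps A(2) x])
  then show "nearly X L (B \<phi>) (mean \<phi>) \<delta>"
    unfolding nearly_def averagers_commute[OF A(1) B, symmetric] using A(1) by blast
qed

text \<open>The averager that flattens \<phi> and the one that flattens \<psi> are taken from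
  opposite sides. They commute, so both together bring the sum close to the sum of the means, and
  neither changes the mean of the sum.\<close>

lemma mean_add:
  assumes \<phi>: "continuous_on X \<phi>" and \<psi>: "continuous_on X \<psi>"
  shows "mean (\<lambda>x. \<phi> x + \<psi> x) = mean \<phi> + mean \<psi>"
proof -
  let ?\<chi> = "\<lambda>x. \<phi> x + \<psi> x"
  have \<chi>: "continuous_on X ?\<chi>" using \<phi> \<psi> by (intro continuous_intros)
  have "\<bar>mean ?\<chi> - (mean \<phi> + mean \<psi>)\<bar> \<le> 0"
  proof (rule field_le_epsilon)
    fix e :: real assume "0 < e"
    then have e: "0 < e/2" by simp
    obtain A where A: "averager R A" "\<And>x. x \<in> X \<Longrightarrow> \<bar>A \<phi> x - mean \<phi>\<bar> \<le> e/2"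
      using mean(2)[OF \<phi> e] unfolding nearly_def by blast
    obtain B where B: "averager L B" "\<And>x. x \<in> X \<Longrightarrow> \<bar>B \<psi> x - mean \<psi>\<bar> \<le> e/2"
      using mean(1)[OF \<psi> e] unfolding nearly_def by blast
    have BA: "B (A f) = A (B f)" for f by (rule averagers_commute[OF B(1) A(1)])
    have cB: "continuous_on X (B ?\<chi>)"
      by (rule averager_continuous[OF B(1) L.T_continuous L.T_maps \<chi>])
    have cA: "continuous_on X (A (B ?\<chi>))"
      by (rule averager_continuous[OF A(1) R.T_continuous R.T_maps cB])
    have eq: "A (B ?\<chi>) x = B (A \<phi>) x + A (B \<psi>) x" for x
      using averager_linear[OF B(1), of 1 \<phi> 1 \<psi>] averager_linear[OF A(1), of 1 "B \<phi>" 1 "B \<psi>"]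
      by (simp add: BA)
    have b: "\<bar>A (B ?\<chi>) x - (mean \<phi> + mean \<psi>)\<bar> \<le> e" if x: "x \<in> X" for x
    proof -
      have "\<bar>B (A \<phi>) x - mean \<phi>\<bar> \<le> e/2" by (rule averager_close[OF B(1) L.T_maps A(2) x])
      moreover have "\<bar>A (B \<psi>) x - mean \<psi>\<bar> \<le> e/2" by (rule averager_close[OF A(1) R.T_maps B(2) x])
      ultimately show ?thesis unfolding eq by linarith
    qed
    have m: "mean ?\<chi> = mean (A (B ?\<chi>))"
      using mean_averager_R[OF cB A(1)] mean_averager_L[OF \<chi> B(1)] by simp
    have "mean \<phi> + mean \<psi> - e \<le> mean (A (B ?\<chi>))"
      by (rule mean_lower[OF cA]) (use b in \<open>fastforce simp: abs_le_iff\<close>)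
    moreover have "- (mean \<phi> + mean \<psi> + e) \<le> mean (\<lambda>x. (-1) * A (B ?\<chi>) x)"
    proof (rule mean_lower)
      show "continuous_on X (\<lambda>x. (-1) * A (B ?\<chi>) x)" using cA by (intro continuous_intros)
      show "- (mean \<phi> + mean \<psi> + e) \<le> (-1) * A (B ?\<chi>) x" if "x \<in> X" for x
        using b[OF that] by (simp add: abs_le_iff)
    qed
    ultimately show "\<bar>mean ?\<chi> - (mean \<phi> + mean \<psi>)\<bar> \<le> 0 + e"
      unfolding mean_scale[OF cA] m by (simp add: abs_le_iff)
  qed
  then show ?thesis by simp
qed

lemma mean_const: "mean (\<lambda>x. c) = c"
proof (rule mean_unique_L)
  obtain x where "x \<in> X" using L.X by blast
  then obtain t where t: "t \<in> L" using L.T_transitive by blast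
  show "nearly X L (\<lambda>x. c) c \<delta>" if "0 < \<delta>" for \<delta>
    unfolding nearly_def by (rule exI, rule conjI, rule averager.trans[OF t]) (use that in simp)
qed simp

lemma linear_mean: "linear_functional_on {\<phi>. continuous_on X \<phi>} mean"
  unfolding linear_functional_on_def using mean_add mean_scale
  by (simp add: plus_fun_def scaleR_fun_def)

end

section \<open>Haar measure of a compact matrix group\<close>

lemma continuous_on_matrix_mult:
  fixes f g :: "'a::topological_space \<Rightarrow> real^'n^'n"
  assumes "continuous_on S f" "continuous_on S g"
  shows "continuous_on S (\<lambda>x. f x ** g x)"
  unfolding matrix_matrix_mult_def
  by (intro continuous_on_vec_lambda continuous_intros assms continuous_on_component)

lemma matrix_inv:
  assumes "invertible A"
  shows "A ** matrix_inv A = mat 1" "matrix_inv A ** A = mat 1"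
  using someI_ex[of "\<lambda>A'. A ** A' = mat 1 \<and> A' ** A = mat 1"] assms
  by (auto simp: invertible_def matrix_inv_def)

text \<open>Associativity makes left and right translations commute, uniform continuity of the
  product on the compact \<open>G \<times> G\<close> makes each family equicontinuous, and quotients
  such as \<open>y ** matrix_inv x\<close> give transitivity. Riesz-Markov turns the resulting mean
  into a measure, whose invariance is tested on continuous functions.\<close>

theorem Haar_measure_compact_matrix_group:
  fixes G :: "(real^'n^'n) set"
  assumes G: "compact G" "mat 1 \<in> G" "\<And>a b. a \<in> G \<Longrightarrow> b \<in> G \<Longrightarrow> a ** b \<in> G"
    and inv: "\<And>a. a \<in> G \<Longrightarrow> invertible a" "\<And>a. a \<in> G \<Longrightarrow> matrix_inv a \<in> G"
  obtains h where "finite_measure h" "measure h UNIV = 1" "sets h = sets borel" "AE a in h. a \<in> G"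
    "\<And>k. k \<in> G \<Longrightarrow> distr h borel (\<lambda>a. k ** a) = h" "\<And>k. k \<in> G \<Longrightarrow> distr h borel (\<lambda>a. a ** k) = h"
proof -
  have uc: "uniformly_continuous_on (G \<times> G) (\<lambda>p. fst p ** snd p)"
    by (intro compact_uniformly_continuous compact_Times G(1) continuous_on_matrix_mult continuous_intros)
  have equi: "\<exists>d>0. \<forall>p\<in>G \<times> G. \<forall>q\<in>G \<times> G. dist p q < d \<longrightarrow> dist (fst p ** snd p) (fst q ** snd q) < r"
    if "0 < r" for r
    using uc that unfolding uniformly_continuous_on_def by (metis dist_commute)
  interpret L: compact_transitive G "(\<lambda>a x. a ** x) ` G"
  proof
    show "t ` G \<subseteq> G" if "t \<in> (\<lambda>a x. a ** x) ` G" for t using that G(3) by auto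
    show "s \<circ> t \<in> (\<lambda>a x. a ** x) ` G"
      if st: "s \<in> (\<lambda>a x. a ** x) ` G" "t \<in> (\<lambda>a x. a ** x) ` G" for s t
    proof -
      obtain a b where "a \<in> G" "b \<in> G" "s = (\<lambda>x. a ** x)" "t = (\<lambda>x. b ** x)" using st by blast
      then show ?thesis using G(3)[of a b] by (auto simp: fun_eq_iff matrix_mul_assoc intro!: image_eqI[of _ _ "a ** b"])
    qed
    show "\<exists>t\<in>(\<lambda>a x. a ** x) ` G. t x = y" if "x \<in> G" "y \<in> G" for x y
    proof (rule bexI[of _ "\<lambda>z. y ** matrix_inv x ** z"])
      show "y ** matrix_inv x ** x = y"
        using that inv by (simp add: matrix_mul_assoc[symmetric] matrix_inv)
    qed (use that G(3) inv in \<open>intro imageI, simp\<close>)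
    fix r :: real assume "0 < r"
    then obtain d where "d > 0" "\<forall>p\<in>G \<times> G. \<forall>q\<in>G \<times> G. dist p q < d \<longrightarrow> dist (fst p ** snd p) (fst q ** snd q) < r"
      using equi by blast
    then show "\<exists>d>0. \<forall>t\<in>(\<lambda>a x. a ** x) ` G. \<forall>x\<in>G. \<forall>y\<in>G. dist x y < d \<longrightarrow> dist (t x) (t y) < r"
      by (intro exI[of _ d]) (force simp: dist_prod_def)
  qed (use G in auto)
  interpret R: compact_transitive G "(\<lambda>a x. x ** a) ` G"
  proof
    show "t ` G \<subseteq> G" if "t \<in> (\<lambda>a x. x ** a) ` G" for t using that G(3) by auto
    show "s \<circ> t \<in> (\<lambda>a x. x ** a) ` G"
      if st: "s \<in> (\<lambda>a x. x ** a) ` G" "t \<in> (\<lambda>a x. x ** a) ` G" for s t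
    proof -
      obtain a b where "a \<in> G" "b \<in> G" "s = (\<lambda>x. x ** a)" "t = (\<lambda>x. x ** b)" using st by blast
      then show ?thesis using G(3)[of b a] by (auto simp: fun_eq_iff matrix_mul_assoc intro!: image_eqI[of _ _ "b ** a"])
    qed
    show "\<exists>t\<in>(\<lambda>a x. x ** a) ` G. t x = y" if "x \<in> G" "y \<in> G" for x y
    proof (rule bexI[of _ "\<lambda>z. z ** (matrix_inv x ** y)"])
      show "x ** (matrix_inv x ** y) = y"
        using that inv by (simp add: matrix_mul_assoc matrix_inv)
    qed (use that G(3) inv in \<open>intro imageI, simp\<close>)
    fix r :: real assume "0 < r"
    then obtain d where "d > 0" "\<forall>p\<in>G \<times> G. \<forall>q\<in>G \<times> G. dist p q < d \<longrightarrow> dist (fst p ** snd p) (fst q ** snd q) < r"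
      using equi by blast
    then show "\<exists>d>0. \<forall>t\<in>(\<lambda>a x. x ** a) ` G. \<forall>x\<in>G. \<forall>y\<in>G. dist x y < d \<longrightarrow> dist (t x) (t y) < r"
      by (intro exI[of _ d]) (force simp: dist_prod_def)
  qed (use G in auto)
  interpret compact_bitransitive G "(\<lambda>a x. a ** x) ` G" "(\<lambda>a x. x ** a) ` G"
    by standard (auto simp: matrix_mul_assoc)
  obtain h where h: "sets h = sets borel" "finite_measure h" "AE x in h. x \<in> G"
    and int: "\<And>\<phi>. continuous_on UNIV \<phi> \<Longrightarrow> has_bochner_integral h \<phi> (mean \<phi>)"
    using Riesz_Markov_compact[OF G(1) linear_mean mean_lower] by metis
  interpret h: finite_measure h by fact
  have "has_bochner_integral h (\<lambda>x. 1) (1 :: real)" using int[of "\<lambda>x. 1"] by (simp add: mean_const)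
  then have one: "measure h UNIV = 1"
    using sets_eq_imp_space_eq[OF h(1)] by (auto simp: has_bochner_integral_iff)
  have inv: "distr h borel t = h"
    if t: "continuous_on UNIV t" "\<And>\<phi>. continuous_on G \<phi> \<Longrightarrow> mean (\<lambda>x. \<phi> (t x)) = mean \<phi>" for t
  proof (rule borel_measure_eqI_continuous)
    have tm: "t \<in> measurable h borel"
      unfolding measurable_cong_sets[OF h(1) refl] by (rule borel_measurable_continuous_onI[OF t(1)])
    show "finite_measure (distr h borel t)" by (rule h.finite_measure_distr[OF tm])
    fix \<phi> :: "real^'n^'n \<Rightarrow> real" assume \<phi>: "continuous_on UNIV \<phi>"
    have "continuous_on UNIV (\<lambda>x. \<phi> (t x))" using \<phi> t(1) by (rule continuous_on_compose2) auto
    from int[OF this] have "(\<integral>x. \<phi> (t x) \<partial>h) = mean (\<lambda>x. \<phi> (t x))"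
      by (rule has_bochner_integral_integral_eq)
    also have "\<dots> = mean \<phi>" by (rule t(2)) (rule continuous_on_subset[OF \<phi>], simp)
    also have "\<dots> = (\<integral>x. \<phi> x \<partial>h)" using int[OF \<phi>] by (rule has_bochner_integral_integral_eq[symmetric])
    finally show "(\<integral>x. \<phi> x \<partial>distr h borel t) = (\<integral>x. \<phi> x \<partial>h)"
      using \<phi> by (subst integral_distr[OF tm]) (auto intro: borel_measurable_continuous_onI)
  qed (use h in auto)
  show thesis
  proof (rule that[OF h(2) one h(1,3)])
    fix k assume k: "k \<in> G"
    show "distr h borel (\<lambda>a. k ** a) = h"
    proof (rule inv)
      show "mean (\<lambda>x. \<phi> (k ** x)) = mean \<phi>" if "continuous_on G \<phi>" for \<phi>
        by (rule mean_averager_L[OF that averager.trans]) (use k in blast)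
    qed (intro continuous_on_matrix_mult continuous_intros)
    show "distr h borel (\<lambda>a. a ** k) = h"
    proof (rule inv)
      show "mean (\<lambda>x. \<phi> (x ** k)) = mean \<phi>" if "continuous_on G \<phi>" for \<phi>
        by (rule mean_averager_R[OF that averager.trans]) (use k in blast)
    qed (intro continuous_on_matrix_mult continuous_intros)
  qed
qed

section \<open>The Reynolds operator\<close>

text \<open>The coordinate ring carries no norm here, so integrals with values in it are
  characterised and compared through scalar functionals.\<close>

lemma linear_functionals_separate:
  fixes a b :: "'a::real_vector"
  assumes "\<And>\<xi> :: 'a \<Rightarrow> real. linear \<xi> \<Longrightarrow> \<xi> a = \<xi> b"
  shows "a = b"
proof (rule ccontr)
  assume "a \<noteq> b"
  then have "independent {a - b}" by simp
  then obtain \<xi> :: "'a \<Rightarrow> real" where "linear \<xi>" "\<xi> (a - b) = 1"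
    using linear_independent_extend[of "{a - b}" "\<lambda>_. 1 :: real"] by auto
  then show False using assms[of \<xi>] by (simp add: linear_diff)
qed

lemma regular_function_on_continuous:
  assumes "regular_function_on G p" "\<And>g. g \<in> G \<Longrightarrow> invertible g"
  shows "continuous_on G p"
proof -
  obtain q k where q: "real_polynomial_function q" "\<And>g. g \<in> G \<Longrightarrow> p g = q g / det g ^ k"
    using assms(1) unfolding regular_function_on_def by blast
  have "continuous_on G (\<lambda>g. q g / det g ^ k)"
  proof (intro continuous_intros)
    show "continuous_on G q" by (rule continuous_on_polymonial_function) (use q(1) real_polynomial_function_eq in auto)
    show "continuous_on G det"
      unfolding det_def by (intro continuous_intros continuous_on_component)
    show "\<forall>g\<in>G. det g ^ k \<noteq> 0" using assms(2) by (simp add: invertible_det_nz)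
  qed
  then show ?thesis by (rule continuous_on_eq) (simp add: q(2))
qed

locale compact_group_action =
  fixes G :: "(real^'n^'n) set" and act :: "real^'n^'n \<Rightarrow> 'a \<Rightarrow> 'a::real_comm_algebra"
    and h :: "(real^'n^'n) measure"
  assumes group: "linear_algebraic_group G" and compact: "compact G"
    and variety: "affine_G_variety G act"
    and h: "finite_measure h" "measure h UNIV = 1" "sets h = sets borel" "AE a in h. a \<in> G"
      "\<And>k. k \<in> G \<Longrightarrow> distr h borel (\<lambda>a. k ** a) = h" "\<And>k. k \<in> G \<Longrightarrow> distr h borel (\<lambda>a. a ** k) = h"
begin

sublocale h: finite_measure h by (rule h(1))

lemma one_in: "mat 1 \<in> G" and mult_in: "a \<in> G \<Longrightarrow> b \<in> G \<Longrightarrow> a ** b \<in> G"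
  and invertible: "a \<in> G \<Longrightarrow> invertible a"
  using group unfolding linear_algebraic_group_def by blast+

lemma act_linear: "k \<in> G \<Longrightarrow> linear (act k)"
  and act_comp: "a \<in> G \<Longrightarrow> b \<in> G \<Longrightarrow> act (a ** b) f = act b (act a f)"
  and act_unit: "k \<in> G \<Longrightarrow> act k 1 = 1" and act_mult: "k \<in> G \<Longrightarrow> act k (f * f') = act k f * act k f'"
  using variety unfolding affine_G_variety_def by blast+

text \<open>The retraction \<open>\<gamma>\<close> makes statements about \<open>G\<close> hold for all matrices.\<close>

definition \<gamma> :: "real^'n^'n \<Rightarrow> real^'n^'n" where "\<gamma> a = (if a \<in> G then a else mat 1)"

lemma \<gamma>_in: "\<gamma> a \<in> G" by (simp add: \<gamma>_def one_in)

lemma \<gamma>_eq: "a \<in> G \<Longrightarrow> \<gamma> a = a" by (simp add: \<gamma>_def)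

lemma G_borel: "G \<in> sets borel"
  using compact_imp_closed[OF compact] by simp

text \<open>The orbit of \<open>f\<close> stays in a finite-dimensional space, with bounded Borel
  coefficients; this reduces integration of the orbit map to finitely many scalar integrals.\<close>

lemma coefficients:
  obtains m q a where "\<And>i. i < (m::nat) \<Longrightarrow> q i \<in> borel_measurable borel"
    "\<And>i. i < m \<Longrightarrow> \<exists>b. \<forall>g. \<bar>q i g\<bar> \<le> (b::real)" "\<And>g. act (\<gamma> g) f = (\<Sum>i<m. q i g *\<^sub>R a i)"
proof -
  obtain m p a where p: "\<And>i. i < (m::nat) \<Longrightarrow> regular_function_on G (p i)"
    "\<And>g. g \<in> G \<Longrightarrow> act g f = (\<Sum>i<m. p i g *\<^sub>R a i)"
    using variety unfolding affine_G_variety_def by metis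
  have pc: "continuous_on G (p i)" if "i < m" for i
    by (rule regular_function_on_continuous[OF p(1)[OF that] invertible])
  show thesis
  proof (rule that[of m "\<lambda>i g. p i (\<gamma> g)" a])
    show "(\<lambda>g. p i (\<gamma> g)) \<in> borel_measurable borel" if "i < m" for i
    proof -
      have "(\<lambda>g. indicator G g *\<^sub>R p i g) \<in> borel_measurable borel"
        by (rule borel_measurable_continuous_on_indicator) (use pc[OF that] G_borel in auto)
      then have "(\<lambda>g. if g \<in> G then indicator G g *\<^sub>R p i g else p i (mat 1)) \<in> borel_measurable borel"
        using G_borel by (intro measurable_If_set) auto
      also have "(\<lambda>g. if g \<in> G then indicator G g *\<^sub>R p i g else p i (mat 1)) = (\<lambda>g. p i (\<gamma> g))"
        by (auto simp: \<gamma>_def)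
      finally show ?thesis .
    qed
    show "\<exists>b. \<forall>g. \<bar>p i (\<gamma> g)\<bar> \<le> b" if "i < m" for i
      using compact_imp_bounded[OF compact_continuous_image[OF pc[OF that] compact]] \<gamma>_in
      by (auto simp: bounded_iff)
    show "act (\<gamma> g) f = (\<Sum>i<m. p i (\<gamma> g) *\<^sub>R a i)" for g by (rule p(2)[OF \<gamma>_in])
  qed
qed

lemma bounded_integrable:
  fixes \<phi> :: "real^'n^'n \<Rightarrow> real"
  assumes "\<phi> \<in> borel_measurable borel" "\<And>g. \<bar>\<phi> g\<bar> \<le> b"
  shows "integrable h \<phi>"
  by (rule h.integrable_const_bound[of _ b]) (use assms in \<open>simp_all add: measurable_cong_sets[OF h(3) refl]\<close>)

lemma orbit_functional:
  fixes \<xi> :: "'a \<Rightarrow> real"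
  assumes \<xi>: "linear \<xi>"
  shows "(\<lambda>g. \<xi> (act (\<gamma> g) f)) \<in> borel_measurable borel" and "integrable h (\<lambda>g. \<xi> (act (\<gamma> g) f))"
proof -
  obtain m q a where q: "\<And>i. i < (m::nat) \<Longrightarrow> q i \<in> borel_measurable borel"
    "\<And>i. i < m \<Longrightarrow> \<exists>b. \<forall>g. \<bar>q i g\<bar> \<le> (b::real)" "\<And>g. act (\<gamma> g) f = (\<Sum>i<m. q i g *\<^sub>R a i)"
    by (rule coefficients[of f]) blast
  have eq: "\<xi> (act (\<gamma> g) f) = (\<Sum>i<m. q i g * \<xi> (a i))" for g
    unfolding q(3) by (simp add: linear_sum[OF \<xi>] linear_scale[OF \<xi>])
  show "(\<lambda>g. \<xi> (act (\<gamma> g) f)) \<in> borel_measurable borel"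
    unfolding eq by (intro borel_measurable_sum borel_measurable_times borel_measurable_const) (use q(1) in auto)
  have "integrable h (q i)" if "i < m" for i
    using q(1,2)[OF that] by (auto intro: bounded_integrable)
  then show "integrable h (\<lambda>g. \<xi> (act (\<gamma> g) f))"
    unfolding eq by (intro Bochner_Integration.integrable_sum integrable_mult_left) auto
qed

text \<open>The weak integral of the orbit map over Haar measure. It exists by
  \<open>coefficients\<close> and is unique by \<open>linear_functionals_separate\<close>.\<close>

definition reynolds :: "'a \<Rightarrow> 'a" where
  "reynolds f = (SOME r. \<forall>\<xi> :: 'a \<Rightarrow> real. linear \<xi> \<longrightarrow> \<xi> r = (\<integral>g. \<xi> (act (\<gamma> g) f) \<partial>h))"

lemma reynolds:
  fixes \<xi> :: "'a \<Rightarrow> real"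
  assumes "linear \<xi>"
  shows "\<xi> (reynolds f) = (\<integral>g. \<xi> (act (\<gamma> g) f) \<partial>h)"
proof -
  obtain m q a where q: "\<And>i. i < (m::nat) \<Longrightarrow> q i \<in> borel_measurable borel"
    "\<And>i. i < m \<Longrightarrow> \<exists>b. \<forall>g. \<bar>q i g\<bar> \<le> (b::real)" "\<And>g. act (\<gamma> g) f = (\<Sum>i<m. q i g *\<^sub>R a i)"
    by (rule coefficients[of f]) blast
  have int: "integrable h (q i)" if "i < m" for i
    using q(1,2)[OF that] by (auto intro: bounded_integrable)
  have "\<forall>\<xi> :: 'a \<Rightarrow> real. linear \<xi> \<longrightarrow>
      \<xi> (\<Sum>i<m. (\<integral>g. q i g \<partial>h) *\<^sub>R a i) = (\<integral>g. \<xi> (act (\<gamma> g) f) \<partial>h)"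
  proof (intro allI impI)
    fix \<xi> :: "'a \<Rightarrow> real" assume \<xi>: "linear \<xi>"
    have "(\<integral>g. \<xi> (act (\<gamma> g) f) \<partial>h) = (\<integral>g. (\<Sum>i<m. q i g * \<xi> (a i)) \<partial>h)"
      unfolding q(3) by (simp add: linear_sum[OF \<xi>] linear_scale[OF \<xi>])
    also have "\<dots> = (\<Sum>i<m. (\<integral>g. q i g \<partial>h) * \<xi> (a i))"
      using int by (subst Bochner_Integration.integral_sum) auto
    finally show "\<xi> (\<Sum>i<m. (\<integral>g. q i g \<partial>h) *\<^sub>R a i) = (\<integral>g. \<xi> (act (\<gamma> g) f) \<partial>h)"
      by (simp add: linear_sum[OF \<xi>] linear_scale[OF \<xi>])
  qed
  then have "\<forall>\<xi> :: 'a \<Rightarrow> real. linear \<xi> \<longrightarrow> \<xi> (reynolds f) = (\<integral>g. \<xi> (act (\<gamma> g) f) \<partial>h)"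
    unfolding reynolds_def by (rule someI)
  then show ?thesis using assms by blast
qed

lemma integral_translate:
  fixes \<phi> :: "real^'n^'n \<Rightarrow> real"
  assumes \<phi>: "\<phi> \<in> borel_measurable borel" and k: "k \<in> G"
  shows "(\<integral>g. \<phi> (k ** g) \<partial>h) = (\<integral>g. \<phi> g \<partial>h)" and "(\<integral>g. \<phi> (g ** k) \<partial>h) = (\<integral>g. \<phi> g \<partial>h)"
proof -
  have 1: "(\<lambda>g. k ** g) \<in> measurable h borel" and 2: "(\<lambda>g. g ** k) \<in> measurable h borel"
    unfolding measurable_cong_sets[OF h(3) refl]
    by (intro borel_measurable_continuous_onI continuous_on_matrix_mult continuous_intros)+
  show "(\<integral>g. \<phi> (k ** g) \<partial>h) = (\<integral>g. \<phi> g \<partial>h)"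
    using integral_distr[OF 1 \<phi>] by (simp add: h(5)[OF k])
  show "(\<integral>g. \<phi> (g ** k) \<partial>h) = (\<integral>g. \<phi> g \<partial>h)"
    using integral_distr[OF 2 \<phi>] by (simp add: h(6)[OF k])
qed

lemma total_mass: "measure h (space h) = 1"
  using h(2) sets_eq_imp_space_eq[OF h(3)] by simp

text \<open>Composing a functional with \<open>act k\<close> gives a functional again, so
  \<open>act k\<close> passes under the integral. As \<open>act\<close> is a right action,
  \<open>act k\<close> after \<open>act g\<close> is \<open>act (g ** k)\<close>, and right
  invariance of \<open>h\<close> applies.\<close>

lemma reynolds_in: "reynolds f \<in> invariant_ring G act"
  unfolding invariant_ring_def
proof (intro CollectI ballI)
  fix k assume k: "k \<in> G"
  show "act k (reynolds f) = reynolds f"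
  proof (rule linear_functionals_separate)
    fix \<xi> :: "'a \<Rightarrow> real" assume \<xi>: "linear \<xi>"
    have "linear (\<lambda>f. \<xi> (act k f))"
      using linear_compose[OF act_linear[OF k] \<xi>] by (simp add: o_def)
    then have "\<xi> (act k (reynolds f)) = (\<integral>g. \<xi> (act k (act (\<gamma> g) f)) \<partial>h)" by (rule reynolds)
    also have "\<dots> = (\<integral>g. \<xi> (act (\<gamma> (g ** k)) f) \<partial>h)"
    proof (rule integral_cong_AE)
      \<comment> \<open>Off \<open>G\<close> both \<open>\<gamma> g\<close> and
        \<open>\<gamma> (g ** k)\<close> are the unit matrix, so the identity can fail
        there.\<close>
      show "AE g in h. \<xi> (act k (act (\<gamma> g) f)) = \<xi> (act (\<gamma> (g ** k)) f)"
        using h(4) by eventually_elim (simp add: \<gamma>_eq act_comp k mult_in)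
      show "(\<lambda>g. \<xi> (act k (act (\<gamma> g) f))) \<in> borel_measurable h"
        by (rule borel_measurable_integrable[OF orbit_functional(2)]) fact
      have "(\<lambda>g. g ** k) \<in> measurable h borel"
        unfolding measurable_cong_sets[OF h(3) refl]
        by (intro borel_measurable_continuous_onI continuous_on_matrix_mult continuous_intros)
      then show "(\<lambda>g. \<xi> (act (\<gamma> (g ** k)) f)) \<in> borel_measurable h"
        using orbit_functional(1)[OF \<xi>] by (rule measurable_compose)
    qed
    also have "\<dots> = \<xi> (reynolds f)"
      unfolding reynolds[OF \<xi>] by (rule integral_translate(2)[OF orbit_functional(1)[OF \<xi>] k])
    finally show "\<xi> (act k (reynolds f)) = \<xi> (reynolds f)" .
  qed
qed

text \<open>Here \<open>k\<close> acts first and appears on the left of \<open>g\<close>, so left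
  invariance of \<open>h\<close> is used.\<close>

lemma reynolds_act: "k \<in> G \<Longrightarrow> reynolds (act k f) = reynolds f"
proof (rule linear_functionals_separate)
  fix \<xi> :: "'a \<Rightarrow> real" assume \<xi>: "linear \<xi>" and k: "k \<in> G"
  have "\<xi> (reynolds (act k f)) = (\<integral>g. \<xi> (act (\<gamma> g) (act k f)) \<partial>h)" by (rule reynolds[OF \<xi>])
  also have "\<dots> = (\<integral>g. \<xi> (act (\<gamma> (k ** g)) f) \<partial>h)"
  proof (rule integral_cong_AE)
    show "AE g in h. \<xi> (act (\<gamma> g) (act k f)) = \<xi> (act (\<gamma> (k ** g)) f)"
      using h(4) by eventually_elim (simp add: \<gamma>_eq act_comp k mult_in)
    show "(\<lambda>g. \<xi> (act (\<gamma> g) (act k f))) \<in> borel_measurable h"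
      by (rule borel_measurable_integrable[OF orbit_functional(2)[OF \<xi>]])
    have "(\<lambda>g. k ** g) \<in> measurable h borel"
      unfolding measurable_cong_sets[OF h(3) refl]
      by (intro borel_measurable_continuous_onI continuous_on_matrix_mult continuous_intros)
    then show "(\<lambda>g. \<xi> (act (\<gamma> (k ** g)) f)) \<in> borel_measurable h"
      using orbit_functional(1)[OF \<xi>] by (rule measurable_compose)
  qed
  also have "\<dots> = \<xi> (reynolds f)"
    unfolding reynolds[OF \<xi>] by (rule integral_translate(1)[OF orbit_functional(1)[OF \<xi>] k])
  finally show "\<xi> (reynolds (act k f)) = \<xi> (reynolds f)" .
qed

lemma invariant_functional_reynolds:
  assumes "linear L" "G_invariant_functional G act L"
  shows "L (reynolds f) = L f"
  using assms \<gamma>_in by (simp add: reynolds G_invariant_functional_def total_mass)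

lemma reynolds_id: "f \<in> invariant_ring G act \<Longrightarrow> reynolds f = f"
  by (rule linear_functionals_separate) (simp add: reynolds invariant_ring_def \<gamma>_in total_mass)

lemma reynolds_linear: "linear reynolds"
proof (rule linearI)
  note lin = act_linear[OF \<gamma>_in]
  show "reynolds (a + b) = reynolds a + reynolds b" for a b
  proof (rule linear_functionals_separate)
    fix \<xi> :: "'a \<Rightarrow> real" assume \<xi>: "linear \<xi>"
    show "\<xi> (reynolds (a + b)) = \<xi> (reynolds a + reynolds b)"
      using orbit_functional(2)[OF \<xi>]
      by (simp add: linear_add[OF \<xi>] linear_add[OF lin] reynolds[OF \<xi>])
  qed
  show "reynolds (c *\<^sub>R a) = c *\<^sub>R reynolds a" for c a
  proof (rule linear_functionals_separate)
    fix \<xi> :: "'a \<Rightarrow> real" assume \<xi>: "linear \<xi>"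
    show "\<xi> (reynolds (c *\<^sub>R a)) = \<xi> (c *\<^sub>R reynolds a)"
      by (simp add: linear_scale[OF \<xi>] linear_scale[OF lin] reynolds[OF \<xi>])
  qed
qed

end

section \<open>Moment functionals on basic closed sets\<close>

text \<open>The products of generators are countable in number and span the ring. This is how finite
  generation provides the sequence of coordinates for \<open>Haviland\<close>.\<close>

lemma affine_coordinate_ring_countable_span:
  assumes "affine_coordinate_ring (UNIV :: 'a::real_comm_algebra set)"
  obtains e :: "nat \<Rightarrow> 'a::real_comm_algebra" where "span (range e) = UNIV"
proof -
  obtain S :: "'a set" where S: "finite S" "subalgebra hull S = UNIV"
    using assms unfolding affine_coordinate_ring_def by (elim conjE exE) metis
  define M where "M = prod_list ` lists S"
  have "subalgebra (span M)"
    unfolding subalgebra_def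
  proof (intro conjI ballI)
    show "1 \<in> span M" by (rule span_base) (auto simp: M_def intro: image_eqI[of _ _ "[]"])
    show "a * b \<in> span M" if "a \<in> span M" "b \<in> span M" for a b
    proof (rule span_mult_closed[OF _ that])
      fix f g assume "f \<in> M" "g \<in> M"
      then obtain xs ys where "f = prod_list xs" "g = prod_list ys" "xs \<in> lists S" "ys \<in> lists S"
        by (auto simp: M_def)
      then show "f * g \<in> M" unfolding M_def by (intro image_eqI[of _ _ "xs @ ys"]) auto
    qed
  qed (rule subspace_span)
  moreover have "S \<subseteq> span M"
  proof
    fix s assume "s \<in> S"
    then show "s \<in> span M" by (intro span_base) (auto simp: M_def intro!: image_eqI[of _ _ "[s]"])
  qed
  ultimately have "subalgebra hull S \<subseteq> span M" by (rule hull_minimal[rotated])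
  moreover have "countable M" "M \<noteq> {}"
    unfolding M_def using S(1) by (auto intro: countable_lists countable_finite)
  then have "range (from_nat_into M) = M" by (intro range_from_nat_into)
  ultimately show thesis using S(2) that[of "from_nat_into M"] by auto
qed

lemma span_range_expansion:
  fixes e :: "nat \<Rightarrow> 'a::real_vector"
  assumes "f \<in> span (range e)"
  shows "\<exists>n c. f = (\<Sum>i<n. c i *\<^sub>R e i)"
  using assms
proof (induction rule: span_induct_alt)
  case base
  show ?case by (intro exI[of _ 0]) simp
next
  case (step r x y)
  then obtain k n c where x: "x = e k" and y: "y = (\<Sum>i<n. c i *\<^sub>R e i)" by blast
  let ?N = "max n (Suc k)"
  have "y = (\<Sum>i<?N. (if i < n then c i else 0) *\<^sub>R e i)"
    unfolding y by (rule sum.mono_neutral_cong_left) auto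
  moreover have "r *\<^sub>R x = (\<Sum>i<?N. (if i = k then r else 0) *\<^sub>R e i)"
    unfolding x by (subst sum.mono_neutral_cong_right[of _ "{k}"]) auto
  ultimately have "r *\<^sub>R x + y = (\<Sum>i<?N. ((if i = k then r else 0) + (if i < n then c i else 0)) *\<^sub>R e i)"
    by (simp add: scaleR_add_left sum.distrib)
  then show ?case by (intro exI)
qed

section \<open>Borel sets of real points and coordinates for them\<close>

abbreviation points_borel :: "'a::real_comm_algebra set \<Rightarrow> ('a \<Rightarrow> real) set \<Rightarrow> ('a \<Rightarrow> real) measure" where
  "points_borel B X \<equiv> sigma X {U. openin (subtopology (points_topology B) X) U}"

lemma points_topology_subset: "{U. openin (subtopology (points_topology B) X) U} \<subseteq> Pow X"
  by (auto simp: openin_subtopology)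

lemma space_points_borel: "space (points_borel B X) = X"
  using points_topology_subset by (rule space_measure_of)

lemma sets_points_borel:
  "sets (points_borel B X) = sigma_sets X {U. openin (subtopology (points_topology B) X) U}"
  using points_topology_subset by (rule sets_measure_of)

lemma topspace_points_topology: "topspace (points_topology B) = real_points B"
  by (auto simp: points_topology_def real_points_def PiE_def)

lemma evaluation_measurable:
  assumes X: "X \<subseteq> real_points B" and f: "f \<in> B"
  shows "(\<lambda>x. x f) \<in> borel_measurable (points_borel B X)"
proof (rule borel_measurableI)
  fix S :: "real set" assume S: "open S"
  have cm: "continuous_map (points_topology B) euclideanreal (\<lambda>x. x f)"
    unfolding points_topology_def
    by (intro continuous_map_from_subtopology continuous_map_product_projection f)
  have "(\<lambda>x. x f) -` S \<inter> X = {x \<in> topspace (subtopology (points_topology B) X). x f \<in> S}"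
    using X by (auto simp: topspace_points_topology)
  then have "openin (subtopology (points_topology B) X) ((\<lambda>x. x f) -` S \<inter> X)"
    using openin_continuous_map_preimage[OF continuous_map_from_subtopology[OF cm, of X], of S] S
    by (simp only: open_openin)
  then show "(\<lambda>x. x f) -` S \<inter> space (points_borel B X) \<in> sets (points_borel B X)"
    unfolding space_points_borel sets_points_borel by blast
qed

lemma real_points_linear: "x \<in> real_points UNIV \<Longrightarrow> linear x"
  by (rule linearI) (auto simp: real_points_def)

text \<open>The \<open>e i\<close> may be linearly dependent, so \<open>c\<close> merely picks one
  expansion of each \<open>f\<close>. Hence \<open>decode y\<close> need not even be additive unless
  \<open>y\<close> is the coordinate sequence of a point.\<close>

locale coordinate_expansion =
  fixes e :: "nat \<Rightarrow> 'a::real_comm_algebra" and n :: "'a \<Rightarrow> nat" and c :: "'a \<Rightarrow> nat \<Rightarrow> real"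
  assumes expansion: "\<And>f. f = (\<Sum>i<n f. c f i *\<^sub>R e i)"
begin

definition decode :: "(nat \<Rightarrow> real) \<Rightarrow> 'a \<Rightarrow> real" where
  "decode y f = (\<Sum>i<n f. c f i * y i)"

lemma decode: "linear x \<Longrightarrow> decode (\<lambda>i. x (e i)) = x"
proof
  fix f assume x: "linear x"
  have "x f = x (\<Sum>i<n f. c f i *\<^sub>R e i)" using expansion[of f] by simp
  then show "decode (\<lambda>i. x (e i)) f = x f"
    by (simp add: decode_def linear_sum[OF x] linear_scale[OF x])
qed

lemma continuous_decode: "continuous_on S (\<lambda>y. decode y f)"
  unfolding decode_def
  by (intro continuous_intros continuous_on_subset[OF continuous_on_product_coordinates]) auto

text \<open>The topology on points is generated by the evaluations at all ring elements, possibly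
  uncountably many. Pulling open sets back along the continuous \<open>decode\<close> reduces them
  to open sets of real sequences, where countably many coordinates determine measurability.\<close>

lemma measurable_points_borel:
  fixes K :: "('a \<Rightarrow> real) set"
  assumes K: "K \<subseteq> real_points UNIV" and F: "F \<in> space M \<rightarrow> K"
    and meas: "\<And>f. (\<lambda>\<omega>. F \<omega> f) \<in> borel_measurable M"
  shows "F \<in> measurable M (points_borel UNIV K)"
proof (rule measurable_measure_of[OF points_topology_subset F])
  fix U assume "U \<in> {U. openin (subtopology (points_topology UNIV) K) U}"
  then obtain V where V: "openin (product_topology (\<lambda>_. euclideanreal) (UNIV :: 'a set)) V"
      "U = V \<inter> real_points UNIV \<inter> K"
    by (auto simp: openin_subtopology points_topology_def)
  have "open V" using V(1) by (simp add: euclidean_product_topology)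
  moreover have "continuous_on UNIV decode"
    by (rule continuous_on_coordinatewise_then_product) (rule continuous_decode)
  ultimately have "open (decode -` V)" by (rule open_vimage)
  moreover have "(\<lambda>\<omega> i. F \<omega> (e i)) \<in> measurable M borel"
    by (rule measurable_coordinatewise_then_product) (rule meas)
  ultimately have "(\<lambda>\<omega> i. F \<omega> (e i)) -` (decode -` V) \<inter> space M \<in> sets M"
    by (intro measurable_sets) auto
  also have "(\<lambda>\<omega> i. F \<omega> (e i)) -` (decode -` V) \<inter> space M = F -` U \<inter> space M"
  proof -
    have "F \<omega> \<in> K" "decode (\<lambda>i. F \<omega> (e i)) = F \<omega>" if "\<omega> \<in> space M" for \<omega>
      using that F K decode[OF real_points_linear] by blast+
    then show ?thesis using K V(2) by auto
  qed
  finally show "F -` U \<inter> space M \<in> sets M" .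
qed

text \<open>The image is described by closed conditions on \<open>y\<close>: that
  \<open>decode y\<close> is a real point, that it satisfies the inequalities defining
  \<open>K\<close>, and that \<open>y\<close> consists of its coordinates.\<close>

lemma closed_coordinates:
  fixes K :: "('a \<Rightarrow> real) set"
  assumes "basic_closed UNIV K"
  shows "closed ((\<lambda>x i. x (e i)) ` K)"
proof -
  obtain S where S: "K = {x \<in> real_points UNIV. \<forall>f\<in>S. 0 \<le> x f}"
    using assms unfolding basic_closed_def by blast
  let ?Y = "(\<Inter>i. {y. decode y (e i) = y i}) \<inter> {y. decode y 1 = 1} \<inter>
    (\<Inter>a. \<Inter>b. {y. decode y (a + b) = decode y a + decode y b}) \<inter>
    (\<Inter>a. \<Inter>b. {y. decode y (a * b) = decode y a * decode y b}) \<inter>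
    (\<Inter>r. \<Inter>a. {y. decode y (r *\<^sub>R a) = r * decode y a}) \<inter> (\<Inter>f\<in>S. {y. 0 \<le> decode y f})"
  have "(\<lambda>x i. x (e i)) ` K = ?Y"
  proof (intro set_eqI iffI)
    fix y assume "y \<in> (\<lambda>x i. x (e i)) ` K"
    then obtain x where x: "x \<in> K" "y = (\<lambda>i. x (e i))" by blast
    then have "decode y = x" using decode[OF real_points_linear] S by auto
    then show "y \<in> ?Y" using x S by (auto simp: real_points_def)
  next
    fix y assume y: "y \<in> ?Y"
    then have "decode y \<in> K" unfolding S real_points_def by (auto simp: extensional_def)
    moreover have "y = (\<lambda>i. decode y (e i))" using y by auto
    ultimately show "y \<in> (\<lambda>x i. x (e i)) ` K" by blast
  qed
  also have "closed \<dots>"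
    by (intro closed_Int closed_INT ballI closed_Collect_eq closed_Collect_le continuous_decode
        continuous_intros continuous_on_product_coordinates)
  finally show ?thesis .
qed

theorem Haviland_basic_closed:
  fixes K :: "('a \<Rightarrow> real) set"
  assumes K: "basic_closed UNIV K" and L: "linear L"
    and pos: "\<And>f. (\<And>x. x \<in> K \<Longrightarrow> 0 \<le> x f) \<Longrightarrow> 0 \<le> L f"
  obtains M where "sets M = sets (points_borel UNIV K)" "finite_measure M"
    "\<And>f. has_bochner_integral M (\<lambda>x. x f) (L f)"
proof -
  have KR: "K \<subseteq> real_points UNIV" using K unfolding basic_closed_def by blast
  let ?Y = "(\<lambda>x i. x (e i)) ` K"
  have lin: "linear x" if "x \<in> K" for x using that KR real_points_linear by blast
  have K1: "x 1 = 1" "x (a * b) = x a * x b" if "x \<in> K" for x a b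
    using that KR by (auto simp: real_points_def)
  \<comment> \<open>A relation on purpose: ring elements that agree on \<open>K\<close> contribute
    values over the same \<open>m\<close>. That these coincide follows from \<open>pos\<close>,
    applied to the difference and its negative.\<close>
  define g where "g = {(m, t). \<exists>a. (\<forall>x\<in>K. m x = x a) \<and> t = L a}"
  have gI: "(m, L a) \<in> g" if "\<And>x. x \<in> K \<Longrightarrow> m x = x a" for m a
    unfolding g_def using that by blast
  obtain M where M: "sets M = sets borel" "finite_measure M" "AE y in M. y \<in> ?Y"
    "\<And>i. has_bochner_integral M (\<lambda>y. y i) (L (e i))"
  proof (rule Haviland[of g K "L 1" "\<lambda>i x. x (e i)" "\<lambda>i. L (e i)" "\<lambda>i. L (e i * e i)"])
    show "subspace g"
      unfolding subspace_def
    proof (intro conjI ballI allI)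
      show "0 \<in> g"
        using gI[of "0" 0] linear_0[OF lin] linear_0[OF L] by (simp add: zero_prod_def)
    next
      fix p q assume "p \<in> g" "q \<in> g"
      then obtain m a m' a' where *: "p = (m, L a)" "q = (m', L a')"
        "\<forall>x\<in>K. m x = x a" "\<forall>x\<in>K. m' x = x a'"
        unfolding g_def by blast
      show "p + q \<in> g"
        using gI[of "m + m'" "a + a'"] * by (simp add: linear_add[OF lin] linear_add[OF L])
    next
      fix r p assume "p \<in> g"
      then obtain m a where *: "p = (m, L a)" "\<forall>x\<in>K. m x = x a"
        unfolding g_def by blast
      show "r *\<^sub>R p \<in> g"
        using gI[of "r *\<^sub>R m" "r *\<^sub>R a"] *
        by (simp add: linear_scale[OF lin] linear_scale[OF L] scaleR_fun_def)
    qed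
    show "0 \<le> t" if "(m, t) \<in> g" "\<And>x. x \<in> K \<Longrightarrow> 0 \<le> m x" for m t
      using that pos by (auto simp: g_def)
    show "closed ?Y" by (rule closed_coordinates[OF K])
  qed (auto intro!: gI simp: K1 power2_eq_square)
  have Y: "?Y \<in> sets M" using closed_coordinates[OF K] M(1) by simp
  \<comment> \<open>\<open>decode\<close> maps into \<open>K\<close> only from \<open>?Y\<close>, so
    the measure is restricted before it is pushed forward.\<close>
  let ?M = "restrict_space M ?Y"
  have space: "space ?M = ?Y"
    using sets_eq_imp_space_eq[OF M(1)] by (simp add: space_restrict_space)
  have dec: "decode y \<in> K" "y i = decode y (e i)" if "y \<in> ?Y" for y i
    using that decode[OF lin] by auto
  have meas: "(\<lambda>y. decode y f) \<in> borel_measurable ?M" for f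
    by (rule measurable_restrict_space1)
       (simp add: measurable_cong_sets[OF M(1) refl] borel_measurable_continuous_onI continuous_decode)
  then have D: "decode \<in> measurable ?M (points_borel UNIV K)"
    by (intro measurable_points_borel KR) (use dec space in auto)
  interpret M: finite_measure M by fact
  have int: "has_bochner_integral M (\<lambda>y. decode y f) (L f)" for f
  proof -
    have "L f = L (\<Sum>i<n f. c f i *\<^sub>R e i)" using expansion[of f] by simp
    then have "L f = (\<Sum>i<n f. c f i * L (e i))"
      by (simp add: linear_sum[OF L] linear_scale[OF L])
    then show ?thesis
      unfolding decode_def by (simp add: has_bochner_integral_sum has_bochner_integral_mult_right M(4))
  qed
  have int_Y: "has_bochner_integral ?M (\<lambda>y. decode y f) (L f)" for f
  proof -
    have "has_bochner_integral M (\<lambda>y. indicator ?Y y *\<^sub>R decode y f) (L f)"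
    proof (subst has_bochner_integral_cong_AE)
      show "(\<lambda>y. indicator ?Y y *\<^sub>R decode y f) \<in> borel_measurable M"
        using Y int[of f] by (auto dest!: borel_measurable_has_bochner_integral)
      show "AE y in M. indicator ?Y y *\<^sub>R decode y f = decode y f"
        using M(3) by eventually_elim simp
    qed (use int in \<open>auto dest: borel_measurable_has_bochner_integral\<close>)
    then show ?thesis using Y by (simp add: has_bochner_integral_restrict_space sets.Int_space_eq2)
  qed
  show thesis
  proof (rule that[of "distr ?M (points_borel UNIV K) decode"])
    interpret M': finite_measure ?M by (rule finite_measure_restrict_space[OF M(2) Y])
    show "finite_measure (distr ?M (points_borel UNIV K) decode)"
      by (rule M'.finite_measure_distr[OF D])
    show "has_bochner_integral (distr ?M (points_borel UNIV K) decode) (\<lambda>x. x f) (L f)" for f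
      by (rule has_bochner_integral_distr[OF _ D]) (rule evaluation_measurable[OF KR UNIV_I] int_Y)+
  qed simp
qed

end

section \<open>Invariant moment functionals\<close>

context compact_group_action
begin

lemma move_comp: "a \<in> G \<Longrightarrow> b \<in> G \<Longrightarrow> move act a (move act b x) = move act (a ** b) x"
  by (simp add: move_def act_comp)

text \<open>The new measure is the image of \<open>h \<Otimes>\<^sub>M M\<close> under the map
  sending \<open>(g, x)\<close> to \<open>g x\<close>. It has the same moments because
  \<open>L\<close> is invariant, and moving by \<open>k\<close> only translates the first factor,
  which \<open>h\<close> absorbs.\<close>

lemma average_measure:
  assumes K: "K \<subseteq> real_points UNIV" and inv: "G_invariant_set G act K"
    and L: "linear L" "G_invariant_functional G act L"
    and M: "sets M = sets (points_borel UNIV K)" "finite_measure M"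
      "\<And>f. has_bochner_integral M (\<lambda>x. x f) (L f)"
  shows "\<exists>M'. moment_measure UNIV K M' \<and> G_invariant_measure G act M' \<and> (\<forall>f. L f = (\<integral>x. x f \<partial>M'))"
proof -
  obtain e :: "nat \<Rightarrow> 'a" where e: "span (range e) = UNIV"
    using variety affine_coordinate_ring_countable_span unfolding affine_G_variety_def by blast
  have "\<forall>f. \<exists>n c. f = (\<Sum>i<n. c i *\<^sub>R e i)" using span_range_expansion[of _ e] e by simp
  then obtain n c where nc: "\<And>f. f = (\<Sum>i<n f. c f i *\<^sub>R e i)" by metis
  interpret coordinate_expansion e n c by standard (rule nc)
  interpret M: finite_measure M by fact
  interpret hM: pair_sigma_finite h M ..
  let ?P = "h \<Otimes>\<^sub>M M" and ?B = "points_borel UNIV K"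
  have space_M: "space M = K" using sets_eq_imp_space_eq[OF M(1)] by (simp add: space_points_borel)
  have space_P: "space ?P = UNIV \<times> K"
    using sets_eq_imp_space_eq[OF h(3)] by (simp add: space_pair_measure space_M)
  have move_in: "move act a x \<in> K" if "a \<in> G" "x \<in> K" for a x
    using inv that unfolding G_invariant_set_def by blast
  have ev: "(\<lambda>x. x f) \<in> borel_measurable M" for f
    unfolding measurable_cong_sets[OF M(1) refl] by (rule evaluation_measurable[OF K]) simp
  have lin: "linear x" if "x \<in> K" for x using that K real_points_linear by blast
  have orbit: "integrable ?P (\<lambda>(g, x). x (act (\<gamma> g) f))" for f
  proof -
    obtain m q a where q: "\<And>i. i < (m::nat) \<Longrightarrow> q i \<in> borel_measurable borel"
      "\<And>i. i < m \<Longrightarrow> \<exists>b. \<forall>g. \<bar>q i g\<bar> \<le> (b::real)" "\<And>g. act (\<gamma> g) f = (\<Sum>i<m. q i g *\<^sub>R a i)"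
      by (rule coefficients[of f]) blast
    \<comment> \<open>Expanding the orbit map separates the variables: a bounded function of
      \<open>g\<close> times an integrable function of \<open>x\<close>.\<close>
    have "integrable ?P (\<lambda>(g, x). q i g * x (a i))" if i: "i < m" for i
    proof (rule hM.Fubini_integrable)
      have qm: "q i \<in> borel_measurable h"
        using q(1)[OF i] by (simp add: measurable_cong_sets[OF h(3) refl])
      have qi: "integrable h (q i)" using q(1,2)[OF i] by (auto intro: bounded_integrable)
      show "(\<lambda>(g, x). q i g * x (a i)) \<in> borel_measurable ?P"
        unfolding case_prod_beta
        by (intro borel_measurable_times measurable_compose[OF measurable_fst qm]
            measurable_compose[OF measurable_snd ev])
      show "integrable h (\<lambda>g. \<integral>x. norm (case (g, x) of (g, x) \<Rightarrow> q i g * x (a i)) \<partial>M)"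
        using qi by (simp add: abs_mult)
      show "AE g in h. integrable M (\<lambda>x. case (g, x) of (g, x) \<Rightarrow> q i g * x (a i))"
        using M(3)[of "a i"] by (simp add: has_bochner_integral_iff)
    qed
    then have "integrable ?P (\<lambda>p. \<Sum>i<m. (case p of (g, x) \<Rightarrow> q i g * x (a i)))"
      by (intro Bochner_Integration.integrable_sum) auto
    then show ?thesis
    proof (rule Bochner_Integration.integrable_cong[THEN iffD1, OF refl, rotated])
      fix p assume "p \<in> space ?P"
      then have "linear (snd p)" using lin by (auto simp: space_P)
      then show "(\<Sum>i<m. case p of (g, x) \<Rightarrow> q i g * x (a i)) = (case p of (g, x) \<Rightarrow> x (act (\<gamma> g) f))"
        by (simp add: case_prod_beta q(3) linear_sum linear_scale)
    qed
  qed
  define T where "T = (\<lambda>(g, x). move act (\<gamma> g) x)"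
  have T: "T \<in> measurable ?P ?B"
  proof (rule measurable_points_borel[OF K])
    show "T \<in> space ?P \<rightarrow> K" by (auto simp: T_def space_P move_in \<gamma>_in)
    show "(\<lambda>p. T p f) \<in> borel_measurable ?P" for f
      using borel_measurable_integrable[OF orbit[of f]] by (simp add: T_def move_def case_prod_beta)
  qed
  define M' where "M' = distr ?P ?B T"
  have int: "has_bochner_integral M' (\<lambda>x. x f) (L f)" for f
    unfolding M'_def
  proof (rule has_bochner_integral_distr[OF evaluation_measurable[OF K UNIV_I] T])
    have "(\<integral>p. (case p of (g, x) \<Rightarrow> x (act (\<gamma> g) f)) \<partial>?P) = (\<integral>g. \<integral>x. x (act (\<gamma> g) f) \<partial>M \<partial>h)"
      using hM.integral_fst'[OF orbit[of f]] by simp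
    also have "\<dots> = (\<integral>g. L f \<partial>h)"
    proof (rule Bochner_Integration.integral_cong[OF refl])
      fix g
      have "(\<integral>x. x (act (\<gamma> g) f) \<partial>M) = L (act (\<gamma> g) f)"
        using M(3) by (rule has_bochner_integral_integral_eq)
      then show "(\<integral>x. x (act (\<gamma> g) f) \<partial>M) = L f"
        using L(2) \<gamma>_in by (simp add: G_invariant_functional_def)
    qed
    also have "\<dots> = L f" by (simp add: total_mass)
    finally show "has_bochner_integral ?P (\<lambda>p. T p f) (L f)"
      using orbit[of f] unfolding case_prod_beta
      by (simp add: has_bochner_integral_iff T_def move_def case_prod_beta)
  qed
  have mm: "moment_measure UNIV K M'"
    unfolding moment_measure_def using int by (auto simp: M'_def has_bochner_integral_iff)
  have "distr M' M' (move act k) = M'" if k: "k \<in> G" for k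
  proof -
    have mk: "move act k \<in> measurable ?B ?B"
    proof (rule measurable_points_borel[OF K])
      show "move act k \<in> space ?B \<rightarrow> K" using move_in[OF k] by (auto simp: space_points_borel)
      show "(\<lambda>x. move act k x f) \<in> borel_measurable ?B" for f
        unfolding move_def by (rule evaluation_measurable[OF K]) simp
    qed
    have km: "(\<lambda>g. k ** g) \<in> measurable h borel"
      unfolding measurable_cong_sets[OF h(3) refl]
      by (intro borel_measurable_continuous_onI continuous_on_matrix_mult continuous_intros)
    \<comment> \<open>Presents translation of the first factor as a product of two maps, so that the
      image of the product measure is a product of images.\<close>
    have Mid: "distr M M (\<lambda>x. x) = M" by (rule distr_id)
    have kP: "(\<lambda>(g, x). (k ** g, x)) \<in> measurable ?P ?P"
      using km unfolding measurable_cong_sets[OF refl h(3)[symmetric]]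
      by (auto intro!: measurable_Pair measurable_compose[OF measurable_fst] simp: case_prod_beta)
    have "sets (borel \<Otimes>\<^sub>M M) = sets ?P" by (rule sets_pair_measure_cong) (simp_all add: h(3))
    then have "distr ?P ?P (\<lambda>(g, x). (k ** g, x)) = distr ?P (borel \<Otimes>\<^sub>M M) (\<lambda>(g, x). (k ** g, x))"
      by (intro distr_cong) auto
    also have "\<dots> = distr h borel (\<lambda>g. k ** g) \<Otimes>\<^sub>M distr M M (\<lambda>x. x)"
      by (rule pair_measure_distr[symmetric])
         (use km M.sigma_finite_measure_axioms Mid in auto)
    also have "\<dots> = ?P" by (simp add: h(5)[OF k] Mid)
    finally have trans: "distr ?P ?P (\<lambda>(g, x). (k ** g, x)) = ?P" .
    have "distr M' M' (move act k) = distr M' ?B (move act k)"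
      by (rule distr_cong) (simp_all add: M'_def)
    also have "\<dots> = distr ?P ?B (move act k \<circ> T)"
      unfolding M'_def by (rule distr_distr[OF mk T])
    also have "\<dots> = distr ?P ?B (T \<circ> (\<lambda>(g, x). (k ** g, x)))"
    proof (rule distr_cong_AE)
      show "AE p in ?P. (move act k \<circ> T) p = (T \<circ> (\<lambda>(g, x). (k ** g, x))) p"
      proof (rule AE_mp[OF hM.AE_pair_measure[where P = "\<lambda>p. fst p \<in> G"]])
        have "fst -` G \<inter> space ?P \<in> sets ?P"
          by (rule measurable_sets[OF measurable_fst]) (simp add: h(3) G_borel)
        then show "{p \<in> space ?P. fst p \<in> G} \<in> sets ?P" by (simp add: vimage_def Int_def conj_commute)
        show "AE g in h. AE x in M. fst (g, x) \<in> G" using h(4) by eventually_elim simp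
        show "AE p in ?P. fst p \<in> G \<longrightarrow> (move act k \<circ> T) p = (T \<circ> (\<lambda>(g, x). (k ** g, x))) p"
          by (rule AE_I2) (auto simp: T_def \<gamma>_eq move_comp k mult_in)
      qed
    qed (use measurable_comp[OF T mk] measurable_comp[OF kP T] in auto)
    also have "\<dots> = distr (distr ?P ?P (\<lambda>(g, x). (k ** g, x))) ?B T"
      by (rule distr_distr[symmetric, OF T kP])
    also have "\<dots> = M'" unfolding trans M'_def ..
    finally show ?thesis .
  qed
  then have "G_invariant_measure G act M'" unfolding G_invariant_measure_def by blast
  moreover have "\<forall>f. L f = (\<integral>x. x f \<partial>M')"
    using has_bochner_integral_integral_eq[OF int] by simp
  ultimately show ?thesis using mm by blast
qed

lemma invariant_moment_measure_iff:
  assumes K: "basic_closed UNIV K" and inv: "G_invariant_set G act K"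
    and L: "linear L" "G_invariant_functional G act L"
  shows "(\<exists>M. moment_measure UNIV K M \<and> G_invariant_measure G act M \<and> (\<forall>f. L f = (\<integral>x. x f \<partial>M))) \<longleftrightarrow>
    (\<forall>f\<in>nonneg_on (invariant_ring G act) (quotient_map_points G act ` K). 0 \<le> L f)"
    (is "?rep \<longleftrightarrow> ?pos")
proof
  assume ?rep
  then obtain M where M: "moment_measure UNIV K M" "\<And>f. L f = (\<integral>x. x f \<partial>M)" by blast
  have "space M = K"
    using M(1) sets_eq_imp_space_eq[of M] space_points_borel unfolding moment_measure_def by metis
  then show ?pos
    by (auto simp: M(2) nonneg_on_def quotient_map_points_def intro!: Bochner_Integration.integral_nonneg)
next
  assume pos: ?pos
  have KR: "K \<subseteq> real_points UNIV" using K unfolding basic_closed_def by blast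
  obtain e :: "nat \<Rightarrow> 'a" where e: "span (range e) = UNIV"
    using variety affine_coordinate_ring_countable_span unfolding affine_G_variety_def by blast
  have "\<forall>f. \<exists>n c. f = (\<Sum>i<n. c i *\<^sub>R e i)" using span_range_expansion[of _ e] e by simp
  then obtain n c where nc: "\<And>f. f = (\<Sum>i<n f. c f i *\<^sub>R e i)" by metis
  interpret coordinate_expansion e n c by standard (rule nc)
  have L_pos: "0 \<le> L f" if f: "\<And>x. x \<in> K \<Longrightarrow> 0 \<le> x f" for f
  proof -
    \<comment> \<open>A real point is itself a linear functional, so the weak integral may be
      evaluated at \<open>x\<close>: it averages the values of \<open>f\<close> over the orbit of
      \<open>x\<close>, which stays in \<open>K\<close>.\<close>
    have "0 \<le> x (reynolds f)" if x: "x \<in> K" for x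
    proof -
      have "x (reynolds f) = (\<integral>g. x (act (\<gamma> g) f) \<partial>h)"
        using x KR by (intro reynolds real_points_linear) blast
      also have "\<dots> \<ge> 0"
      proof (rule Bochner_Integration.integral_nonneg)
        fix g
        have "move act (\<gamma> g) x \<in> K" using inv x \<gamma>_in unfolding G_invariant_set_def by blast
        from f[OF this] show "0 \<le> x (act (\<gamma> g) f)" by (simp add: move_def)
      qed
      finally show ?thesis .
    qed
    then have "reynolds f \<in> nonneg_on (invariant_ring G act) (quotient_map_points G act ` K)"
      using reynolds_in by (simp add: nonneg_on_def quotient_map_points_def)
    then show "0 \<le> L f" using pos invariant_functional_reynolds[OF L] by fastforce
  qed
  obtain M where M: "sets M = sets (points_borel UNIV K)" "finite_measure M"
    "\<And>f. has_bochner_integral M (\<lambda>x. x f) (L f)"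
    using Haviland_basic_closed[OF K L(1) L_pos] by metis
  show ?rep by (rule average_measure[OF KR inv L M])
qed

lemma subspace_invariant_ring: "subspace (invariant_ring G act)"
  using act_linear by (auto simp: subspace_def invariant_ring_def linear_0 linear_add linear_scale)

lemma reynolds_functional:
  assumes F: "linear_functional_on (invariant_ring G act) F"
  shows "linear (\<lambda>f. F (reynolds f))" "G_invariant_functional G act (\<lambda>f. F (reynolds f))"
proof -
  show "linear (\<lambda>f. F (reynolds f))"
    by (rule linearI) (use F reynolds_in in \<open>simp_all add: linear_functional_on_def
        linear_add[OF reynolds_linear] linear_scale[OF reynolds_linear]\<close>)
  show "G_invariant_functional G act (\<lambda>f. F (reynolds f))"
    by (simp add: G_invariant_functional_def reynolds_act)
qed

lemma quotient_map_in:
  assumes "x \<in> real_points UNIV"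
  shows "quotient_map_points G act x \<in> real_points (invariant_ring G act)"
proof -
  let ?B = "invariant_ring G act"
  have "1 \<in> ?B" "\<And>a b. a \<in> ?B \<Longrightarrow> b \<in> ?B \<Longrightarrow> a + b \<in> ?B \<and> a * b \<in> ?B" "\<And>r a. a \<in> ?B \<Longrightarrow> r *\<^sub>R a \<in> ?B"
    using act_unit act_mult act_linear by (auto simp: invariant_ring_def linear_add linear_scale)
  then show ?thesis
    using assms by (simp add: real_points_def quotient_map_points_def)
qed

lemma quotient_map_measurable:
  assumes K: "K \<subseteq> real_points UNIV"
  shows "quotient_map_points G act \<in>
    measurable (points_borel UNIV K) (points_borel (invariant_ring G act) (quotient_map_points G act ` K))"
proof (rule measurable_measure_of[OF points_topology_subset])
  let ?B = "invariant_ring G act" and ?\<pi> = "quotient_map_points G act"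
  show "?\<pi> \<in> space (points_borel UNIV K) \<rightarrow> ?\<pi> ` K" by (simp add: space_points_borel)
  fix U assume "U \<in> {U. openin (subtopology (points_topology ?B) (?\<pi> ` K)) U}"
  then obtain V where V: "openin (points_topology ?B) V" "U = V \<inter> ?\<pi> ` K"
    by (auto simp: openin_subtopology)
  have "continuous_map (points_topology UNIV) (points_topology ?B) ?\<pi>"
    unfolding points_topology_def[of ?B] continuous_map_in_subtopology
  proof
    show "continuous_map (points_topology UNIV) (product_topology (\<lambda>_. euclideanreal) ?B) ?\<pi>"
      unfolding continuous_map_componentwise
    proof (intro conjI ballI)
      show "?\<pi> ` topspace (points_topology UNIV) \<subseteq> extensional ?B" by (auto simp: quotient_map_points_def)
      fix f assume "f \<in> ?B"
      then have "(\<lambda>x. ?\<pi> x f) = (\<lambda>x. x f)" by (simp add: quotient_map_points_def)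
      then show "continuous_map (points_topology UNIV) euclideanreal (\<lambda>x. ?\<pi> x f)"
        unfolding points_topology_def
        by (auto intro: continuous_map_from_subtopology continuous_map_product_projection)
    qed
    show "?\<pi> \<in> topspace (points_topology UNIV) \<rightarrow> real_points ?B"
      using quotient_map_in by (auto simp: topspace_points_topology)
  qed
  from openin_continuous_map_preimage[OF this V(1)]
  have "openin (subtopology (points_topology UNIV) K) ({x \<in> topspace (points_topology UNIV). ?\<pi> x \<in> V} \<inter> K)"
    by (auto simp: openin_subtopology)
  moreover have "{x \<in> topspace (points_topology UNIV). ?\<pi> x \<in> V} \<inter> K = ?\<pi> -` U \<inter> K"
    using K V(2) by (auto simp: topspace_points_topology)
  ultimately show "?\<pi> -` U \<inter> space (points_borel UNIV K) \<in> sets (points_borel UNIV K)"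
    unfolding space_points_borel sets_points_borel by auto
qed

text \<open>\<open>F\<close> may be arbitrary off the invariant ring, whereas composing it with
  \<open>reynolds\<close> gives an invariant linear functional on the whole ring with the same
  values on invariants. The case already settled on \<open>K\<close> therefore applies.\<close>

lemma moment_measure_iff:
  assumes K: "basic_closed UNIV K" and inv: "G_invariant_set G act K"
    and F: "linear_functional_on (invariant_ring G act) F"
  defines "B \<equiv> invariant_ring G act" and "X \<equiv> quotient_map_points G act ` K"
  shows "(\<exists>M. moment_measure B X M \<and> (\<forall>f\<in>B. F f = (\<integral>x. x f \<partial>M))) \<longleftrightarrow> (\<forall>f\<in>nonneg_on B X. 0 \<le> F f)"
    (is "?rep \<longleftrightarrow> ?pos")
proof
  assume ?rep
  then obtain M where M: "moment_measure B X M" "\<And>f. f \<in> B \<Longrightarrow> F f = (\<integral>x. x f \<partial>M)" by blast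
  have "space M = X"
    using M(1) sets_eq_imp_space_eq[of M] space_points_borel unfolding moment_measure_def by metis
  then show ?pos
    by (auto simp: M(2) nonneg_on_def intro!: Bochner_Integration.integral_nonneg)
next
  assume pos: ?pos
  have KR: "K \<subseteq> real_points UNIV" using K unfolding basic_closed_def by blast
  have XR: "X \<subseteq> real_points B" using KR quotient_map_in by (auto simp: X_def B_def)
  have FR: "F (reynolds f) = F f" if "f \<in> B" for f using reynolds_id that by (simp add: B_def)
  have "\<forall>f\<in>nonneg_on B X. 0 \<le> F (reynolds f)"
    using pos FR by (simp add: nonneg_on_def)
  then obtain M where M: "moment_measure UNIV K M" "\<And>f. F (reynolds f) = (\<integral>x. x f \<partial>M)"
    using invariant_moment_measure_iff[OF K inv reynolds_functional[OF F]] unfolding B_def X_def by blast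
  have sM: "sets M = sets (points_borel UNIV K)" and iM: "integrable M (\<lambda>x. x f)" for f
    using M(1) unfolding moment_measure_def by auto
  let ?\<pi> = "quotient_map_points G act"
  have \<pi>: "?\<pi> \<in> measurable M (points_borel B X)"
    unfolding measurable_cong_sets[OF sM refl] B_def X_def by (rule quotient_map_measurable[OF KR])
  have \<pi>f: "?\<pi> x f = x f" if "f \<in> B" for x f using that by (simp add: quotient_map_points_def B_def)
  show ?rep
  proof (intro exI conjI ballI)
    show "moment_measure B X (distr M (points_borel B X) ?\<pi>)"
      unfolding moment_measure_def
    proof (intro conjI ballI)
      show "integrable (distr M (points_borel B X) ?\<pi>) (\<lambda>x. x f)" if "f \<in> B" for f
        using iM[of f] by (subst integrable_distr_eq[OF \<pi> evaluation_measurable[OF XR that]]) (simp add: \<pi>f that)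
    qed simp
    fix f assume f: "f \<in> B"
    have "(\<integral>x. x f \<partial>distr M (points_borel B X) ?\<pi>) = (\<integral>x. x f \<partial>M)"
      by (subst integral_distr[OF \<pi> evaluation_measurable[OF XR f]]) (simp add: \<pi>f f)
    then show "F f = (\<integral>x. x f \<partial>distr M (points_borel B X) ?\<pi>)"
      using M(2)[of f] FR[OF f] by simp
  qed
qed

end

text \<open>A form of the bipolar theorem. The points of \<open>X\<close> are themselves functionals
  nonnegative on \<open>nonneg_on B X\<close>; when the dual cones agree they are nonnegative on
  \<open>N\<close> and on its closure, which gives one inclusion. A functional separating a point
  from the closure would contradict the agreement, which gives the other.\<close>

lemma closure_of_cone_eq_nonneg_on_iff:
  assumes B: "subspace B" and NB: "N \<subseteq> B" and N0: "0 \<in> N"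
    and N: "\<And>a b. a \<in> N \<Longrightarrow> b \<in> N \<Longrightarrow> a + b \<in> N" "\<And>a c. a \<in> N \<Longrightarrow> 0 \<le> c \<Longrightarrow> c *\<^sub>R a \<in> N"
    and X: "\<And>x. x \<in> X \<Longrightarrow> linear_functional_on B x"
  shows "finest_locally_convex_topology B closure_of N = nonneg_on B X \<longleftrightarrow>
    (\<forall>F. linear_functional_on B F \<longrightarrow> ((\<forall>f\<in>N. 0 \<le> F f) \<longleftrightarrow> (\<forall>f\<in>nonneg_on B X. 0 \<le> F f)))"
    (is "?cl = ?P \<longleftrightarrow> ?dual")
proof
  have top: "topspace (finest_locally_convex_topology B) = B"
    using locally_convex_vector_topology_finest[OF B] by (simp add: locally_convex_vector_topology_def)
  have cl_B: "?cl \<subseteq> B" using closure_of_subset_topspace top by metis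
  have N_cl: "N \<subseteq> ?cl" using closure_of_subset NB top by metis
  {
    assume eq: "?cl = ?P"
    show ?dual
    proof (intro allI impI iffI ballI)
      fix F f assume F: "linear_functional_on B F"
      show "0 \<le> F f" if "\<forall>f\<in>N. 0 \<le> F f" "f \<in> ?P"
        using closure_of_finest_locally_convex_nonneg[OF B F] that eq by blast
      show "0 \<le> F f" if "\<forall>f\<in>?P. 0 \<le> F f" "f \<in> N" using that N_cl eq by blast
    qed
  }
  assume dual: ?dual
  show "?cl = ?P"
  proof
    show "?cl \<subseteq> ?P"
    proof
      fix p assume p: "p \<in> ?cl"
      have "0 \<le> x p" if x: "x \<in> X" for x
      proof (rule closure_of_finest_locally_convex_nonneg[OF B X[OF x] _ p])
        have "\<forall>f\<in>?P. 0 \<le> x f" using x by (simp add: nonneg_on_def)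
        then show "0 \<le> x f" if "f \<in> N" for f using dual X[OF x] that by blast
      qed
      moreover have "p \<in> B" using cl_B p by (rule subsetD)
      ultimately show "p \<in> ?P" by (simp add: nonneg_on_def)
    qed
    show "?P \<subseteq> ?cl"
    proof
      fix p assume p: "p \<in> ?P"
      show "p \<in> ?cl"
      proof (rule ccontr)
        assume np: "p \<notin> ?cl"
        have "p \<in> B" using p by (simp add: nonneg_on_def)
        then obtain F where F: "linear_functional_on B F" "\<And>f. f \<in> N \<Longrightarrow> 0 \<le> F f" "F p < 0"
          using separate_from_closure_of_cone[OF B NB N0 N _ np] by metis
        then have "\<forall>f\<in>?P. 0 \<le> F f" using dual by blast
        then show False using p F(3) by force
      qed
    qed
  qed
qed

text \<open>A nonnegative scalar is the square of \<open>sqrt c\<close>, so a quadratic module is a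
  convex cone; \<open>c = 0\<close> shows that it contains 0.\<close>

lemma quadratic_module_scaleR:
  assumes "quadratic_module B N" "1 \<in> B" "subspace B" "f \<in> N" "0 \<le> c"
  shows "c *\<^sub>R f \<in> N"
proof -
  have "(sqrt c *\<^sub>R 1) \<^sup>2 * f \<in> N"
    using assms unfolding quadratic_module_def by (simp add: subspace_scale)
  moreover have "(sqrt c *\<^sub>R 1)\<^sup>2 * f = c *\<^sub>R f"
    using assms(5) by (simp add: power2_eq_square)
  ultimately show ?thesis by simp
qed

theorem corollary6p13:
  fixes G :: "(real^'n^'n) set"
    and act :: "real^'n^'n \<Rightarrow> 'a \<Rightarrow> 'a::real_comm_algebra"
    and K :: "('a \<Rightarrow> real) set"
    and N :: "'a set"
  assumes "linear_algebraic_group G" and "compact G"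
    and "affine_G_variety G act"
    and "basic_closed UNIV K" and "G_invariant_set G act K"
    and "quadratic_module (invariant_ring G act) N"
  shows "(solves_invariant_moment_problem G act K N \<longleftrightarrow>
            finest_locally_convex_topology (invariant_ring G act) closure_of N
              = nonneg_on (invariant_ring G act) (quotient_map_points G act ` K)) \<and>
         (finest_locally_convex_topology (invariant_ring G act) closure_of N
              = nonneg_on (invariant_ring G act) (quotient_map_points G act ` K) \<longleftrightarrow>
            solves_moment_problem (invariant_ring G act) (quotient_map_points G act ` K) N)"
proof -
  let ?B = "invariant_ring G act" and ?X = "quotient_map_points G act ` K"
  let ?P = "nonneg_on ?B ?X"
  let ?dual = "\<forall>F. linear_functional_on ?B F \<longrightarrow> ((\<forall>f\<in>N. 0 \<le> F f) \<longleftrightarrow> (\<forall>f\<in>?P. 0 \<le> F f))"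
  obtain h where h: "finite_measure h" "measure h UNIV = 1" "sets h = sets borel" "AE a in h. a \<in> G"
      "\<And>k. k \<in> G \<Longrightarrow> distr h borel (\<lambda>a. k ** a) = h" "\<And>k. k \<in> G \<Longrightarrow> distr h borel (\<lambda>a. a ** k) = h"
    by (rule Haar_measure_compact_matrix_group[of G])
       (use assms(1,2) in \<open>auto simp: linear_algebraic_group_def\<close>)
  interpret compact_group_action G act h
    using assms(1-3) h by (rule compact_group_action.intro)
  have sub: "subspace ?B" by (rule subspace_invariant_ring)
  have one: "1 \<in> ?B" using act_unit by (simp add: invariant_ring_def)
  note Q = assms(6)
  have N: "N \<subseteq> ?B" "1 \<in> N" "\<And>a b. a \<in> N \<Longrightarrow> b \<in> N \<Longrightarrow> a + b \<in> N"
    using Q unfolding quadratic_module_def by auto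
  have "0 \<in> N" using quadratic_module_scaleR[OF Q one sub N(2), of 0] by simp
  moreover have "linear_functional_on ?B x" if "x \<in> ?X" for x
    using that assms(4) quotient_map_in
    by (force simp: basic_closed_def linear_functional_on_def real_points_def)
  ultimately have closure: "finest_locally_convex_topology ?B closure_of N = ?P \<longleftrightarrow> ?dual"
    by (intro closure_of_cone_eq_nonneg_on_iff sub N quadratic_module_scaleR[OF Q one sub])
  have moment: "solves_moment_problem ?B ?X N \<longleftrightarrow> ?dual"
    unfolding solves_moment_problem_def using moment_measure_iff[OF assms(4,5)] by auto
  have "solves_invariant_moment_problem G act K N \<longleftrightarrow> (\<forall>L. linear L \<and> G_invariant_functional G act L \<longrightarrow>
      ((\<forall>f\<in>?P. 0 \<le> L f) \<longleftrightarrow> (\<forall>f\<in>N. 0 \<le> L f)))"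
    unfolding solves_invariant_moment_problem_def
    using invariant_moment_measure_iff[OF assms(4,5)] by auto
  also have "\<dots> \<longleftrightarrow> ?dual"
  proof
    assume inv: "\<forall>L. linear L \<and> G_invariant_functional G act L \<longrightarrow>
      ((\<forall>f\<in>?P. 0 \<le> L f) \<longleftrightarrow> (\<forall>f\<in>N. 0 \<le> L f))"
    show ?dual
    proof (intro allI impI)
      fix F assume F: "linear_functional_on ?B F"
      \<comment> \<open>\<open>F\<close> is linear on the invariant ring only, while the condition
        on invariant functionals speaks of the whole ring. \<open>N\<close> and \<open>?P\<close>
        consist of invariants, where passing to \<open>F (reynolds f)\<close> changes
        nothing.\<close>
      have "F (reynolds f) = F f" if "f \<in> N \<or> f \<in> ?P" for f
        using reynolds_id[of f] that N(1) by (auto simp: nonneg_on_def)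
      then show "(\<forall>f\<in>N. 0 \<le> F f) \<longleftrightarrow> (\<forall>f\<in>?P. 0 \<le> F f)"
        using inv reynolds_functional[OF F] by auto
    qed
  next
    assume dual: ?dual
    show "\<forall>L. linear L \<and> G_invariant_functional G act L \<longrightarrow>
      ((\<forall>f\<in>?P. 0 \<le> L f) \<longleftrightarrow> (\<forall>f\<in>N. 0 \<le> L f))"
    proof (intro allI impI)
      fix L :: "'a \<Rightarrow> real" assume "linear L \<and> G_invariant_functional G act L"
      then have "linear_functional_on ?B L" by (simp add: linear_functional_on_def linear_add linear_scale)
      then show "(\<forall>f\<in>?P. 0 \<le> L f) \<longleftrightarrow> (\<forall>f\<in>N. 0 \<le> L f)" using dual by blast
    qed
  qed
  finally show ?thesis using closure moment by blast
qed

end
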